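(* Let $a,b$ be coprime positive integers, $X=\{x^ay^b=1\}\subset(\mathbb{C}^* )^2$ and $W=x+y:X\to\mathbb{C}$. Let $\gamma_0,\dots,\gamma_{a+b-1}$ be the straight line segments joining the origin to the critical values $\lambda_0,\dots,\lambda_{a+b-1}$ of $W$. Then, for suitable gradings of the vanishing cycles, $\mathrm{Lag_{vc}}(W,\{\gamma_j\})$ is a DG category, equivalent to $\mathfrak{C}_\theta$ for any $\theta\in\mathrm{M}(2,\mathbb{C}^* )$.
   Context: **The DG category $\mathfrak{C}_\theta$.** Write $(a_0,a_1)=(a,b)$, $l=a+b$. $\mathrm{M}(2,\mathbb{C}^* )$ is the set of $2\times2$ matrices $\theta=(\theta_{ij})_{0\le i,j\le1}$ with all entries in $\mathbb{C}^*$. $\Lambda_\theta^\bullet=\bigoplus_{p,i}(\Lambda_\theta)^p_i$ is the bigraded algebra (trivial differential) generated by $y_0,y_1$, $y_i\in(\Lambda_\theta)^1_{-a_i}$, with relations $\theta_{ij}y_iy_j+\theta_{ji}y_jy_i=0$ for all $i,j$ (in particular $y_i^2=0$). $\mathfrak{C}_\theta$ is the DG category with trivial differentials having objects $w_0,\dots,w_{l-1}$ and $\mathrm{Hom}^\bullet(w_j,w_i)=(\Lambda_\theta^\bullet)_{i-j}$, with composition induced by multiplication in $\Lambda^\bullet_\theta$. **Critical values and arcs.** The critical values of $W$ are $\lambda_j=\lambda_0e^{-2\pi ij/(a+b)}$, $0\le j<a+b$, where $\lambda_0$ is the positive real root of $\lambda^{a+b}=\frac{(a+b)^{a+b}}{a^ab^b}$.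 The reference fiber $\Sigma_0=W^{-1}(0)$ is a set of $a+b$ points. **Lagrangian vanishing cycles.** The vanishing cycle $L_j\subset\Sigma_0$ is the pair of points of $\Sigma_0$ which merge when the fiber $W^{-1}(\lambda)$ is followed as $\lambda$ moves along $\gamma_j$ from $0$ to $\lambda_j$; it is the boundary of the Lefschetz thimble $D_j\subset X$, an arc mapped by $W$ to $\gamma_j$. $\mathrm{Lag_{vc}}(W,\{\gamma_j\})$ is the $A_\infty$-category over $\mathbb{C}$ with objects $L_0,\dots,L_{a+b-1}$, with $\mathrm{Hom}(L_i,L_j)=CF^*(L_i,L_j;\mathbb{C})=\mathbb{C}^{|L_i\cap L_j|}$ if $i<j$, $\mathbb{C}\cdot\mathrm{id}$ if $i=j$, and $0$ if $i>j$. The operations $m_k$ (of degree $2-k$) are zero unless $i_0<\dots<i_k$ (except for the obvious $m_2$ with identity morphisms); for $i_0<\dots<i_k$ they are defined by counting pseudo-holomorphic discs in $\Sigma_0$ (necessarily constant) with marked boundary points sent to the given intersection points and boundary arcs on $L_{i_0},\dots,L_{i_k}$. **Grading.** Let $\Omega$ be the holomorphic 1-form on $X$ with $\Omega\wedge\left(\frac{a}{x}dx+\frac{b}{y}dy\right)=\frac{dx\wedge dy}{xy}$, and write $\Omega=\Theta\,dW$ near $\Sigma_0$. The phase of $L_j$ is $\phi_{L_j}=\arg\Theta:L_j\to\mathbb{R}/\pi\mathbb{Z}$. A grading of $L_j$ is a real lift $\tilde\phi_{L_j}$ of $\phi_{L_j}$ which is induced by a continuous real lift of the phase $\arg\Omega(v)$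 ($v$ tangent to $D_j$) along the thimble $D_j$; such a choice is unique up to an overall shift by integer multiples of $\pi$. The degree of an intersection point $p\in L_i\cap L_j$ ($i<j$) is $\frac1\pi(\tilde\phi_{L_j}(p)-\tilde\phi_{L_i}(p))$. *)

theory Defs
  imports
    "HOL-Analysis.Analysis"
    "HOL-Library.Poly_Mapping"
    "HOL-Algebra.Algebraic_Closure_Type"
begin

(* otherwise X cannot be used as a variable name *)
no_notation var (\<open>X\<index>\<close>)

section \<open>DG categories over the complex numbers\<close>

abbreviation CC :: "complex ring" where
  "CC \<equiv> ring_of_type_algebra"

record ('o, 'm) graded_quiver =
  Ob :: "'o set"
  Hom :: "'o \<Rightarrow> 'o \<Rightarrow> (complex, 'm) module"
  HomDeg :: "'o \<Rightarrow> 'o \<Rightarrow> int \<Rightarrow> 'm set"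
  Ident :: "'o \<Rightarrow> 'm"

text \<open>Composition is written in the usual order: \<open>Comp A X Y Z g f\<close> is \<open>g\<close> after \<open>f\<close>, for
  \<open>f\<close> in \<open>Hom A X Y\<close> and \<open>g\<close> in \<open>Hom A Y Z\<close>.\<close>

record ('o, 'm) dg_cat = "('o, 'm) graded_quiver" +
  Diff :: "'o \<Rightarrow> 'o \<Rightarrow> 'm \<Rightarrow> 'm"
  Comp :: "'o \<Rightarrow> 'o \<Rightarrow> 'o \<Rightarrow> 'm \<Rightarrow> 'm \<Rightarrow> 'm"

definition C_linear :: "(complex, 'm) module \<Rightarrow> (complex, 'n) module \<Rightarrow> ('m \<Rightarrow> 'n) \<Rightarrow> bool" where
  "C_linear M N h \<longleftrightarrow>
     h \<in> carrier M \<rightarrow> carrier N \<and>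
     (\<forall>x\<in>carrier M. \<forall>y\<in>carrier M. h (x \<oplus>\<^bsub>M\<^esub> y) = h x \<oplus>\<^bsub>N\<^esub> h y) \<and>
     (\<forall>c. \<forall>x\<in>carrier M. h (c \<odot>\<^bsub>M\<^esub> x) = c \<odot>\<^bsub>N\<^esub> h x)"

definition graded_module :: "(complex, 'm) module \<Rightarrow> (int \<Rightarrow> 'm set) \<Rightarrow> bool" where
  "graded_module M D \<longleftrightarrow>
     Module.module CC M \<and>
     (\<forall>n. submodule (D n) CC M) \<and>
     (\<forall>x\<in>carrier M. \<exists>!c. (\<forall>n. c n \<in> D n) \<and> finite {n. c n \<noteq> \<zero>\<^bsub>M\<^esub>} \<and>
        x = finsum M c {n. c n \<noteq> \<zero>\<^bsub>M\<^esub>})"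

locale dg_category =
  fixes A :: "('o, 'm) dg_cat"
  assumes hom_graded: "\<lbrakk>X \<in> Ob A; Y \<in> Ob A\<rbrakk> \<Longrightarrow> graded_module (Hom A X Y) (HomDeg A X Y)"
    and diff_linear: "\<lbrakk>X \<in> Ob A; Y \<in> Ob A\<rbrakk> \<Longrightarrow> C_linear (Hom A X Y) (Hom A X Y) (Diff A X Y)"
    and diff_degree: "\<lbrakk>X \<in> Ob A; Y \<in> Ob A; f \<in> HomDeg A X Y n\<rbrakk>
      \<Longrightarrow> Diff A X Y f \<in> HomDeg A X Y (n + 1)"
    and diff_diff: "\<lbrakk>X \<in> Ob A; Y \<in> Ob A; f \<in> carrier (Hom A X Y)\<rbrakk>
      \<Longrightarrow> Diff A X Y (Diff A X Y f) = \<zero>\<^bsub>Hom A X Y\<^esub>"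
    and comp_linear_left: "\<lbrakk>X \<in> Ob A; Y \<in> Ob A; Z \<in> Ob A; f \<in> carrier (Hom A X Y)\<rbrakk>
      \<Longrightarrow> C_linear (Hom A Y Z) (Hom A X Z) (\<lambda>g. Comp A X Y Z g f)"
    and comp_linear_right: "\<lbrakk>X \<in> Ob A; Y \<in> Ob A; Z \<in> Ob A; g \<in> carrier (Hom A Y Z)\<rbrakk>
      \<Longrightarrow> C_linear (Hom A X Y) (Hom A X Z) (\<lambda>f. Comp A X Y Z g f)"
    and comp_degree: "\<lbrakk>X \<in> Ob A; Y \<in> Ob A; Z \<in> Ob A; f \<in> HomDeg A X Y m; g \<in> HomDeg A Y Z n\<rbrakk>
      \<Longrightarrow> Comp A X Y Z g f \<in> HomDeg A X Z (n + m)"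
    and leibniz: "\<lbrakk>X \<in> Ob A; Y \<in> Ob A; Z \<in> Ob A; f \<in> carrier (Hom A X Y); g \<in> HomDeg A Y Z n\<rbrakk>
      \<Longrightarrow> Diff A X Z (Comp A X Y Z g f) =
            Comp A X Y Z (Diff A Y Z g) f
              \<oplus>\<^bsub>Hom A X Z\<^esub> ((-1) powi n) \<odot>\<^bsub>Hom A X Z\<^esub> Comp A X Y Z g (Diff A X Y f)"
    and comp_assoc: "\<lbrakk>X \<in> Ob A; Y \<in> Ob A; Z \<in> Ob A; V \<in> Ob A; f \<in> carrier (Hom A X Y);
        g \<in> carrier (Hom A Y Z); h \<in> carrier (Hom A Z V)\<rbrakk>
      \<Longrightarrow> Comp A X Z V h (Comp A X Y Z g f) = Comp A X Y V (Comp A Y Z V h g) f"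
    and ident_degree: "X \<in> Ob A \<Longrightarrow> Ident A X \<in> HomDeg A X X 0"
    and ident_closed: "X \<in> Ob A \<Longrightarrow> Diff A X X (Ident A X) = \<zero>\<^bsub>Hom A X X\<^esub>"
    and ident_right: "\<lbrakk>X \<in> Ob A; Y \<in> Ob A; f \<in> carrier (Hom A X Y)\<rbrakk>
      \<Longrightarrow> Comp A X X Y f (Ident A X) = f"
    and ident_left: "\<lbrakk>X \<in> Ob A; Y \<in> Ob A; f \<in> carrier (Hom A X Y)\<rbrakk>
      \<Longrightarrow> Comp A X Y Y (Ident A Y) f = f"

definition dg_functor ::
  "('o, 'm) dg_cat \<Rightarrow> ('p, 'n) dg_cat \<Rightarrow> ('o \<Rightarrow> 'p) \<Rightarrow> ('o \<Rightarrow> 'o \<Rightarrow> 'm \<Rightarrow> 'n) \<Rightarrow> bool" where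
  "dg_functor A B F \<Phi> \<longleftrightarrow>
     F \<in> Ob A \<rightarrow> Ob B \<and>
     (\<forall>X\<in>Ob A. \<forall>Y\<in>Ob A.
        C_linear (Hom A X Y) (Hom B (F X) (F Y)) (\<Phi> X Y) \<and>
        (\<forall>n. \<Phi> X Y ` HomDeg A X Y n \<subseteq> HomDeg B (F X) (F Y) n) \<and>
        (\<forall>f\<in>carrier (Hom A X Y). \<Phi> X Y (Diff A X Y f) = Diff B (F X) (F Y) (\<Phi> X Y f))) \<and>
     (\<forall>X\<in>Ob A. \<Phi> X X (Ident A X) = Ident B (F X)) \<and>
     (\<forall>X\<in>Ob A. \<forall>Y\<in>Ob A. \<forall>Z\<in>Ob A. \<forall>f\<in>carrier (Hom A X Y). \<forall>g\<in>carrier (Hom A Y Z).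
        \<Phi> X Z (Comp A X Y Z g f) = Comp B (F X) (F Y) (F Z) (\<Phi> Y Z g) (\<Phi> X Y f))"

definition dg_isomorphic :: "('o, 'm) dg_cat \<Rightarrow> 'o \<Rightarrow> 'o \<Rightarrow> bool" where
  "dg_isomorphic A X Y \<longleftrightarrow>
     (\<exists>f\<in>HomDeg A X Y 0. \<exists>g\<in>HomDeg A Y X 0.
        Diff A X Y f = \<zero>\<^bsub>Hom A X Y\<^esub> \<and> Diff A Y X g = \<zero>\<^bsub>Hom A Y X\<^esub> \<and>
        Comp A X Y X g f = Ident A X \<and> Comp A Y X Y f g = Ident A Y)"

definition dg_equivalent :: "('o, 'm) dg_cat \<Rightarrow> ('p, 'n) dg_cat \<Rightarrow> bool" where
  "dg_equivalent A B \<longleftrightarrow>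
     (\<exists>F \<Phi>. dg_functor A B F \<Phi> \<and>
        (\<forall>X\<in>Ob A. \<forall>Y\<in>Ob A.
           bij_betw (\<Phi> X Y) (carrier (Hom A X Y)) (carrier (Hom B (F X) (F Y))) \<and>
           (\<forall>n. bij_betw (\<Phi> X Y) (HomDeg A X Y n) (HomDeg B (F X) (F Y) n))) \<and>
        (\<forall>Z\<in>Ob B. \<exists>X\<in>Ob A. dg_isomorphic B (F X) Z))"

text \<open>\<open>Mu A [X\<^sub>0, ..., X\<^sub>k] [f\<^sub>1, ..., f\<^sub>k]\<close> is \<open>m\<^sub>k(f\<^sub>k, ..., f\<^sub>1)\<close> for \<open>f\<^sub>s\<close> in
  \<open>Hom A X\<^sub>s\<^sub>-\<^sub>1 X\<^sub>s\<close>. Signs follow the convention in which a DG category is exactly an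
  \<open>A\<^sub>\<infinity>\<close>-category with \<open>m\<^sub>k = 0\<close> for \<open>k \<ge> 3\<close>, the differential being \<open>m\<^sub>1\<close> and the composition
  \<open>g \<circ> f\<close> being \<open>m\<^sub>2(g, f)\<close>; for such operations the \<open>A\<^sub>\<infinity>\<close>-relations are the axioms of a DG
  category.\<close>

record ('o, 'm) ainf_cat = "('o, 'm) graded_quiver" +
  Mu :: "'o list \<Rightarrow> 'm list \<Rightarrow> 'm"

definition dg_of_ainf :: "('o, 'm) ainf_cat \<Rightarrow> ('o, 'm) dg_cat" where
  "dg_of_ainf A =
     \<lparr>Ob = Ob A, Hom = Hom A, HomDeg = HomDeg A, Ident = Ident A,
      Diff = (\<lambda>X Y f. Mu A [X, Y] [f]),
      Comp = (\<lambda>X Y Z g f. Mu A [X, Y, Z] [f, g])\<rparr>"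

definition ainf_is_dg :: "('o, 'm) ainf_cat \<Rightarrow> bool" where
  "ainf_is_dg A \<longleftrightarrow>
     (\<forall>Xs fs. length fs \<ge> 3 \<and> length Xs = length fs + 1 \<and> set Xs \<subseteq> Ob A \<and>
        (\<forall>s<length fs. fs ! s \<in> carrier (Hom A (Xs ! s) (Xs ! Suc s)))
        \<longrightarrow> Mu A Xs fs = \<zero>\<^bsub>Hom A (hd Xs) (last Xs)\<^esub>) \<and>
     dg_category (dg_of_ainf A)"


section \<open>The algebra \<open>\<Lambda>\<^sub>\<theta>\<close> and the category \<open>C\<^sub>\<theta>\<close>\<close>

text \<open>The indices 0 and 1 are the two elements of the type \<open>2\<close>. Words in them form the free
  monoid, here written additively so that \<open>word \<Rightarrow>\<^sub>0 complex\<close>, with the convolution product, is the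
  free associative algebra on \<open>y\<^sub>0, y\<^sub>1\<close>.\<close>

datatype word = Word (letters: "2 list")

instantiation word :: monoid_add
begin

definition zero_word :: word where "0 = Word []"

definition plus_word :: "word \<Rightarrow> word \<Rightarrow> word" where "u + v = Word (letters u @ letters v)"

instance
  by standard (simp_all add: zero_word_def plus_word_def)

end

type_synonym free_alg = "word \<Rightarrow>\<^sub>0 complex"

definition ygen :: "2 \<Rightarrow> free_alg" where
  "ygen i = Poly_Mapping.single (Word [i]) 1"

definition scal :: "complex \<Rightarrow> free_alg" where
  "scal c = Poly_Mapping.single 0 c"

abbreviation FA :: "free_alg ring" where
  "FA \<equiv> ring_of_type_algebra"

definition Lambda_ideal :: "complex^2^2 \<Rightarrow> free_alg set" where
  "Lambda_ideal \<theta> =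
     Idl\<^bsub>FA\<^esub> {scal (\<theta> $ i $ j) * ygen i * ygen j + scal (\<theta> $ j $ i) * ygen j * ygen i | i j. True}"

definition Lambda :: "complex^2^2 \<Rightarrow> free_alg set ring" where
  "Lambda \<theta> = FA Quot Lambda_ideal \<theta>"

definition Lambda_proj :: "complex^2^2 \<Rightarrow> free_alg \<Rightarrow> free_alg set" where
  "Lambda_proj \<theta> f = Lambda_ideal \<theta> +>\<^bsub>FA\<^esub> f"

text \<open>The internal grading, in which \<open>y\<^sub>i\<close> has weight \<open>-a\<^sub>i\<close> with \<open>(a\<^sub>0, a\<^sub>1) = (a, b)\<close>.\<close>

definition weight :: "nat \<Rightarrow> nat \<Rightarrow> word \<Rightarrow> int" where
  "weight a b w = (\<Sum>i\<leftarrow>letters w. - int (if i = 0 then a else b))"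

definition Lambda_weight :: "nat \<Rightarrow> nat \<Rightarrow> complex^2^2 \<Rightarrow> int \<Rightarrow> free_alg set set" where
  "Lambda_weight a b \<theta> n =
     Lambda_proj \<theta> ` {f. \<forall>w\<in>Poly_Mapping.keys f. weight a b w = n}"

definition Lambda_bideg :: "nat \<Rightarrow> nat \<Rightarrow> complex^2^2 \<Rightarrow> int \<Rightarrow> int \<Rightarrow> free_alg set set" where
  "Lambda_bideg a b \<theta> p n =
     Lambda_proj \<theta> ` {f. \<forall>w\<in>Poly_Mapping.keys f. int (length (letters w)) = p \<and> weight a b w = n}"

text \<open>The object \<open>w\<^sub>j\<close> is represented by \<open>j\<close>.\<close>

definition C_theta :: "nat \<Rightarrow> nat \<Rightarrow> complex^2^2 \<Rightarrow> (nat, free_alg set) dg_cat" where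
  "C_theta a b \<theta> =
     \<lparr>Ob = {..<a + b},
      Hom = (\<lambda>j i.
        \<lparr>carrier = Lambda_weight a b \<theta> (int i - int j),
         monoid.mult = monoid.mult (Lambda \<theta>), one = \<one>\<^bsub>Lambda \<theta>\<^esub>,
         zero = \<zero>\<^bsub>Lambda \<theta>\<^esub>, add = add (Lambda \<theta>),
         smult = (\<lambda>c x. Lambda_proj \<theta> (scal c) \<otimes>\<^bsub>Lambda \<theta>\<^esub> x)\<rparr>),
      HomDeg = (\<lambda>j i p. Lambda_bideg a b \<theta> p (int i - int j)),
      Ident = (\<lambda>j. \<one>\<^bsub>Lambda \<theta>\<^esub>),
      Diff = (\<lambda>j i f. \<zero>\<^bsub>Lambda \<theta>\<^esub>),
      Comp = (\<lambda>k j i g f. g \<otimes>\<^bsub>Lambda \<theta>\<^esub> f)\<rparr>"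


section \<open>The Landau--Ginzburg model\<close>

type_synonym point = "complex \<times> complex"

definition LG_X :: "nat \<Rightarrow> nat \<Rightarrow> point set" where
  "LG_X a b = {(x, y). x \<noteq> 0 \<and> y \<noteq> 0 \<and> x ^ a * y ^ b = 1}"

definition LG_W :: "point \<Rightarrow> complex" where
  "LG_W p = fst p + snd p"

definition fiber0 :: "nat \<Rightarrow> nat \<Rightarrow> point set" where
  "fiber0 a b = {p \<in> LG_X a b. LG_W p = 0}"

definition crit_value :: "nat \<Rightarrow> nat \<Rightarrow> nat \<Rightarrow> complex" where
  "crit_value a b j =
     complex_of_real (root (a + b) (real ((a + b) ^ (a + b)) / real (a ^ a * b ^ b)))
       * exp (- (2 * pi * \<i> * of_nat j / of_nat (a + b)))"

definition seg :: "nat \<Rightarrow> nat \<Rightarrow> nat \<Rightarrow> real \<Rightarrow> complex" where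
  "seg a b j = linepath 0 (crit_value a b j)"

text \<open>A lift of \<open>\<gamma>\<close> follows a point of the fiber of \<open>W\<close> along \<open>\<gamma>\<close>, up to and including the
  critical value at the end of \<open>\<gamma>\<close>.\<close>

definition is_lift :: "nat \<Rightarrow> nat \<Rightarrow> (real \<Rightarrow> complex) \<Rightarrow> (real \<Rightarrow> point) \<Rightarrow> bool" where
  "is_lift a b \<gamma> c \<longleftrightarrow>
     path c \<and> path_image c \<subseteq> LG_X a b \<and> (\<forall>t\<in>{0..1}. LG_W (c t) = \<gamma> t)"

definition vanishing_cycle :: "nat \<Rightarrow> nat \<Rightarrow> (real \<Rightarrow> complex) \<Rightarrow> point set" where
  "vanishing_cycle a b \<gamma> =
     {p \<in> fiber0 a b. \<exists>q\<in>fiber0 a b. q \<noteq> p \<and>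
        (\<exists>c d. is_lift a b \<gamma> c \<and> is_lift a b \<gamma> d \<and>
           pathstart c = p \<and> pathstart d = q \<and> pathfinish c = pathfinish d)}"

definition thimble :: "nat \<Rightarrow> nat \<Rightarrow> (real \<Rightarrow> complex) \<Rightarrow> point set" where
  "thimble a b \<gamma> =
     \<Union> {path_image c | c. is_lift a b \<gamma> c \<and> pathstart c \<in> vanishing_cycle a b \<gamma>}"


section \<open>Gradings\<close>

text \<open>The 1-form \<open>(a/x) dx + (b/y) dy\<close>, whose kernel at a point of \<open>X\<close> is the tangent space of
  \<open>X\<close>.\<close>

definition eta :: "nat \<Rightarrow> nat \<Rightarrow> point \<Rightarrow> point \<Rightarrow> complex" where
  "eta a b p v = of_nat a / fst p * fst v + of_nat b / snd p * snd v"

definition tangent_X :: "nat \<Rightarrow> nat \<Rightarrow> point \<Rightarrow> point set" where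
  "tangent_X a b p = {v. eta a b p v = 0}"

text \<open>Evaluating \<open>\<Omega> \<and> \<eta> = (dx \<and> dy)/(x y)\<close> on \<open>(v, w)\<close> with \<open>v\<close> tangent to \<open>X\<close> gives
  \<open>\<Omega>(v) \<eta>(w) = (v\<^sub>1 w\<^sub>2 - v\<^sub>2 w\<^sub>1)/(x y)\<close> for all \<open>w\<close>, since \<open>\<eta>(v) = 0\<close>. This determines \<open>\<Omega>\<close> on
  tangent vectors of \<open>X\<close>; it has no meaning on other vectors.\<close>

definition Omega :: "nat \<Rightarrow> nat \<Rightarrow> point \<Rightarrow> point \<Rightarrow> complex" where
  "Omega a b p v =
     (THE z. \<forall>w. z * eta a b p w = (fst v * snd w - snd v * fst w) / (fst p * snd p))"

text \<open>\<open>\<Omega> = \<Theta> dW\<close> on \<open>X\<close> near the reference fiber. As \<open>W\<close> is the restriction of a linear map, it is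
  its own derivative.\<close>

definition Theta :: "nat \<Rightarrow> nat \<Rightarrow> point \<Rightarrow> complex" where
  "Theta a b p = (THE z. \<forall>v\<in>tangent_X a b p. Omega a b p v = z * LG_W v)"

text \<open>\<open>r\<close> is a real lift of the class of the argument of \<open>z\<close> modulo \<open>\<pi>\<close>.\<close>

definition lifts_arg :: "real \<Rightarrow> complex \<Rightarrow> bool" where
  "lifts_arg r z \<longleftrightarrow> (\<exists>k::int. r = Arg z + of_int k * pi)"

definition regular_param :: "(real \<Rightarrow> point) \<Rightarrow> (real \<Rightarrow> point) \<Rightarrow> point set \<Rightarrow> bool" where
  "regular_param g g' D \<longleftrightarrow>
     inj_on g {0..1} \<and> g ` {0..1} = D \<and> continuous_on {0..1} g' \<and>
     (\<forall>t\<in>{0..1}. (g has_vector_derivative g' t) (at t within {0..1}) \<and> g' t \<noteq> 0)"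

text \<open>The lift \<open>\<psi>\<close> of the phase of the thimble induces the grading \<open>\<phi>\<close>: as \<open>W\<close> maps the thimble to
  a segment, \<open>arg dW(v)\<close> is constant modulo \<open>\<pi>\<close> along it, and hence \<open>arg \<Omega>(v)\<close> and \<open>arg \<Theta>\<close> differ on
  the vanishing cycle by a constant \<open>\<kappa>\<close>, the same at both points.\<close>

definition is_grading :: "nat \<Rightarrow> nat \<Rightarrow> (real \<Rightarrow> complex) \<Rightarrow> (point \<Rightarrow> real) \<Rightarrow> bool" where
  "is_grading a b \<gamma> \<phi> \<longleftrightarrow>
     (\<forall>p\<in>vanishing_cycle a b \<gamma>. lifts_arg (\<phi> p) (Theta a b p)) \<and>
     (\<exists>g g' \<psi> \<kappa>. regular_param g g' (thimble a b \<gamma>) \<and>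
        continuous_on (thimble a b \<gamma>) \<psi> \<and>
        (\<forall>t\<in>{0..1}. lifts_arg (\<psi> (g t)) (Omega a b (g t) (g' t))) \<and>
        (\<forall>p\<in>vanishing_cycle a b \<gamma>. \<phi> p = \<psi> p - \<kappa>))"

definition point_degree :: "(nat \<Rightarrow> point \<Rightarrow> real) \<Rightarrow> nat \<Rightarrow> nat \<Rightarrow> point \<Rightarrow> real" where
  "point_degree \<phi> i j p = (\<phi> j p - \<phi> i p) / pi"


section \<open>Pseudo-holomorphic discs\<close>

text \<open>A marked disc is a map \<open>u\<close> on the closed unit disc together with angles
  \<open>\<tau>\<^sub>0 < \<dots> < \<tau>\<^sub>k < \<tau>\<^sub>0 + 2\<pi>\<close> of boundary points. The point at \<open>\<tau>\<^sub>0\<close> is the output \<open>q\<close>, the point at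
  \<open>\<tau>\<^sub>s\<close> the \<open>s\<close>-th input; the boundary arc after \<open>\<tau>\<^sub>s\<close> lies on the \<open>s\<close>-th cycle of \<open>Ls\<close>. The fiber,
  a complex submanifold of dimension 0, has only one almost complex structure.\<close>

type_synonym marked_disc = "(complex \<Rightarrow> point) \<times> real list"

definition hol_discs :: "point set \<Rightarrow> point set list \<Rightarrow> point list \<Rightarrow> point \<Rightarrow> marked_disc set" where
  "hol_discs S Ls ps q =
     {(u, \<tau>). continuous_on (cball 0 1) u \<and>
        (\<lambda>z. fst (u z)) holomorphic_on ball 0 1 \<and> (\<lambda>z. snd (u z)) holomorphic_on ball 0 1 \<and>
        u ` cball 0 1 \<subseteq> S \<and>
        length \<tau> = length Ls \<and> sorted_wrt (<) \<tau> \<and> last \<tau> < hd \<tau> + 2 * pi \<and>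
        u (cis (\<tau> ! 0)) = q \<and>
        (\<forall>s<length ps. u (cis (\<tau> ! Suc s)) = ps ! s) \<and>
        (\<forall>s<length ps. \<forall>t\<in>{\<tau> ! s..\<tau> ! Suc s}. u (cis t) \<in> Ls ! s) \<and>
        (\<forall>t\<in>{last \<tau>..hd \<tau> + 2 * pi}. u (cis t) \<in> last Ls)}"

definition disc_automorphism :: "(complex \<Rightarrow> complex) \<Rightarrow> bool" where
  "disc_automorphism h \<longleftrightarrow>
     h holomorphic_on ball 0 1 \<and> continuous_on (cball 0 1) h \<and>
     bij_betw h (ball 0 1) (ball 0 1) \<and> bij_betw h (cball 0 1) (cball 0 1)"

definition disc_equiv :: "(marked_disc \<times> marked_disc) set" where
  "disc_equiv =
     {((u, \<tau>), (u', \<tau>')). length \<tau> = length \<tau>' \<and>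
        (\<exists>h. disc_automorphism h \<and> (\<forall>z\<in>cball 0 1. u' (h z) = u z) \<and>
           (\<forall>s<length \<tau>. h (cis (\<tau> ! s)) = cis (\<tau>' ! s)))}"

definition disc_moduli ::
  "point set \<Rightarrow> point set list \<Rightarrow> point list \<Rightarrow> point \<Rightarrow> marked_disc set set" where
  "disc_moduli S Ls ps q =
     hol_discs S Ls ps q // (disc_equiv \<inter> hol_discs S Ls ps q \<times> hol_discs S Ls ps q)"


section \<open>The category of vanishing cycles\<close>

datatype gen = IdGen | Pt point

type_synonym mor = "gen \<Rightarrow> complex"

definition gens :: "(nat \<Rightarrow> point set) \<Rightarrow> nat \<Rightarrow> nat \<Rightarrow> gen set" where
  "gens L i j = (if i < j then Pt ` (L i \<inter> L j) else if i = j then {IdGen} else {})"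

definition gen_degree :: "(nat \<Rightarrow> point \<Rightarrow> real) \<Rightarrow> nat \<Rightarrow> nat \<Rightarrow> gen \<Rightarrow> real" where
  "gen_degree \<phi> i j g = (case g of IdGen \<Rightarrow> 0 | Pt p \<Rightarrow> point_degree \<phi> i j p)"

text \<open>The space with basis \<open>B\<close>, as functions supported on \<open>B\<close>. The fields \<open>mult\<close> and \<open>one\<close> of the
  record play no role in a module.\<close>

definition span_module :: "gen set \<Rightarrow> (complex, mor) module" where
  "span_module B =
     \<lparr>carrier = {v. \<forall>g. g \<notin> B \<longrightarrow> v g = 0},
      monoid.mult = undefined, one = undefined,
      zero = (\<lambda>_. 0), add = (\<lambda>v w g. v g + w g), smult = (\<lambda>c v g. c * v g)\<rparr>"

text \<open>The coefficient of \<open>q\<close> in \<open>m\<^sub>k(p\<^sub>k, ..., p\<^sub>1)\<close> for \<open>is = [i\<^sub>0, ..., i\<^sub>k]\<close>. As \<open>m\<^sub>k\<close> has degree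
  \<open>2 - k\<close>, only discs for which the degrees of the corners match are counted (the others move in
  moduli spaces of a nonzero expected dimension). All discs are constant, and constant discs count
  with sign \<open>+1\<close>.\<close>

definition disc_count ::
  "point set \<Rightarrow> (nat \<Rightarrow> point set) \<Rightarrow> (nat \<Rightarrow> point \<Rightarrow> real) \<Rightarrow> nat list \<Rightarrow> point list \<Rightarrow> point \<Rightarrow> nat"
where
  "disc_count S L \<phi> is ps q =
     (if point_degree \<phi> (hd is) (last is) q =
           (\<Sum>s<length ps. point_degree \<phi> (is ! s) (is ! Suc s) (ps ! s)) + 2 - real (length ps)
      then card (disc_moduli S (map L is) ps q) else 0)"

definition mu_discs ::
  "point set \<Rightarrow> (nat \<Rightarrow> point set) \<Rightarrow> (nat \<Rightarrow> point \<Rightarrow> real) \<Rightarrow> nat list \<Rightarrow> mor list \<Rightarrow> mor" where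
  "mu_discs S L \<phi> is vs g =
     (case g of
        IdGen \<Rightarrow> 0
      | Pt q \<Rightarrow>
          (\<Sum>ps\<in>listset (map2 (\<lambda>i j. L i \<inter> L j) is (tl is)).
             (\<Prod>s<length vs. (vs ! s) (Pt (ps ! s))) * of_nat (disc_count S L \<phi> is ps q)))"

text \<open>The first two cases are the compositions with multiples of identity morphisms; identities
  are strict units.\<close>

definition mu_vc ::
  "point set \<Rightarrow> (nat \<Rightarrow> point set) \<Rightarrow> (nat \<Rightarrow> point \<Rightarrow> real) \<Rightarrow> nat list \<Rightarrow> mor list \<Rightarrow> mor" where
  "mu_vc S L \<phi> is vs =
     (if length is = 3 \<and> is ! 0 = is ! 1 then (\<lambda>g. (vs ! 0) IdGen * (vs ! 1) g)
      else if length is = 3 \<and> is ! 1 = is ! 2 then (\<lambda>g. (vs ! 1) IdGen * (vs ! 0) g)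
      else if sorted_wrt (<) is then mu_discs S L \<phi> is vs
      else (\<lambda>g. 0))"

text \<open>The object \<open>L\<^sub>j\<close> is represented by \<open>j\<close>.\<close>

definition Lag_vc ::
  "nat \<Rightarrow> nat \<Rightarrow> (nat \<Rightarrow> real \<Rightarrow> complex) \<Rightarrow> (nat \<Rightarrow> point \<Rightarrow> real) \<Rightarrow> (nat, mor) ainf_cat" where
  "Lag_vc a b \<gamma> \<phi> =
     (let L = (\<lambda>j. vanishing_cycle a b (\<gamma> j)) in
      \<lparr>Ob = {..<a + b},
       Hom = (\<lambda>i j. span_module (gens L i j)),
       HomDeg = (\<lambda>i j n. {v \<in> carrier (span_module (gens L i j)).
                            \<forall>g. v g \<noteq> 0 \<longrightarrow> gen_degree \<phi> i j g = real_of_int n}),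
       Ident = (\<lambda>i g. if g = IdGen then 1 else 0),
       Mu = mu_vc (fiber0 a b) L \<phi>\<rparr>)"

end

theory Submission
  imports Defs
begin

text \<open>Since \<open>a\<close> and \<open>b\<close> are coprime, \<open>t \<mapsto> (t\<^sup>b, t\<^sup>-\<^sup>a)\<close> identifies the punctured plane with \<open>X\<close>, and \<open>W\<close> becomes
\<open>t\<^sup>b + t\<^sup>-\<^sup>a\<close>. The reference fiber is \<open>t\<^sup>l = -1\<close> with \<open>l = a + b\<close>, the critical points are the roots of
\<open>t\<^sup>l = a / b\<close>, and rotating \<open>t\<close> by an \<open>l\<close>-th root of unity permutes the segments. It is therefore enough to
understand the segment that ends at the positive real critical value. Over it lies the curve
\<open>t = r(x) e\<^sup>i\<^sup>x\<close>, \<open>\<bar>x\<bar> \<le> \<pi> / l\<close>, on which \<open>W\<close> is real; it is given by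
\<open>r\<^sup>l = sin (a x) / sin (b x)\<close>. On each half of this curve \<open>W\<close> is strictly monotone, because the curve
passes through a critical point only at \<open>x = 0\<close>, so the two halves are lifts of the segment
that merge. No other lift merges with anything: two lifts that start at different points never meet
before the end, two that meet at the end meet at a critical point, and a third root of
\<open>t\<^sup>l + 1 = \<lambda> t\<^sup>a\<close> converging to the critical point would make it a triple root
(\<open>trinomial_simple_root\<close>, \<open>trinomial_double_root\<close>, \<open>merging_branches\<close>). Hence \<open>L\<^sub>j\<close> is the pair of points with
\<open>x\<close>-coordinates \<open>exp (i \<pi> (\<plusminus>b - 2 j) / l)\<close> (\<open>vanishing_cycle_eq\<close>).

For \<open>i < j\<close> the pairs \<open>L\<^sub>i\<close> and \<open>L\<^sub>j\<close> share a point exactly if \<open>j - i\<close> is \<open>a\<close> or \<open>b\<close>. In the coordinate \<open>t\<close> the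
form \<open>\<Omega>\<close> is \<open>dt / t\<close>, so the phase of the thimble is the argument of \<open>r'/r + i\<close>, which stays in the upper
half plane and equals \<open>a \<pi> / l\<close> at one end and \<open>b \<pi> / l\<close> at the other. Shifting it by \<open>2 \<pi> j / l\<close> gives a
grading of \<open>L\<^sub>j\<close>, and for these gradings every intersection point has degree 1
(\<open>vanishing_cycles_degree_one\<close>).

The rest is a degree count (\<open>mu_discs_eq_0\<close>). The operation \<open>m\<^sub>k\<close> sends \<open>k\<close> inputs of degree 1 to degree
\<open>k + (2 - k) = 2\<close>, where there is nothing, so all operations vanish apart from composition with
identities. On the other side, the morphism spaces of \<open>C\<^sub>\<theta>\<close> only involve weights above \<open>-(a + b)\<close>. There
\<open>\<Lambda>\<^sub>\<theta>\<close> is spanned by \<open>1\<close>, \<open>y\<^sub>0\<close> and \<open>y\<^sub>1\<close>: the product \<open>y\<^sub>0 y\<^sub>1\<close> has weight \<open>-(a + b)\<close> and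
the squares of the generators vanish, for every \<open>\<theta>\<close>. Sending the two intersection
points to \<open>y\<^sub>0\<close> and \<open>y\<^sub>1\<close> and \<open>L\<^sub>j\<close> to \<open>w\<^sub>l\<^sub>-\<^sub>1\<^sub>-\<^sub>j\<close> is the required equivalence; the order of the objects is
reversed because the generators have negative weight.\<close>

section \<open>The algebra \<open>\<Lambda>\<^sub>\<theta>\<close> in weights above \<open>-(a + b)\<close>\<close>

lemma ring_FA: "ring FA"
proof -
  have "\<exists>y. x + y = 0" for x :: free_alg
    by (rule exI[of _ "- x"]) simp
  moreover have "\<exists>y. y + x = 0" for x :: free_alg
    by (rule exI[of _ "- x"]) simp
  ultimately show ?thesis
    unfolding ring_of_type_algebra_def
    by unfold_locales (auto simp: algebra_simps Units_def)
qed

lemma FA_simps [simp]: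
  "carrier FA = UNIV" "x \<oplus>\<^bsub>FA\<^esub> y = x + y" "x \<otimes>\<^bsub>FA\<^esub> y = x * y" "\<zero>\<^bsub>FA\<^esub> = 0" "\<one>\<^bsub>FA\<^esub> = 1"
  by (simp_all add: ring_of_type_algebra_def)

lemma FA_minus: "\<ominus>\<^bsub>FA\<^esub> x = - x"
proof -
  interpret ring FA by (rule ring_FA)
  show ?thesis
    using minus_equality[of "- x" x] by simp
qed

lemma ideal_Lambda: "ideal (Lambda_ideal \<theta>) FA"
  unfolding Lambda_ideal_def by (rule ring.genideal_ideal[OF ring_FA]) simp

lemma Lambda_relation:
  "scal (\<theta> $ i $ j) * ygen i * ygen j + scal (\<theta> $ j $ i) * ygen j * ygen i \<in> Lambda_ideal \<theta>"
  unfolding Lambda_ideal_def by (rule subsetD[OF ring.genideal_self[OF ring_FA]]) auto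

lemma Lambda_proj_ops:
  "Lambda_proj \<theta> f \<oplus>\<^bsub>Lambda \<theta>\<^esub> Lambda_proj \<theta> g = Lambda_proj \<theta> (f + g)"
  "Lambda_proj \<theta> f \<otimes>\<^bsub>Lambda \<theta>\<^esub> Lambda_proj \<theta> g = Lambda_proj \<theta> (f * g)"
  "\<one>\<^bsub>Lambda \<theta>\<^esub> = Lambda_proj \<theta> 1"
  "\<zero>\<^bsub>Lambda \<theta>\<^esub> = Lambda_proj \<theta> 0"
proof -
  interpret ideal "Lambda_ideal \<theta>" FA by (rule ideal_Lambda)
  have h: "ring_hom_ring FA (Lambda \<theta>) (Lambda_proj \<theta>)"
    using rcos_ring_hom_ring unfolding Lambda_def Lambda_proj_def by (simp add: Lambda_proj_def[abs_def])
  interpret h: ring_hom_ring FA "Lambda \<theta>" "Lambda_proj \<theta>" by (rule h)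
  show "Lambda_proj \<theta> f \<oplus>\<^bsub>Lambda \<theta>\<^esub> Lambda_proj \<theta> g = Lambda_proj \<theta> (f + g)"
    using h.hom_add[of f g] by simp
  show "Lambda_proj \<theta> f \<otimes>\<^bsub>Lambda \<theta>\<^esub> Lambda_proj \<theta> g = Lambda_proj \<theta> (f * g)"
    using h.hom_mult[of f g] by simp
  show "\<one>\<^bsub>Lambda \<theta>\<^esub> = Lambda_proj \<theta> 1" using h.hom_one by simp
  show "\<zero>\<^bsub>Lambda \<theta>\<^esub> = Lambda_proj \<theta> 0" using h.hom_zero by simp
qed

lemma Lambda_proj_eq_iff: "Lambda_proj \<theta> f = Lambda_proj \<theta> g \<longleftrightarrow> f - g \<in> Lambda_ideal \<theta>"
proof -
  interpret ideal "Lambda_ideal \<theta>" FA by (rule ideal_Lambda)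
  show ?thesis
    unfolding Lambda_proj_def
    using quotient_eq_iff_same_a_r_cos[OF ideal_Lambda, of f g] by (simp add: a_minus_def FA_minus)
qed

lemma Lambda_ideal_closed:
  "f \<in> Lambda_ideal \<theta> \<Longrightarrow> g \<in> Lambda_ideal \<theta> \<Longrightarrow> f + g \<in> Lambda_ideal \<theta>"
  "f \<in> Lambda_ideal \<theta> \<Longrightarrow> h * f \<in> Lambda_ideal \<theta>"
  "f \<in> Lambda_ideal \<theta> \<Longrightarrow> f * h \<in> Lambda_ideal \<theta>"
  "0 \<in> Lambda_ideal \<theta>"
proof -
  interpret ideal "Lambda_ideal \<theta>" FA by (rule ideal_Lambda)
  show "f \<in> Lambda_ideal \<theta> \<Longrightarrow> g \<in> Lambda_ideal \<theta> \<Longrightarrow> f + g \<in> Lambda_ideal \<theta>"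
    using additive_subgroup.a_closed[OF additive_subgroup_axioms, of f g] by simp
  show "f \<in> Lambda_ideal \<theta> \<Longrightarrow> h * f \<in> Lambda_ideal \<theta>"
    using I_l_closed[of f h] by simp
  show "f \<in> Lambda_ideal \<theta> \<Longrightarrow> f * h \<in> Lambda_ideal \<theta>"
    using I_r_closed[of f h] by simp
  show "0 \<in> Lambda_ideal \<theta>" using additive_subgroup.zero_closed[OF additive_subgroup_axioms] by simp
qed

text \<open>Multiplying by a word does not shorten words. As the defining relations are quadratic, this ideal contains
\<open>Lambda_ideal\<close>, which makes \<open>1\<close>, \<open>y\<^sub>0\<close> and \<open>y\<^sub>1\<close>
linearly independent in the quotient.\<close>

lemma ideal_long_words: "ideal {f. \<forall>w\<in>Poly_Mapping.keys f. 2 \<le> length (letters w)} FA"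
  (is "ideal ?I FA")
proof (rule idealI[OF ring_FA])
  interpret ring FA by (rule ring_FA)
  show "subgroup ?I (add_monoid FA)"
  proof (rule add.subgroupI)
    show "?I \<noteq> {}" by (auto intro!: exI[of _ 0])
    show "\<ominus>\<^bsub>FA\<^esub> f \<in> ?I" if "f \<in> ?I" for f
      using that by (simp add: FA_minus)
    show "f \<oplus>\<^bsub>FA\<^esub> g \<in> ?I" if "f \<in> ?I" "g \<in> ?I" for f g
      using that keys_add[of f g] by auto
  qed simp
next
  have mult: "w \<in> Poly_Mapping.keys (f * g) \<Longrightarrow>
      \<exists>u\<in>Poly_Mapping.keys f. \<exists>v\<in>Poly_Mapping.keys g. length (letters w) = length (letters u) + length (letters v)"
    for f g :: free_alg and w
    using keys_mult[of f g] by (force simp: plus_word_def)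
  fix f g assume f: "f \<in> ?I"
  show "g \<otimes>\<^bsub>FA\<^esub> f \<in> ?I"
    using f by (auto dest!: mult)
  show "f \<otimes>\<^bsub>FA\<^esub> g \<in> ?I"
    using f by (auto dest!: mult)
qed

lemma scal_mult_single: "scal c * Poly_Mapping.single w d = Poly_Mapping.single w (c * d)"
  by (simp add: scal_def mult_single)

lemma Lambda_ideal_long_words:
  fixes \<theta> :: "complex^2^2"
  assumes "f \<in> Lambda_ideal \<theta>" "w \<in> Poly_Mapping.keys f"
  shows "2 \<le> length (letters w)"
proof -
  have "Lambda_ideal \<theta> \<subseteq> {f. \<forall>w\<in>Poly_Mapping.keys f. 2 \<le> length (letters w)}"
    unfolding Lambda_ideal_def
  proof (rule ring.genideal_minimal[OF ring_FA ideal_long_words], safe)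
    fix i j w
    have "Poly_Mapping.keys (scal c * ygen i * ygen j) \<subseteq> {Word [i, j]}" for c i j
      by (simp add: ygen_def scal_mult_single mult_single plus_word_def)
    moreover assume "w \<in> Poly_Mapping.keys
      (scal (\<theta> $ i $ j) * ygen i * ygen j + scal (\<theta> $ j $ i) * ygen j * ygen i)"
    ultimately have "w = Word [i, j] \<or> w = Word [j, i]"
      using subsetD[OF keys_add] by (metis UnE singletonD subsetD)
    then show "2 \<le> length (letters w)" by auto
  qed
  then show ?thesis using assms by auto
qed

text \<open>The relation for \<open>i = j\<close> is \<open>2 \<theta>\<^sub>i\<^sub>i y\<^sub>i\<^sup>2\<close>, and
its coefficient is invertible.\<close>

lemma ygen_square:
  fixes \<theta> :: "complex^2^2"
  assumes "\<theta> $ i $ i \<noteq> 0"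
  shows "ygen i * ygen i \<in> Lambda_ideal \<theta>"
proof -
  let ?c = "\<theta> $ i $ i"
  have "scal (inverse (2 * ?c)) * (scal ?c * ygen i * ygen i + scal ?c * ygen i * ygen i) \<in> Lambda_ideal \<theta>"
    by (rule Lambda_ideal_closed(2)[OF Lambda_relation])
  also have "scal (inverse (2 * ?c)) * (scal ?c * ygen i * ygen i + scal ?c * ygen i * ygen i) = ygen i * ygen i"
    using assms
    by (simp add: ygen_def scal_mult_single mult_single distrib_left single_add[symmetric])
  finally show ?thesis .
qed

lemma index_cases: "i = 0 \<or> i = (1::2)"
  using exhaust_2[of i] by auto

lemma weight_word:
  "weight a b w = - int (a * count_list (letters w) 0 + b * count_list (letters w) 1)"
proof -
  have "(\<Sum>i\<leftarrow>l. - int (if i = 0 then a else b)) = - int (a * count_list l 0 + b * count_list l (1::2))" for l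
  proof (induction l)
    case (Cons i l)
    have "i = 0 \<or> i = 1" using index_cases[of i] by auto
    then show ?case using Cons index_cases[of i] by (auto simp: algebra_simps)
  qed simp
  then show ?thesis by (simp add: weight_def)
qed

text \<open>A word containing both letters has weight at most \<open>-(a + b)\<close>. So a long word of larger weight
is a power of one generator, and has its square as a factor.\<close>

lemma long_word_in_ideal:
  fixes \<theta> :: "complex^2^2"
  assumes nz: "\<And>i. \<theta> $ i $ i \<noteq> 0" and len: "2 \<le> length (letters w)" and wt: "weight a b w > - int (a + b)"
  shows "Poly_Mapping.single w c \<in> Lambda_ideal \<theta>"
proof -
  obtain i j l where w: "letters w = i # j # l"
    using len by (cases "letters w"; cases "tl (letters w)") auto
  have "i = j"
  proof (rule ccontr)
    assume "i \<noteq> j"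
    then have "i = 0 \<and> j = 1 \<or> i = 1 \<and> j = 0"
      using index_cases[of i] index_cases[of j] by auto
    then have "1 \<le> count_list (letters w) 0" "1 \<le> count_list (letters w) 1"
      using w by auto
    then have "a * 1 + b * 1 \<le> a * count_list (letters w) 0 + b * count_list (letters w) 1"
      by (intro add_mono mult_le_mono2)
    then have "int (a + b) \<le> int (a * count_list (letters w) 0 + b * count_list (letters w) 1)"
      by (intro zle_int[THEN iffD2]) simp
    with wt show False by (simp only: weight_word)
  qed
  then have "Poly_Mapping.single w c = ygen i * ygen i * Poly_Mapping.single (Word l) c"
    using w by (cases w) (simp add: ygen_def mult_single plus_word_def)
  then show ?thesis using Lambda_ideal_closed(3)[OF ygen_square[OF nz[of i]]] by metis
qed

lemma sum_monomials: "f = (\<Sum>w\<in>Poly_Mapping.keys f. Poly_Mapping.single w (Poly_Mapping.lookup f w))"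
  by (rule poly_mapping_eqI) (auto simp: lookup_sum lookup_single when_def in_keys_iff)

lemma long_words_in_ideal:
  fixes \<theta> :: "complex^2^2"
  assumes nz: "\<And>i. \<theta> $ i $ i \<noteq> 0"
    and long: "\<And>w. w \<in> Poly_Mapping.keys f \<Longrightarrow> 2 \<le> length (letters w) \<and> weight a b w > - int (a + b)"
  shows "f \<in> Lambda_ideal \<theta>"
proof -
  have "(\<Sum>w\<in>K. Poly_Mapping.single w (Poly_Mapping.lookup f w)) \<in> Lambda_ideal \<theta>"
    if "finite K" "K \<subseteq> Poly_Mapping.keys f" for K
    using that
  proof (induction K rule: finite_induct)
    case empty
    then show ?case by (simp add: Lambda_ideal_closed(4))
  next
    case (insert w K)
    then have "Poly_Mapping.single w (Poly_Mapping.lookup f w) \<in> Lambda_ideal \<theta>"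
      using long[of w] by (intro long_word_in_ideal[OF nz]) auto
    then show ?case
      using insert by (simp add: Lambda_ideal_closed(1))
  qed
  from this[of "Poly_Mapping.keys f"] show ?thesis
    using sum_monomials[of f] by simp
qed

text \<open>In the weights that occur as differences of two objects, these elements represent all classes of
\<open>\<Lambda>\<^sub>\<theta>\<close>.\<close>

definition linear_elt :: "complex \<Rightarrow> complex \<Rightarrow> complex \<Rightarrow> free_alg" where
  "linear_elt c d e =
     Poly_Mapping.single 0 c + Poly_Mapping.single (Word [0]) d + Poly_Mapping.single (Word [1]) e"

lemma lookup_linear_elt:
  "Poly_Mapping.lookup (linear_elt c d e) w =
     (if letters w = [] then c else if letters w = [0] then d else if letters w = [1] then e else 0)"
  by (cases w) (auto simp: linear_elt_def lookup_add lookup_single when_def zero_word_def)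

lemma linear_elt_add:
  "linear_elt c d e + linear_elt c' d' e' = linear_elt (c + c') (d + d') (e + e')"
  by (rule poly_mapping_eqI) (simp add: lookup_add lookup_linear_elt)

lemma scal_mult_linear_elt: "scal x * linear_elt c d e = linear_elt (x * c) (x * d) (x * e)"
  by (simp add: linear_elt_def distrib_left scal_mult_single)

lemma linear_elt_0 [simp]: "linear_elt 0 0 0 = 0"
  by (simp add: linear_elt_def)

lemma linear_elt_1 [simp]: "linear_elt 1 0 0 = 1"
  by (simp add: linear_elt_def)

lemma Lambda_proj_linear_elt_inj:
  "Lambda_proj \<theta> (linear_elt c d e) = Lambda_proj \<theta> (linear_elt c' d' e') \<longleftrightarrow> c = c' \<and> d = d' \<and> e = e'"
proof
  assume "Lambda_proj \<theta> (linear_elt c d e) = Lambda_proj \<theta> (linear_elt c' d' e')"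
  then have I: "linear_elt c d e - linear_elt c' d' e' \<in> Lambda_ideal \<theta>" (is "?f \<in> _")
    by (simp add: Lambda_proj_eq_iff)
  have "Poly_Mapping.lookup ?f w = 0" if "length (letters w) < 2" for w
    using Lambda_ideal_long_words[OF I, of w] that by (auto simp: in_keys_iff)
  from this[of "Word []"] this[of "Word [0]"] this[of "Word [1]"]
  show "c = c' \<and> d = d' \<and> e = e'"
    by (simp add: lookup_minus lookup_linear_elt)
qed simp

text \<open>The two hypotheses \<open>d e' = 0\<close> and \<open>e d' = 0\<close> discard the mixed products
\<open>y\<^sub>0 y\<^sub>1\<close> and \<open>y\<^sub>1 y\<^sub>0\<close>; the squares are zero in
\<open>\<Lambda>\<^sub>\<theta>\<close>.\<close>

lemma Lambda_proj_linear_elt_mult: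
  fixes \<theta> :: "complex^2^2"
  assumes nz: "\<And>i. \<theta> $ i $ i \<noteq> 0" and "d * e' = 0" and "e * d' = 0"
  shows "Lambda_proj \<theta> (linear_elt c d e * linear_elt c' d' e')
    = Lambda_proj \<theta> (linear_elt (c * c') (c * d' + d * c') (c * e' + e * c'))"
proof -
  have "linear_elt c d e * linear_elt c' d' e' - linear_elt (c * c') (c * d' + d * c') (c * e' + e * c')
      = scal (d * d') * (ygen 0 * ygen 0) + scal (e * e') * (ygen 1 * ygen 1)"
    by (simp add: linear_elt_def distrib_left distrib_right scal_mult_single ygen_def mult_single
        single_add assms(2,3))
  also have "\<dots> \<in> Lambda_ideal \<theta>"
    by (intro Lambda_ideal_closed ygen_square nz)
  finally show ?thesis by (simp add: Lambda_proj_eq_iff)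
qed

lemma Lambda_proj_truncate:
  fixes \<theta> :: "complex^2^2"
  assumes nz: "\<And>i. \<theta> $ i $ i \<noteq> 0"
    and wt: "\<And>w. w \<in> Poly_Mapping.keys f \<Longrightarrow> weight a b w > - int (a + b)"
  shows "Lambda_proj \<theta> f = Lambda_proj \<theta> (linear_elt (Poly_Mapping.lookup f (Word []))
    (Poly_Mapping.lookup f (Word [0])) (Poly_Mapping.lookup f (Word [1])))"
proof -
  let ?g = "linear_elt (Poly_Mapping.lookup f (Word []))
    (Poly_Mapping.lookup f (Word [0])) (Poly_Mapping.lookup f (Word [1]))"
  have "2 \<le> length (letters w) \<and> weight a b w > - int (a + b)" if w: "w \<in> Poly_Mapping.keys (f - ?g)" for w
  proof -
    obtain l where l: "w = Word l" by (cases w)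
    have *: "Poly_Mapping.lookup f w \<noteq> Poly_Mapping.lookup ?g w"
      using w by (simp add: in_keys_iff lookup_minus)
    have "l \<noteq> []" using * l by (auto simp: lookup_linear_elt)
    moreover have "l \<noteq> [i]" for i
      using * l index_cases[of i] by (auto simp: lookup_linear_elt)
    ultimately have len: "2 \<le> length l"
      by (cases l; cases "tl l") auto
    then have "Poly_Mapping.lookup ?g w = 0" using l by (auto simp: lookup_linear_elt)
    then show ?thesis using * wt[of w] len l by (simp add: in_keys_iff)
  qed
  then show ?thesis
    unfolding Lambda_proj_eq_iff by (intro long_words_in_ideal[OF nz]) auto
qed

lemma Lambda_weight_eq:
  fixes \<theta> :: "complex^2^2"
  assumes nz: "\<And>i. \<theta> $ i $ i \<noteq> 0" and n: "n > - int (a + b)"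
  shows "Lambda_weight a b \<theta> n =
    {Lambda_proj \<theta> (linear_elt c d e) | c d e.
       (c \<noteq> 0 \<longrightarrow> n = 0) \<and> (d \<noteq> 0 \<longrightarrow> n = - int a) \<and> (e \<noteq> 0 \<longrightarrow> n = - int b)}"
proof (intro equalityI subsetI)
  fix x assume "x \<in> Lambda_weight a b \<theta> n"
  then obtain f where x: "x = Lambda_proj \<theta> f" and f: "\<forall>w\<in>Poly_Mapping.keys f. weight a b w = n"
    by (auto simp: Lambda_weight_def)
  have "Poly_Mapping.lookup f w \<noteq> 0 \<longrightarrow> n = weight a b w" for w
    using f by (auto simp: in_keys_iff)
  from this[of "Word []"] this[of "Word [0]"] this[of "Word [1]"]
  show "x \<in> {Lambda_proj \<theta> (linear_elt c d e) | c d e.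
       (c \<noteq> 0 \<longrightarrow> n = 0) \<and> (d \<noteq> 0 \<longrightarrow> n = - int a) \<and> (e \<noteq> 0 \<longrightarrow> n = - int b)}"
    unfolding x using f n by (subst Lambda_proj_truncate[OF nz, of _ a b]) (auto simp: weight_word)
next
  fix x assume "x \<in> {Lambda_proj \<theta> (linear_elt c d e) | c d e.
       (c \<noteq> 0 \<longrightarrow> n = 0) \<and> (d \<noteq> 0 \<longrightarrow> n = - int a) \<and> (e \<noteq> 0 \<longrightarrow> n = - int b)}"
  then show "x \<in> Lambda_weight a b \<theta> n"
    unfolding Lambda_weight_def
    by (auto intro!: imageI simp: in_keys_iff lookup_linear_elt weight_word split: if_splits)
qed

lemma Lambda_bideg_eq:
  fixes \<theta> :: "complex^2^2"
  assumes nz: "\<And>i. \<theta> $ i $ i \<noteq> 0" and n: "n > - int (a + b)"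
  shows "Lambda_bideg a b \<theta> p n =
    {Lambda_proj \<theta> (linear_elt c d e) | c d e.
       (c \<noteq> 0 \<longrightarrow> p = 0 \<and> n = 0) \<and> (d \<noteq> 0 \<longrightarrow> p = 1 \<and> n = - int a) \<and>
       (e \<noteq> 0 \<longrightarrow> p = 1 \<and> n = - int b)}"
proof (intro equalityI subsetI)
  fix x assume "x \<in> Lambda_bideg a b \<theta> p n"
  then obtain f where x: "x = Lambda_proj \<theta> f"
    and f: "\<forall>w\<in>Poly_Mapping.keys f. int (length (letters w)) = p \<and> weight a b w = n"
    by (auto simp: Lambda_bideg_def)
  have "Poly_Mapping.lookup f w \<noteq> 0 \<longrightarrow> p = int (length (letters w)) \<and> n = weight a b w" for w
    using f by (auto simp: in_keys_iff)
  from this[of "Word []"] this[of "Word [0]"] this[of "Word [1]"]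
  show "x \<in> {Lambda_proj \<theta> (linear_elt c d e) | c d e.
       (c \<noteq> 0 \<longrightarrow> p = 0 \<and> n = 0) \<and> (d \<noteq> 0 \<longrightarrow> p = 1 \<and> n = - int a) \<and>
       (e \<noteq> 0 \<longrightarrow> p = 1 \<and> n = - int b)}"
    unfolding x using f n by (subst Lambda_proj_truncate[OF nz, of _ a b]) (auto simp: weight_word)
next
  fix x assume "x \<in> {Lambda_proj \<theta> (linear_elt c d e) | c d e.
       (c \<noteq> 0 \<longrightarrow> p = 0 \<and> n = 0) \<and> (d \<noteq> 0 \<longrightarrow> p = 1 \<and> n = - int a) \<and>
       (e \<noteq> 0 \<longrightarrow> p = 1 \<and> n = - int b)}"
  then show "x \<in> Lambda_bideg a b \<theta> p n"
    unfolding Lambda_bideg_def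
    by (auto intro!: imageI simp: in_keys_iff lookup_linear_elt weight_word split: if_splits)
qed

section \<open>Cycles that meet only in degree one\<close>

lemma listset_nth:
  assumes "ps \<in> listset As" 
  shows "length ps = length As" "s < length As \<Longrightarrow> ps ! s \<in> As ! s"
proof -
  have "length ps = length As \<and> (\<forall>s<length As. ps ! s \<in> As ! s)"
    using assms
  proof (induction As arbitrary: ps)
    case (Cons A As)
    then show ?case by (force simp: set_Cons_def less_Suc_eq_0_disj)
  qed simp
  then show "length ps = length As" "s < length As \<Longrightarrow> ps ! s \<in> As ! s" by auto
qed

text \<open>The first boundary arc starts at the output and the last one returns to it, so the output lies on both
cycles.\<close>

lemma hol_discs_output:
  assumes ne: "(u, \<tau>) \<in> hol_discs S Ls ps q" and Ls: "length ps > 0" "length Ls = Suc (length ps)"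
  shows "q \<in> hd Ls" "q \<in> last Ls"
proof -
  from ne have len: "length \<tau> = length Ls" and srt: "sorted_wrt (<) \<tau>" and lst: "last \<tau> < hd \<tau> + 2 * pi"
    and q: "u (cis (\<tau> ! 0)) = q"
    and arcs: "\<forall>s<length ps. \<forall>t\<in>{\<tau> ! s..\<tau> ! Suc s}. u (cis t) \<in> Ls ! s"
    and arc_last: "\<forall>t\<in>{last \<tau>..hd \<tau> + 2 * pi}. u (cis t) \<in> last Ls"
    by (auto simp: hol_discs_def)
  have "\<tau> ! 0 < \<tau> ! Suc 0"
    using sorted_wrt_nth_less[OF srt, of 0 "Suc 0"] len Ls by simp
  then show "q \<in> hd Ls"
    using arcs[rule_format, of 0 "\<tau> ! 0"] q Ls by (cases Ls) (auto simp: hd_conv_nth)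
  \<comment> \<open>The last arc ends one full turn after the output.\<close>
  have "\<tau> \<noteq> []" using len Ls by auto
  then have "cis (hd \<tau> + 2 * pi) = cis (\<tau> ! 0)"
    by (simp add: hd_conv_nth complex_eq_iff)
  then show "q \<in> last Ls"
    using arc_last[rule_format, of "hd \<tau> + 2 * pi"] lst q by simp
qed

text \<open>A disc counts only if the degree of its output is the sum of the input degrees plus \<open>2 - k\<close>.
With all \<open>k\<close> inputs of degree 1 this sum is 2, whereas an output on both end cycles also has degree 1; an
output off these cycles bounds no disc.\<close>

lemma mu_discs_eq_0:
  assumes deg: "\<And>i j q. i < j \<Longrightarrow> i \<in> I \<Longrightarrow> j \<in> I \<Longrightarrow> q \<in> L i \<inter> L j \<Longrightarrow> point_degree \<phi> i j q = 1"
    and srt: "sorted_wrt (<) xs" and I: "set xs \<subseteq> I" and len: "length xs \<ge> 2"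
  shows "mu_discs S L \<phi> xs vs = (\<lambda>_. 0)"
proof
  fix g
  have step: "xs ! s < xs ! Suc s" if "Suc s < length xs" for s
    using sorted_wrt_nth_less[OF srt, of s "Suc s"] that by simp
  have ends: "hd xs < last xs"
    using sorted_wrt_nth_less[OF srt, of 0 "length xs - 1"] len
    by (cases xs) (auto simp: last_conv_nth)
  have "disc_count S L \<phi> xs ps q = 0"
    if ps: "ps \<in> listset (map2 (\<lambda>i j. L i \<inter> L j) xs (tl xs))" for ps q
  proof (cases "q \<in> L (hd xs) \<inter> L (last xs)")
    case True
    have lps: "length ps = length xs - 1" using listset_nth(1)[OF ps] by simp
    have "point_degree \<phi> (xs ! s) (xs ! Suc s) (ps ! s) = 1" if "s < length ps" for s
    proof (rule deg)
      show "xs ! s < xs ! Suc s" using step that lps by simp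
      show "xs ! s \<in> I" "xs ! Suc s \<in> I" using I that lps nth_mem[of _ xs] by auto
      show "ps ! s \<in> L (xs ! s) \<inter> L (xs ! Suc s)"
        using listset_nth(2)[OF ps, of s] that lps by (simp add: nth_tl)
    qed
    then have "(\<Sum>s<length ps. point_degree \<phi> (xs ! s) (xs ! Suc s) (ps ! s)) = real (length ps)"
      by simp
    moreover have "point_degree \<phi> (hd xs) (last xs) q = 1"
    proof (rule deg[OF ends])
      show "hd xs \<in> I" "last xs \<in> I"
        using I len hd_in_set[of xs] last_in_set[of xs] by (cases xs; auto)+
      show "q \<in> L (hd xs) \<inter> L (last xs)" by (fact True)
    qed
    ultimately show ?thesis by (simp add: disc_count_def)
  next
    case False
    have lps: "length ps = length xs - 1" using listset_nth(1)[OF ps] by simp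
    have ne: "xs \<noteq> []" using len by auto
    have "hol_discs S (map L xs) ps q = {}"
    proof (rule ccontr)
      assume "hol_discs S (map L xs) ps q \<noteq> {}"
      then obtain u \<tau> where "(u, \<tau>) \<in> hol_discs S (map L xs) ps q" by auto
      from hol_discs_output[OF this] lps len False ne show False
        by (auto simp: hd_map last_map)
    qed
    then show ?thesis by (simp add: disc_count_def disc_moduli_def quotient_def)
  qed
  then show "mu_discs S L \<phi> xs vs g = 0"
    by (auto simp: mu_discs_def split: gen.split)
qed

lemma span_module_simps [simp]:
  "carrier (span_module B) = {v. \<forall>g. g \<notin> B \<longrightarrow> v g = 0}"
  "\<zero>\<^bsub>span_module B\<^esub> = (\<lambda>_. 0)"
  "v \<oplus>\<^bsub>span_module B\<^esub> w = (\<lambda>g. v g + w g)"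
  "c \<odot>\<^bsub>span_module B\<^esub> v = (\<lambda>g. c * v g)"
  by (simp_all add: span_module_def)

lemma module_span_module: "Module.module CC (span_module B)"
proof (rule moduleI)
  show "cring CC" by (rule cring_from_type_algebra)
  show "abelian_group (span_module B)"
  proof (rule abelian_groupI)
    fix v assume "v \<in> carrier (span_module B)"
    then show "\<exists>w\<in>carrier (span_module B). w \<oplus>\<^bsub>span_module B\<^esub> v = \<zero>\<^bsub>span_module B\<^esub>"
      by (intro bexI[of _ "\<lambda>g. - v g"]) auto
  qed (auto simp: algebra_simps)
qed (auto simp: ring_of_type_algebra_def algebra_simps)

lemma graded_module_concentrated:
  assumes M: "Module.module CC M" and D: "\<And>n. D n = (if n = d then carrier M else {\<zero>\<^bsub>M\<^esub>})"
  shows "graded_module M D"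
  unfolding graded_module_def
proof (intro conjI allI ballI)
  interpret Module.module CC M by (rule M)
  show "Module.module CC M" by (rule M)
  show "submodule (D n) CC M" for n
    unfolding D by (auto intro!: submoduleI carrier_is_submodule)
  fix x assume x: "x \<in> carrier M"
  show "\<exists>!c. (\<forall>n. c n \<in> D n) \<and> finite {n. c n \<noteq> \<zero>\<^bsub>M\<^esub>} \<and> x = finsum M c {n. c n \<noteq> \<zero>\<^bsub>M\<^esub>}"
  proof (rule ex1I[of _ "\<lambda>n. if n = d then x else \<zero>\<^bsub>M\<^esub>"])
    have "{n. (if n = d then x else \<zero>\<^bsub>M\<^esub>) \<noteq> \<zero>\<^bsub>M\<^esub>} = (if x = \<zero>\<^bsub>M\<^esub> then {} else {d})" by auto
    then show "(\<forall>n. (if n = d then x else \<zero>\<^bsub>M\<^esub>) \<in> D n) \<and>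
      finite {n. (if n = d then x else \<zero>\<^bsub>M\<^esub>) \<noteq> \<zero>\<^bsub>M\<^esub>} \<and>
      x = finsum M (\<lambda>n. if n = d then x else \<zero>\<^bsub>M\<^esub>) {n. (if n = d then x else \<zero>\<^bsub>M\<^esub>) \<noteq> \<zero>\<^bsub>M\<^esub>}"
      using x by (auto simp: D)
  next
    fix c assume c: "(\<forall>n. c n \<in> D n) \<and> finite {n. c n \<noteq> \<zero>\<^bsub>M\<^esub>} \<and> x = finsum M c {n. c n \<noteq> \<zero>\<^bsub>M\<^esub>}"
    have off: "c n = \<zero>\<^bsub>M\<^esub>" if "n \<noteq> d" for n
      using c that D[of n] by auto
    have cd: "c d \<in> carrier M" using c D[of d] by (metis (full_types))
    have "{n. c n \<noteq> \<zero>\<^bsub>M\<^esub>} = (if c d = \<zero>\<^bsub>M\<^esub> then {} else {d})"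
    proof -
      have "c n \<noteq> \<zero>\<^bsub>M\<^esub> \<longleftrightarrow> n = d \<and> c d \<noteq> \<zero>\<^bsub>M\<^esub>" for n
        using off[of n] by (cases "n = d") auto
      then have "{n. c n \<noteq> \<zero>\<^bsub>M\<^esub>} = {n. n = d \<and> c d \<noteq> \<zero>\<^bsub>M\<^esub>}" by (rule Collect_cong)
      then show ?thesis by simp
    qed
    then have "x = c d" using c cd by (auto split: if_splits)
    then show "c = (\<lambda>n. if n = d then x else \<zero>\<^bsub>M\<^esub>)" using off by (simp add: fun_eq_iff)
  qed
qed

text \<open>This collects what the category needs to know about the geometry: \<open>L\<^sub>i\<close> meets a later
\<open>L\<^sub>j\<close> only for \<open>j = i + a\<close>, in the point \<open>P i\<close>, and for \<open>j = i +
b\<close>, in the point \<open>M i\<close>. For \<open>a = b\<close> both conditions hold at once, so \<open>P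
i\<close> and \<open>M i\<close> have to be kept apart.\<close>

locale degree_one_cycles =
  fixes a b :: nat and \<gamma> :: "nat \<Rightarrow> real \<Rightarrow> complex" and \<phi> :: "nat \<Rightarrow> point \<Rightarrow> real"
    and P M :: "nat \<Rightarrow> point"
  assumes pos: "a > 0" "b > 0"
    and inter: "\<And>i j. i < j \<Longrightarrow> j < a + b \<Longrightarrow>
      vanishing_cycle a b (\<gamma> i) \<inter> vanishing_cycle a b (\<gamma> j) =
        {p. j = i + a \<and> p = P i \<or> j = i + b \<and> p = M i}"
    and distinct: "\<And>i. i < a + b \<Longrightarrow> P i \<noteq> M i"
    and degree_one: "\<And>i j p. i < j \<Longrightarrow> j < a + b \<Longrightarrow>
      p \<in> vanishing_cycle a b (\<gamma> i) \<inter> vanishing_cycle a b (\<gamma> j) \<Longrightarrow> point_degree \<phi> i j p = 1"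
begin

abbreviation Lag :: "(nat, mor) ainf_cat" where
  "Lag \<equiv> Lag_vc a b \<gamma> \<phi>"

abbreviation Lag_dg :: "(nat, mor) dg_cat" where
  "Lag_dg \<equiv> dg_of_ainf Lag"

lemma Mu_eq_0:
  assumes "set is \<subseteq> {..<a + b}" "length is \<ge> 2" "length is \<noteq> 3 \<or> is ! 0 \<noteq> is ! 1 \<and> is ! 1 \<noteq> is ! 2"
  shows "Mu Lag is vs = (\<lambda>_. 0)"
  using assms mu_discs_eq_0[of "{..<a + b}" "\<lambda>j. vanishing_cycle a b (\<gamma> j)" \<phi> "is" "fiber0 a b" vs] degree_one
  by (auto simp: Lag_vc_def Let_def mu_vc_def)

lemma Ob_Lag_dg [simp]: "Ob Lag_dg = {..<a + b}"
  by (simp add: dg_of_ainf_def Lag_vc_def Let_def)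

lemma Hom_Lag_dg: "Hom Lag_dg X Y = span_module (gens (\<lambda>j. vanishing_cycle a b (\<gamma> j)) X Y)"
  by (simp add: dg_of_ainf_def Lag_vc_def Let_def)

lemma Hom_Lag_dg_simps [simp]:
  "\<zero>\<^bsub>Hom Lag_dg X Y\<^esub> = (\<lambda>_. 0)"
  "v \<oplus>\<^bsub>Hom Lag_dg X Y\<^esub> w = (\<lambda>g. v g + w g)"
  "c \<odot>\<^bsub>Hom Lag_dg X Y\<^esub> v = (\<lambda>g. c * v g)"
  by (simp_all add: Hom_Lag_dg)

text \<open>Writing the three kinds of generators in one condition on the support of a morphism, for \<open>X\<close>
and \<open>Y\<close> in any order, spares later proofs the case distinction in \<open>gens\<close>.\<close>

lemma carrier_Hom_Lag_dg:
  assumes "X < a + b" "Y < a + b"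
  shows "carrier (Hom Lag_dg X Y) =
    {v. \<forall>g. v g \<noteq> 0 \<longrightarrow> X = Y \<and> g = IdGen \<or> Y = X + a \<and> g = Pt (P X) \<or> Y = X + b \<and> g = Pt (M X)}"
proof -
  have "gens (\<lambda>j. vanishing_cycle a b (\<gamma> j)) X Y =
      {g. X = Y \<and> g = IdGen \<or> Y = X + a \<and> g = Pt (P X) \<or> Y = X + b \<and> g = Pt (M X)}"
    using assms inter[of X Y] pos by (auto simp: gens_def)
  then show ?thesis by (auto simp: Hom_Lag_dg)
qed

lemma HomDeg_Lag_dg:
  assumes "X < a + b" "Y < a + b"
  shows "HomDeg Lag_dg X Y n =
    (if n = (if X = Y then 0 else 1) then carrier (Hom Lag_dg X Y) else {\<lambda>_. 0})"
proof -
  have deg: "gen_degree \<phi> X Y g = (if X = Y then 0 else 1)"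
    if "v \<in> carrier (Hom Lag_dg X Y)" "v g \<noteq> 0" for v g
  proof (cases g)
    case IdGen
    then show ?thesis
      using that by (auto simp: Hom_Lag_dg gen_degree_def gens_def split: if_splits)
  next
    case (Pt p)
    have "Pt p \<in> gens (\<lambda>j. vanishing_cycle a b (\<gamma> j)) X Y"
      using that Pt by (auto simp: Hom_Lag_dg)
    then have "X < Y \<and> p \<in> vanishing_cycle a b (\<gamma> X) \<inter> vanishing_cycle a b (\<gamma> Y)"
      by (auto simp: gens_def split: if_splits)
    with degree_one[of X Y p] assms Pt show ?thesis by (simp add: gen_degree_def)
  qed
  have "HomDeg Lag_dg X Y n =
      {v \<in> carrier (Hom Lag_dg X Y). \<forall>g. v g \<noteq> 0 \<longrightarrow> gen_degree \<phi> X Y g = real_of_int n}"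
    by (simp add: dg_of_ainf_def Lag_vc_def Let_def)
  also have "\<dots> = {v \<in> carrier (Hom Lag_dg X Y). v = (\<lambda>_. 0) \<or> n = (if X = Y then 0 else 1)}"
    using deg by (force simp: fun_eq_iff split: if_splits)
  also have "\<dots> = (if n = (if X = Y then 0 else 1) then carrier (Hom Lag_dg X Y) else {\<lambda>_. 0})"
    by (auto simp: Hom_Lag_dg)
  finally show ?thesis .
qed

lemma Ident_Lag_dg [simp]: "Ident Lag_dg X = (\<lambda>g. if g = IdGen then 1 else 0)"
  by (simp add: dg_of_ainf_def Lag_vc_def Let_def)

lemma Diff_Lag_dg:
  assumes "X < a + b" "Y < a + b"
  shows "Diff Lag_dg X Y f = (\<lambda>_. 0)"
  using Mu_eq_0[of "[X, Y]" "[f]"] assms by (simp add: dg_of_ainf_def)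

lemma Comp_Lag_dg:
  assumes "X < a + b" "Y < a + b" "Z < a + b"
  shows "Comp Lag_dg X Y Z g f =
    (if X = Y then (\<lambda>x. f IdGen * g x) else if Y = Z then (\<lambda>x. g IdGen * f x) else (\<lambda>_. 0))"
proof (cases "X = Y \<or> Y = Z")
  case True
  then show ?thesis
    by (auto simp: dg_of_ainf_def Lag_vc_def Let_def mu_vc_def)
next
  case False
  then show ?thesis
    using Mu_eq_0[of "[X, Y, Z]" "[f, g]"] assms by (simp add: dg_of_ainf_def)
qed

lemma dg_category_Lag_dg: "dg_category Lag_dg"
proof
  note [simp] = Diff_Lag_dg Comp_Lag_dg HomDeg_Lag_dg carrier_Hom_Lag_dg C_linear_def
  show "graded_module (Hom Lag_dg X Y) (HomDeg Lag_dg X Y)" if "X \<in> Ob Lag_dg" "Y \<in> Ob Lag_dg" for X Y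
  proof (rule graded_module_concentrated[where d = "if X = Y then 0 else 1"])
    show "Module.module CC (Hom Lag_dg X Y)"
      by (simp only: Hom_Lag_dg module_span_module)
    show "HomDeg Lag_dg X Y n = (if n = (if X = Y then 0 else 1) then carrier (Hom Lag_dg X Y) else {\<zero>\<^bsub>Hom Lag_dg X Y\<^esub>})" for n
      using that by (simp only: HomDeg_Lag_dg Ob_Lag_dg lessThan_iff Hom_Lag_dg_simps)
  qed
  show "C_linear (Hom Lag_dg X Y) (Hom Lag_dg X Y) (Diff Lag_dg X Y)" if "X \<in> Ob Lag_dg" "Y \<in> Ob Lag_dg" for X Y
    using that by simp
  show "Diff Lag_dg X Y f \<in> HomDeg Lag_dg X Y (n + 1)"
    if "X \<in> Ob Lag_dg" "Y \<in> Ob Lag_dg" "f \<in> HomDeg Lag_dg X Y n" for X Y f n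
    using that by auto
  show "Diff Lag_dg X Y (Diff Lag_dg X Y f) = \<zero>\<^bsub>Hom Lag_dg X Y\<^esub>"
    if "X \<in> Ob Lag_dg" "Y \<in> Ob Lag_dg" "f \<in> carrier (Hom Lag_dg X Y)" for X Y f
    using that by auto
  show "C_linear (Hom Lag_dg Y Z) (Hom Lag_dg X Z) (\<lambda>g. Comp Lag_dg X Y Z g f)"
    if "X \<in> Ob Lag_dg" "Y \<in> Ob Lag_dg" "Z \<in> Ob Lag_dg" "f \<in> carrier (Hom Lag_dg X Y)" for X Y Z f
    using that pos by (cases "X = Y"; cases "Y = Z"; simp add: algebra_simps; blast)
  show "C_linear (Hom Lag_dg X Y) (Hom Lag_dg X Z) (\<lambda>f. Comp Lag_dg X Y Z g f)"
    if "X \<in> Ob Lag_dg" "Y \<in> Ob Lag_dg" "Z \<in> Ob Lag_dg" "g \<in> carrier (Hom Lag_dg Y Z)" for X Y Z g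
    using that pos by (cases "X = Y"; cases "Y = Z"; simp add: algebra_simps; blast)
  show "Comp Lag_dg X Y Z g f \<in> HomDeg Lag_dg X Z (n + m)"
    if "X \<in> Ob Lag_dg" "Y \<in> Ob Lag_dg" "Z \<in> Ob Lag_dg" "f \<in> HomDeg Lag_dg X Y m" "g \<in> HomDeg Lag_dg Y Z n" for X Y Z f g m n
    using that pos by (cases "X = Y"; cases "Y = Z") (auto split: if_splits)
  show "Diff Lag_dg X Z (Comp Lag_dg X Y Z g f) =
            Comp Lag_dg X Y Z (Diff Lag_dg Y Z g) f
              \<oplus>\<^bsub>Hom Lag_dg X Z\<^esub> ((-1) powi n) \<odot>\<^bsub>Hom Lag_dg X Z\<^esub> Comp Lag_dg X Y Z g (Diff Lag_dg X Y f)"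
    if "X \<in> Ob Lag_dg" "Y \<in> Ob Lag_dg" "Z \<in> Ob Lag_dg" for X Y Z f g n
    using that by simp
  show "Comp Lag_dg X Z V h (Comp Lag_dg X Y Z g f) = Comp Lag_dg X Y V (Comp Lag_dg Y Z V h g) f"
    if "X \<in> Ob Lag_dg" "Y \<in> Ob Lag_dg" "Z \<in> Ob Lag_dg" "V \<in> Ob Lag_dg" "f \<in> carrier (Hom Lag_dg X Y)"
        "g \<in> carrier (Hom Lag_dg Y Z)" "h \<in> carrier (Hom Lag_dg Z V)" for X Y Z V f g h
    using that by (cases "X = Y"; cases "Y = Z"; cases "Z = V"; simp add: mult_ac)
  show "Ident Lag_dg X \<in> HomDeg Lag_dg X X 0" if "X \<in> Ob Lag_dg" for X
    using that by auto
  show "Diff Lag_dg X X (Ident Lag_dg X) = \<zero>\<^bsub>Hom Lag_dg X X\<^esub>" if "X \<in> Ob Lag_dg" for X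
    using that by auto
  show "Comp Lag_dg X X Y f (Ident Lag_dg X) = f"
    if "X \<in> Ob Lag_dg" "Y \<in> Ob Lag_dg" "f \<in> carrier (Hom Lag_dg X Y)" for X Y f
    using that by auto
  show "Comp Lag_dg X Y Y (Ident Lag_dg Y) f = f"
    if "X \<in> Ob Lag_dg" "Y \<in> Ob Lag_dg" "f \<in> carrier (Hom Lag_dg X Y)" for X Y f
    using that pos by (cases "X = Y"; simp add: fun_eq_iff; blast)
qed

lemma ainf_is_dg_Lag: "ainf_is_dg Lag"
  unfolding ainf_is_dg_def
proof (intro conjI allI impI dg_category_Lag_dg)
  fix Xs fs
  assume *: "3 \<le> length fs \<and> length Xs = length fs + 1 \<and> set Xs \<subseteq> Ob Lag \<and>
    (\<forall>s<length fs. fs ! s \<in> carrier (Hom Lag (Xs ! s) (Xs ! Suc s)))"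
  then have "Mu Lag Xs fs = (\<lambda>_. 0)"
    by (intro Mu_eq_0) (auto simp: Lag_vc_def Let_def)
  then show "Mu Lag Xs fs = \<zero>\<^bsub>Hom Lag (hd Xs) (last Xs)\<^esub>"
    by (simp add: Lag_vc_def Let_def)
qed

end

section \<open>The equivalence with \<open>C\<^sub>\<theta>\<close>\<close>

lemma C_theta_simps [simp]:
  "Ob (C_theta a b \<theta>) = {..<a + b}"
  "carrier (Hom (C_theta a b \<theta>) j i) = Lambda_weight a b \<theta> (int i - int j)"
  "\<zero>\<^bsub>Hom (C_theta a b \<theta>) j i\<^esub> = \<zero>\<^bsub>Lambda \<theta>\<^esub>"
  "x \<oplus>\<^bsub>Hom (C_theta a b \<theta>) j i\<^esub> y = x \<oplus>\<^bsub>Lambda \<theta>\<^esub> y"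
  "c \<odot>\<^bsub>Hom (C_theta a b \<theta>) j i\<^esub> x = Lambda_proj \<theta> (scal c) \<otimes>\<^bsub>Lambda \<theta>\<^esub> x"
  "HomDeg (C_theta a b \<theta>) j i p = Lambda_bideg a b \<theta> p (int i - int j)"
  "Ident (C_theta a b \<theta>) j = \<one>\<^bsub>Lambda \<theta>\<^esub>"
  "Diff (C_theta a b \<theta>) j i f = \<zero>\<^bsub>Lambda \<theta>\<^esub>"
  "Comp (C_theta a b \<theta>) k j i g f = g \<otimes>\<^bsub>Lambda \<theta>\<^esub> f"
  by (simp_all add: C_theta_def)

lemma dg_isomorphic_C_theta_refl: "dg_isomorphic (C_theta a b \<theta>) X X"
proof -
  have "\<one>\<^bsub>Lambda \<theta>\<^esub> \<in> Lambda_bideg a b \<theta> 0 0"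
    unfolding Lambda_bideg_def Lambda_proj_ops
    by (rule imageI) (simp add: single_one[symmetric] zero_word_def weight_def del: single_one)
  then show ?thesis
    unfolding dg_isomorphic_def by (intro bexI[of _ "\<one>\<^bsub>Lambda \<theta>\<^esub>"]) (simp_all add: Lambda_proj_ops)
qed

text \<open>Weight zero forces word length 0 and the weights \<open>-a\<close> and \<open>-b\<close> force length 1,
so each morphism space is concentrated in one degree, as on the symplectic side.\<close>

lemma Lambda_bideg_concentrated:
  fixes \<theta> :: "complex^2^2"
  assumes nz: "\<And>i. \<theta> $ i $ i \<noteq> 0" and pos: "a > 0" "b > 0" and n: "n > - int (a + b)"
  shows "Lambda_bideg a b \<theta> p n =
    (if p = (if n = 0 then 0 else 1) then Lambda_weight a b \<theta> n else {Lambda_proj \<theta> 0})"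
proof -
  let ?B = "\<lambda>c d e. (c \<noteq> 0 \<longrightarrow> p = 0 \<and> n = 0) \<and> (d \<noteq> 0 \<longrightarrow> p = 1 \<and> n = - int a) \<and>
       (e \<noteq> 0 \<longrightarrow> p = 1 \<and> n = - int b)"
  let ?W = "\<lambda>c d e. (c \<noteq> 0 \<longrightarrow> n = 0) \<and> (d \<noteq> 0 \<longrightarrow> n = - int a) \<and> (e \<noteq> 0 \<longrightarrow> n = - int b)"
  show ?thesis
  proof (cases "p = (if n = 0 then 0 else 1)")
    case True
    have "?B c d e \<longleftrightarrow> ?W c d e" for c d e :: complex
      using True pos by (cases "n = 0") simp_all
    then show ?thesis
      unfolding Lambda_bideg_eq[OF nz n] Lambda_weight_eq[OF nz n] if_P[OF True] by (simp only:)
  next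
    case False
    have "?B c d e \<longleftrightarrow> c = 0 \<and> d = 0 \<and> e = 0" for c d e :: complex
      using False pos by (cases "n = 0") auto
    then have "{Lambda_proj \<theta> (linear_elt c d e) | c d e. ?B c d e} = {Lambda_proj \<theta> (linear_elt 0 0 0)}"
      by (simp only:) blast
    then show ?thesis
      unfolding Lambda_bideg_eq[OF nz n] if_not_P[OF False] by (simp only: linear_elt_0)
  qed
qed

context degree_one_cycles
begin

text \<open>The generators have negative weight, so nonzero morphisms of \<open>C\<^sub>\<theta>\<close> lower the
index, while those between vanishing cycles raise it.\<close>

definition obj :: "nat \<Rightarrow> nat" where
  "obj X = a + b - 1 - X"

text \<open>As a morphism is zero off the generators that exist for \<open>X\<close> and \<open>Y\<close>, the same
formula serves for all pairs of objects.\<close>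

definition linear_part :: "complex^2^2 \<Rightarrow> nat \<Rightarrow> nat \<Rightarrow> mor \<Rightarrow> free_alg set" where
  "linear_part \<theta> X Y v = Lambda_proj \<theta> (linear_elt (v IdGen) (v (Pt (P X))) (v (Pt (M X))))"

lemma obj_diff: "X < a + b \<Longrightarrow> Y < a + b \<Longrightarrow> int (obj Y) - int (obj X) = int X - int Y"
  by (simp add: obj_def of_nat_diff)

lemma mem_Hom_Lag_dg:
  assumes "X < a + b" "Y < a + b" "v \<in> carrier (Hom Lag_dg X Y)"
  shows "v IdGen \<noteq> 0 \<Longrightarrow> X = Y" "v (Pt (P X)) \<noteq> 0 \<Longrightarrow> Y = X + a" "v (Pt (M X)) \<noteq> 0 \<Longrightarrow> Y = X + b"
proof -
  have v: "v g \<noteq> 0 \<Longrightarrow>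
      X = Y \<and> g = IdGen \<or> Y = X + a \<and> g = Pt (P X) \<or> Y = X + b \<and> g = Pt (M X)" for g
    using assms unfolding carrier_Hom_Lag_dg[OF assms(1,2)] by blast
  show "v IdGen \<noteq> 0 \<Longrightarrow> X = Y" using v[of IdGen] by simp
  show "v (Pt (P X)) \<noteq> 0 \<Longrightarrow> Y = X + a" using v[of "Pt (P X)"] distinct[OF assms(1)] by simp
  show "v (Pt (M X)) \<noteq> 0 \<Longrightarrow> Y = X + b" using v[of "Pt (M X)"] distinct[OF assms(1)] by auto
qed

lemma bij_linear_part:
  fixes \<theta> :: "complex^2^2"
  assumes nz: "\<And>i. \<theta> $ i $ i \<noteq> 0" and X: "X < a + b" and Y: "Y < a + b"
  shows "bij_betw (linear_part \<theta> X Y) (carrier (Hom Lag_dg X Y)) (Lambda_weight a b \<theta> (int X - int Y))"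
proof (rule bij_betw_imageI)
  have n: "int X - int Y > - int (a + b)" using Y by simp
  have I: "int X - int Y = 0 \<longleftrightarrow> X = Y" "int X - int Y = - int a \<longleftrightarrow> Y = X + a"
    "int X - int Y = - int b \<longleftrightarrow> Y = X + b" by auto
  show "inj_on (linear_part \<theta> X Y) (carrier (Hom Lag_dg X Y))"
  proof (rule inj_onI)
    fix v w assume v: "v \<in> carrier (Hom Lag_dg X Y)" and w: "w \<in> carrier (Hom Lag_dg X Y)"
      and eq: "linear_part \<theta> X Y v = linear_part \<theta> X Y w"
    then have "v g = w g" if "g \<in> {IdGen, Pt (P X), Pt (M X)}" for g
      using that by (auto simp: linear_part_def Lambda_proj_linear_elt_inj)
    moreover have "v g = w g" if "g \<notin> {IdGen, Pt (P X), Pt (M X)}" for g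
    proof -
      have "v g = 0" "w g = 0"
        using v w that unfolding carrier_Hom_Lag_dg[OF X Y] by blast+
      then show ?thesis by simp
    qed
    ultimately show "v = w" by blast
  qed
  show "linear_part \<theta> X Y ` carrier (Hom Lag_dg X Y) = Lambda_weight a b \<theta> (int X - int Y)"
  proof (intro equalityI subsetI)
    fix x assume "x \<in> linear_part \<theta> X Y ` carrier (Hom Lag_dg X Y)"
    then obtain v where v: "v \<in> carrier (Hom Lag_dg X Y)" and x: "x = linear_part \<theta> X Y v" by auto
    show "x \<in> Lambda_weight a b \<theta> (int X - int Y)"
      unfolding Lambda_weight_eq[OF nz n] I x linear_part_def using mem_Hom_Lag_dg[OF X Y v] by blast
  next
    fix x assume "x \<in> Lambda_weight a b \<theta> (int X - int Y)"
    then obtain c d e where x: "x = Lambda_proj \<theta> (linear_elt c d e)"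
      and cde: "c \<noteq> 0 \<longrightarrow> X = Y" "d \<noteq> 0 \<longrightarrow> Y = X + a" "e \<noteq> 0 \<longrightarrow> Y = X + b"
      unfolding Lambda_weight_eq[OF nz n] I by blast
    define v where "v = (\<lambda>g. if g = IdGen then c else if g = Pt (P X) then d else if g = Pt (M X) then e else 0)"
    have "v \<in> carrier (Hom Lag_dg X Y)"
      unfolding carrier_Hom_Lag_dg[OF X Y] v_def using cde by simp
    moreover have "x = linear_part \<theta> X Y v"
      using distinct[OF X] by (auto simp: x linear_part_def v_def)
    ultimately show "x \<in> linear_part \<theta> X Y ` carrier (Hom Lag_dg X Y)" by blast
  qed
qed

text \<open>A mixed product \<open>y\<^sub>0 y\<^sub>1\<close> would need \<open>Z = X + a + b\<close>, which exceeds
the range of the objects. Hence only products with multiples of identities survive on either side.\<close>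

lemma linear_part_Comp:
  fixes \<theta> :: "complex^2^2"
  assumes nz: "\<And>i. \<theta> $ i $ i \<noteq> 0" and X: "X < a + b" and Y: "Y < a + b" and Z: "Z < a + b"
    and f: "f \<in> carrier (Hom Lag_dg X Y)" and g: "g \<in> carrier (Hom Lag_dg Y Z)"
  shows "linear_part \<theta> X Z (Comp Lag_dg X Y Z g f) =
    linear_part \<theta> Y Z g \<otimes>\<^bsub>Lambda \<theta>\<^esub> linear_part \<theta> X Y f"
proof -
  note f' = mem_Hom_Lag_dg[OF X Y f] and g' = mem_Hom_Lag_dg[OF Y Z g]
  have "linear_part \<theta> Y Z g \<otimes>\<^bsub>Lambda \<theta>\<^esub> linear_part \<theta> X Y f =
    Lambda_proj \<theta> (linear_elt (g IdGen * f IdGen)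
      (g IdGen * f (Pt (P X)) + g (Pt (P Y)) * f IdGen)
      (g IdGen * f (Pt (M X)) + g (Pt (M Y)) * f IdGen))"
    unfolding linear_part_def Lambda_proj_ops
  proof (rule Lambda_proj_linear_elt_mult[OF nz])
    show "g (Pt (P Y)) * f (Pt (M X)) = 0"
      by (rule ccontr) (use f'(3) g'(2) Z in simp)
    show "g (Pt (M Y)) * f (Pt (P X)) = 0"
      by (rule ccontr) (use f'(2) g'(3) Z in simp)
  qed
  also have "\<dots> = linear_part \<theta> X Z (Comp Lag_dg X Y Z g f)"
  proof (cases "X = Y")
    case True
    then have "f (Pt (P X)) = 0" "f (Pt (M X)) = 0"
      using f'(2,3) pos by (metis add_cancel_left_right less_irrefl)+
    then show ?thesis using True X Y Z by (simp add: linear_part_def Comp_Lag_dg mult.commute)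
  next
    case XY: False
    then have f0: "f IdGen = 0" using f'(1) by blast
    show ?thesis
    proof (cases "Y = Z")
      case True
      then show ?thesis using XY f0 X Y Z by (simp add: linear_part_def Comp_Lag_dg)
    next
      case False
      then have "g IdGen = 0" using g'(1) by blast
      then show ?thesis using XY f0 False X Y Z by (simp add: linear_part_def Comp_Lag_dg)
    qed
  qed
  finally show ?thesis ..
qed

lemma dg_functor_linear_part:
  fixes \<theta> :: "complex^2^2"
  assumes nz: "\<And>i. \<theta> $ i $ i \<noteq> 0"
  shows "dg_functor Lag_dg (C_theta a b \<theta>) obj (linear_part \<theta>)"
    and "X < a + b \<Longrightarrow> Y < a + b \<Longrightarrow>
      bij_betw (linear_part \<theta> X Y) (HomDeg Lag_dg X Y n) (HomDeg (C_theta a b \<theta>) (obj X) (obj Y) n)"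
proof -
  have zero: "linear_part \<theta> X Y (\<lambda>_. 0) = Lambda_proj \<theta> 0" for X Y
    by (simp add: linear_part_def)
  show deg: "bij_betw (linear_part \<theta> X Y) (HomDeg Lag_dg X Y n) (HomDeg (C_theta a b \<theta>) (obj X) (obj Y) n)"
    if X: "X < a + b" and Y: "Y < a + b" for X Y n
  proof -
    have n: "int X - int Y > - int (a + b)" using Y by simp
    have "HomDeg (C_theta a b \<theta>) (obj X) (obj Y) n =
        (if n = (if X = Y then 0 else 1) then Lambda_weight a b \<theta> (int X - int Y) else {Lambda_proj \<theta> 0})"
      using Lambda_bideg_concentrated[OF nz pos n, of n] by (simp add: obj_diff[OF X Y])
    then show ?thesis
      using bij_linear_part[OF nz X Y]
      by (simp add: HomDeg_Lag_dg[OF X Y] zero bij_betw_def)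
  qed
  have lin: "C_linear (Hom Lag_dg X Y) (Hom (C_theta a b \<theta>) (obj X) (obj Y)) (linear_part \<theta> X Y)"
    if X: "X < a + b" and Y: "Y < a + b" for X Y
    unfolding C_linear_def
  proof (intro conjI ballI allI)
    show "linear_part \<theta> X Y \<in> carrier (Hom Lag_dg X Y) \<rightarrow> carrier (Hom (C_theta a b \<theta>) (obj X) (obj Y))"
      using bij_linear_part[OF nz X Y] by (auto simp: obj_diff[OF X Y] bij_betw_def)
  qed (simp_all add: linear_part_def Lambda_proj_ops linear_elt_add scal_mult_linear_elt)
  show "dg_functor Lag_dg (C_theta a b \<theta>) obj (linear_part \<theta>)"
    unfolding dg_functor_def
  proof (intro conjI ballI allI)
    show "obj \<in> Ob Lag_dg \<rightarrow> Ob (C_theta a b \<theta>)" using pos by (auto simp: obj_def)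
  next
    fix X Y n assume X: "X \<in> Ob Lag_dg" and Y: "Y \<in> Ob Lag_dg"
    then show "C_linear (Hom Lag_dg X Y) (Hom (C_theta a b \<theta>) (obj X) (obj Y)) (linear_part \<theta> X Y)"
      by (intro lin) simp_all
    show "linear_part \<theta> X Y ` HomDeg Lag_dg X Y n \<subseteq> HomDeg (C_theta a b \<theta>) (obj X) (obj Y) n"
      using deg[of X Y n] X Y unfolding bij_betw_def by simp
  next
    fix X Y f assume "X \<in> Ob Lag_dg" "Y \<in> Ob Lag_dg"
    then show "linear_part \<theta> X Y (Diff Lag_dg X Y f) = Diff (C_theta a b \<theta>) (obj X) (obj Y) (linear_part \<theta> X Y f)"
      by (simp add: Diff_Lag_dg zero Lambda_proj_ops)
  next
    fix X assume "X \<in> Ob Lag_dg"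
    show "linear_part \<theta> X X (Ident Lag_dg X) = Ident (C_theta a b \<theta>) (obj X)"
      by (simp add: linear_part_def Lambda_proj_ops)
  next
    fix X Y Z f g
    assume "X \<in> Ob Lag_dg" "Y \<in> Ob Lag_dg" "Z \<in> Ob Lag_dg" "f \<in> carrier (Hom Lag_dg X Y)" "g \<in> carrier (Hom Lag_dg Y Z)"
    then show "linear_part \<theta> X Z (Comp Lag_dg X Y Z g f) =
      Comp (C_theta a b \<theta>) (obj X) (obj Y) (obj Z) (linear_part \<theta> Y Z g) (linear_part \<theta> X Y f)"
      using linear_part_Comp[OF nz] by simp
  qed
qed

lemma dg_equivalent_C_theta:
  fixes \<theta> :: "complex^2^2"
  assumes nz: "\<And>i. \<theta> $ i $ i \<noteq> 0"
  shows "dg_equivalent Lag_dg (C_theta a b \<theta>)"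
  unfolding dg_equivalent_def
proof (intro exI[of _ obj] exI[of _ "linear_part \<theta>"] conjI ballI allI)
  show "dg_functor Lag_dg (C_theta a b \<theta>) obj (linear_part \<theta>)"
    by (rule dg_functor_linear_part(1)[OF nz])
next
  fix X Y n assume X: "X \<in> Ob Lag_dg" and Y: "Y \<in> Ob Lag_dg"
  then show "bij_betw (linear_part \<theta> X Y) (carrier (Hom Lag_dg X Y)) (carrier (Hom (C_theta a b \<theta>) (obj X) (obj Y)))"
    using bij_linear_part[OF nz, of X Y] by (simp add: obj_diff)
  show "bij_betw (linear_part \<theta> X Y) (HomDeg Lag_dg X Y n) (HomDeg (C_theta a b \<theta>) (obj X) (obj Y) n)"
    using X Y by (intro dg_functor_linear_part(2)[OF nz]) simp_all
next
  fix Z assume "Z \<in> Ob (C_theta a b \<theta>)"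
  then have "obj Z \<in> Ob Lag_dg" "obj (obj Z) = Z" by (auto simp: obj_def)
  then show "\<exists>X\<in>Ob Lag_dg. dg_isomorphic (C_theta a b \<theta>) (obj X) Z"
    using dg_isomorphic_C_theta_refl by metis
qed

end

section \<open>Roots of a trinomial depending on a parameter\<close>

text \<open>The divided difference of \<open>t\<^sup>n\<close>. It is a polynomial in its two points, hence continuous
also where they coincide.\<close>

definition divided_diff :: "nat \<Rightarrow> complex \<Rightarrow> complex \<Rightarrow> complex" where
  "divided_diff n x y = (\<Sum>i<n. y ^ (n - Suc i) * x ^ i)"

text \<open>The divided difference of \<open>t\<^sup>n\<close> at three points.\<close>

definition divided_diff2 :: "nat \<Rightarrow> complex \<Rightarrow> complex \<Rightarrow> complex \<Rightarrow> complex" where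
  "divided_diff2 n x y w = (\<Sum>i<n. divided_diff (n - Suc i) y w * x ^ i)"

lemma power_diff_divided_diff: "x ^ n - y ^ n = (x - y) * divided_diff n x y"
  unfolding divided_diff_def by (rule power_diff_sumr2)

lemma divided_diff_diff: "divided_diff n x y - divided_diff n x w = (y - w) * divided_diff2 n x y w"
  unfolding divided_diff2_def divided_diff_def[of n]
  by (simp add: sum_subtractf[symmetric] sum_distrib_left left_diff_distrib[symmetric]
      power_diff_divided_diff mult.assoc)

lemma divided_diff_diag: "z * divided_diff n z z = of_nat n * z ^ n"
proof -
  have "z * (z ^ (n - Suc i) * z ^ i) = z ^ n" if "i < n" for i
    using that by (simp add: power_add[symmetric] flip: power_Suc)
  then show ?thesis by (simp add: divided_diff_def sum_distrib_left)
qed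

lemma divided_diff2_diag: "2 * z\<^sup>2 * divided_diff2 n z z z = of_nat n * (of_nat n - 1) * z ^ n"
proof -
  have "z\<^sup>2 * (divided_diff (n - Suc i) z z * z ^ i) = of_nat (n - Suc i) * z ^ n" if "i < n" for i
  proof -
    have "z\<^sup>2 * (divided_diff (n - Suc i) z z * z ^ i) = (z * divided_diff (n - Suc i) z z) * (z * z ^ i)"
      by (simp add: power2_eq_square)
    also have "\<dots> = of_nat (n - Suc i) * z ^ (n - Suc i + Suc i)"
      by (simp add: divided_diff_diag power_add)
    finally show ?thesis using that by simp
  qed
  then have "z\<^sup>2 * divided_diff2 n z z z = (\<Sum>i<n. of_nat (n - Suc i)) * z ^ n"
    by (simp add: divided_diff2_def sum_distrib_left sum_distrib_right)
  also have "(\<Sum>i<n. of_nat (n - Suc i)) = (\<Sum>i<n. of_nat i :: complex)"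
    by (rule sum.nat_diff_reindex)
  finally have "2 * z\<^sup>2 * divided_diff2 n z z z = (2 * (\<Sum>i<n. of_nat i)) * z ^ n"
    by (simp add: mult.assoc)
  also have "2 * (\<Sum>i<n. of_nat i) = (of_nat n * (of_nat n - 1) :: complex)"
    by (induction n) (auto simp: algebra_simps)
  finally show ?thesis .
qed

lemma tendsto_divided_diff [tendsto_intros]:
  "(x \<longlongrightarrow> z) F \<Longrightarrow> (y \<longlongrightarrow> w) F \<Longrightarrow> ((\<lambda>s. divided_diff n (x s) (y s)) \<longlongrightarrow> divided_diff n z w) F"
  unfolding divided_diff_def by (intro tendsto_intros)

lemma tendsto_divided_diff2 [tendsto_intros]:
  "(x \<longlongrightarrow> z) F \<Longrightarrow> (y \<longlongrightarrow> w) F \<Longrightarrow> (v \<longlongrightarrow> u) F \<Longrightarrow>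
    ((\<lambda>s. divided_diff2 n (x s) (y s) (v s)) \<longlongrightarrow> divided_diff2 n z w u) F"
  unfolding divided_diff2_def by (intro tendsto_intros)

text \<open>After multiplication by \<open>t\<^sup>a\<close>, this is the equation \<open>t\<^sup>b +
t\<^sup>-\<^sup>a = c\<close> of a fiber of \<open>W\<close>, for \<open>l = a + b\<close>.\<close>

definition trinomial_root :: "nat \<Rightarrow> nat \<Rightarrow> complex \<Rightarrow> complex \<Rightarrow> bool" where
  "trinomial_root l a c t \<longleftrightarrow> t ^ l + 1 = c * t ^ a"

lemma trinomial_divided_diff:
  assumes "trinomial_root l a c x" "trinomial_root l a c y" "x \<noteq> y"
  shows "divided_diff l x y = c * divided_diff a x y"
proof -
  have "(x - y) * divided_diff l x y = (x ^ l + 1) - (y ^ l + 1)"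
    by (simp add: power_diff_divided_diff[symmetric])
  also have "\<dots> = c * (x ^ a - y ^ a)"
    using assms(1,2) by (simp add: trinomial_root_def right_diff_distrib)
  also have "\<dots> = (x - y) * (c * divided_diff a x y)"
    by (simp add: power_diff_divided_diff)
  finally show ?thesis using assms(3) by simp
qed

text \<open>Two distinct roots make the divided difference of the trinomial vanish. In the limit that quantity becomes
the derivative at \<open>z\<close>; the last hypothesis says that \<open>z\<close> times this derivative is
nonzero.\<close>

lemma trinomial_simple_root:
  assumes x: "(x \<longlongrightarrow> z) F" and y: "(y \<longlongrightarrow> z) F" and c: "(c \<longlongrightarrow> c0) F"
    and roots: "\<forall>\<^sub>F s in F. trinomial_root l a (c s) (x s) \<and> trinomial_root l a (c s) (y s)"
    and simple: "of_nat l * z ^ l \<noteq> c0 * of_nat a * z ^ a"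
  shows "\<forall>\<^sub>F s in F. x s = y s"
proof -
  have "z * (divided_diff l z z - c0 * divided_diff a z z) = of_nat l * z ^ l - c0 * of_nat a * z ^ a"
    by (simp add: right_diff_distrib divided_diff_diag mult.left_commute[of z c0] mult.assoc)
  then have "divided_diff l z z - c0 * divided_diff a z z \<noteq> 0"
    using simple by auto
  moreover have "((\<lambda>s. divided_diff l (x s) (y s) - c s * divided_diff a (x s) (y s)) \<longlongrightarrow>
      divided_diff l z z - c0 * divided_diff a z z) F"
    by (intro tendsto_intros x y c)
  ultimately have "\<forall>\<^sub>F s in F. divided_diff l (x s) (y s) - c s * divided_diff a (x s) (y s) \<noteq> 0"
    using tendsto_imp_eventually_ne by blast
  with roots show ?thesis
  proof eventually_elim
    case (elim s)
    then show ?case using trinomial_divided_diff[of l a "c s" "x s" "y s"] by auto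
  qed
qed

text \<open>Three distinct roots make the second divided difference vanish, and its limit is half the second
derivative at \<open>z\<close>; the conclusion is multiplied by \<open>z\<^sup>2\<close>.\<close>

lemma trinomial_double_root:
  assumes x: "(x \<longlongrightarrow> z) F" and y: "(y \<longlongrightarrow> z) F" and w: "(w \<longlongrightarrow> z) F" and c: "(c \<longlongrightarrow> c0) F"
    and F: "F \<noteq> bot"
    and roots: "\<forall>\<^sub>F s in F. trinomial_root l a (c s) (x s) \<and> trinomial_root l a (c s) (y s) \<and>
      trinomial_root l a (c s) (w s) \<and> x s \<noteq> y s \<and> x s \<noteq> w s \<and> y s \<noteq> w s"
  shows "of_nat l * (of_nat l - 1) * z ^ l = c0 * (of_nat a * (of_nat a - 1)) * z ^ a"
proof -
  have "\<forall>\<^sub>F s in F. divided_diff2 l (x s) (y s) (w s) - c s * divided_diff2 a (x s) (y s) (w s) = 0"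
    using roots
  proof eventually_elim
    case (elim s)
    have "(y s - w s) * divided_diff2 l (x s) (y s) (w s) =
        divided_diff l (x s) (y s) - divided_diff l (x s) (w s)"
      by (rule divided_diff_diff[symmetric])
    also have "\<dots> = c s * (divided_diff a (x s) (y s) - divided_diff a (x s) (w s))"
      using elim trinomial_divided_diff[of l a "c s" "x s" "y s"]
        trinomial_divided_diff[of l a "c s" "x s" "w s"] by (simp add: right_diff_distrib)
    also have "\<dots> = (y s - w s) * (c s * divided_diff2 a (x s) (y s) (w s))"
      by (simp add: divided_diff_diff)
    finally show ?case using elim by simp
  qed
  then have "((\<lambda>s. divided_diff2 l (x s) (y s) (w s) - c s * divided_diff2 a (x s) (y s) (w s)) \<longlongrightarrow> 0) F"
    by (rule tendsto_eventually)
  moreover have "((\<lambda>s. divided_diff2 l (x s) (y s) (w s) - c s * divided_diff2 a (x s) (y s) (w s)) \<longlongrightarrow>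
      divided_diff2 l z z z - c0 * divided_diff2 a z z z) F"
    by (intro tendsto_intros x y c w)
  ultimately have "divided_diff2 l z z z - c0 * divided_diff2 a z z z = 0"
    using tendsto_unique[OF F] by blast
  then have "divided_diff2 l z z z = c0 * divided_diff2 a z z z" by simp
  then have "2 * z\<^sup>2 * divided_diff2 l z z z = c0 * (2 * z\<^sup>2 * divided_diff2 a z z z)"
    by (simp only: mult_ac)
  then show ?thesis unfolding divided_diff2_diag by (simp only: mult.assoc)
qed

text \<open>Simple roots cannot split, so the set where the two lifts agree is open as well as closed in \<open>[0,
1)\<close>. At the end, where the root may be multiple, they agree by continuity.\<close>

lemma trinomial_lifts_agree:
  fixes x y c :: "real \<Rightarrow> complex"
  assumes cont: "continuous_on {0..1} x" "continuous_on {0..1} y" "continuous_on {0..1} c"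
    and roots: "\<And>s. s \<in> {0..1} \<Longrightarrow> trinomial_root l a (c s) (x s) \<and> trinomial_root l a (c s) (y s)"
    and simple: "\<And>s. s \<in> {0..<1} \<Longrightarrow> of_nat l * x s ^ l \<noteq> c s * of_nat a * x s ^ a"
    and eq: "s0 \<in> {0..<1}" "x s0 = y s0" and s: "s \<in> {0..1}"
  shows "x s = y s"
proof -
  let ?I = "{0..<1::real}" and ?S = "{s\<in>{0..<1}. x s = y s}"
  have contI: "continuous_on ?I x" "continuous_on ?I y" "continuous_on ?I c"
    by (rule continuous_on_subset[OF cont(1)] continuous_on_subset[OF cont(2)]
        continuous_on_subset[OF cont(3)]; auto)+
  have "closedin (top_of_set ?I) ?S"
    using continuous_closedin_preimage_constant[of ?I "\<lambda>s. x s - y s" 0] contI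
    by (simp add: continuous_on_diff)
  \<comment> \<open>Openness: near a simple root the two lifts cannot separate.\<close>
  moreover have "openin (top_of_set ?I) ?S"
    unfolding openin_subopen[of _ ?S]
  proof
    fix t assume t: "t \<in> ?S"
    then have tI: "t \<in> ?I" and xy: "x t = y t" by auto
    have "\<forall>\<^sub>F s in at t within ?I. x s = y s"
    proof (rule trinomial_simple_root)
      show "(x \<longlongrightarrow> x t) (at t within ?I)" "(y \<longlongrightarrow> x t) (at t within ?I)" "(c \<longlongrightarrow> c t) (at t within ?I)"
        using contI[unfolded continuous_on_def, THEN bspec, OF tI] by (simp_all only: xy)
      show "\<forall>\<^sub>F s in at t within ?I. trinomial_root l a (c s) (x s) \<and> trinomial_root l a (c s) (y s)"
        unfolding eventually_at_filter by (rule always_eventually) (use roots in simp)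
      show "of_nat l * x t ^ l \<noteq> c t * of_nat a * x t ^ a"
        by (rule simple[OF tI])
    qed
    then obtain U where U: "open U" "t \<in> U" "\<And>s. s \<in> U \<Longrightarrow> s \<noteq> t \<Longrightarrow> s \<in> ?I \<Longrightarrow> x s = y s"
      unfolding eventually_at_topological by blast
    have "?I \<inter> U \<subseteq> ?S"
    proof
      fix s assume "s \<in> ?I \<inter> U"
      then show "s \<in> ?S" using U(3)[of s] xy by (cases "s = t") auto
    qed
    then show "\<exists>T. openin (top_of_set ?I) T \<and> t \<in> T \<and> T \<subseteq> ?S"
      using U tI by (intro exI[of _ "?I \<inter> U"]) auto
  qed
  moreover have "?S \<noteq> {}" using eq by blast
  ultimately have S: "?S = ?I"
    using connected_clopen[of ?I] connected_Ico[of 0 "1::real"] by blast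
  show ?thesis
  proof (cases "s = 1")
    case False
    then have "s \<in> ?I" using s by auto
    then show ?thesis using S by blast
  next
    case True
    have sub: "?I \<subseteq> {0..1}" by auto
    have lim: "(x \<longlongrightarrow> x 1) (at 1 within ?I)" "(y \<longlongrightarrow> y 1) (at 1 within ?I)"
      using cont(1,2)[unfolded continuous_on_def, THEN bspec, of 1, THEN tendsto_within_subset[OF _ sub]]
      by simp_all
    moreover have "\<forall>\<^sub>F s in at 1 within ?I. x s = y s"
      unfolding eventually_at_filter by (rule always_eventually) (use S in blast)
    ultimately have "(y \<longlongrightarrow> x 1) (at 1 within ?I)"
      using Lim_transform_eventually by blast
    moreover have "at (1::real) within ?I \<noteq> bot"
      by (simp add: at_within_eq_bot_iff)
    ultimately show ?thesis using True lim(2) tendsto_unique by blast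
  qed
qed

section \<open>The thimble over the positive real critical value\<close>

text \<open>The function \<open>sin (n x) / sin x\<close> by the addition theorem. This form is smooth at \<open>x =
0\<close>, where the thimble passes through the critical point.\<close>

primrec sin_quot :: "nat \<Rightarrow> real \<Rightarrow> real" where
  "sin_quot 0 x = 0"
| "sin_quot (Suc n) x = sin_quot n x * cos x + cos (real n * x)"

primrec sin_quot' :: "nat \<Rightarrow> real \<Rightarrow> real" where
  "sin_quot' 0 x = 0"
| "sin_quot' (Suc n) x = sin_quot' n x * cos x - sin_quot n x * sin x - real n * sin (real n * x)"

lemma sin_mult_sin_quot: "sin x * sin_quot n x = sin (real n * x)"
  by (induction n) (simp_all add: distrib_left distrib_right sin_add mult.commute[of "cos x"] mult.assoc[symmetric])

lemma sin_quot_minus [simp]: "sin_quot n (- x) = sin_quot n x"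
  by (induction n) simp_all

lemma sin_quot'_minus [simp]: "sin_quot' n (- x) = - sin_quot' n x"
  by (induction n) simp_all

lemma sin_quot_0 [simp]: "sin_quot n 0 = real n"
  by (induction n) simp_all

lemma sin_quot_deriv: "(sin_quot n has_real_derivative sin_quot' n x) (at x within A)"
proof (induction n)
  case (Suc n)
  show ?case by (auto intro!: derivative_eq_intros Suc simp: algebra_simps)
qed simp

lemma continuous_on_sin_quot [continuous_intros]:
  fixes f :: "real \<Rightarrow> real"
  shows "continuous_on A f \<Longrightarrow> continuous_on A (\<lambda>x. sin_quot n (f x))"
  by (induction n) (auto intro!: continuous_intros)

lemma continuous_on_sin_quot' [continuous_intros]:
  fixes f :: "real \<Rightarrow> real"
  shows "continuous_on A f \<Longrightarrow> continuous_on A (\<lambda>x. sin_quot' n (f x))"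
  by (induction n) (auto intro!: continuous_intros)

lemma sin_quot_pos:
  assumes "n > 0" "real n * \<bar>x\<bar> < pi"
  shows "sin_quot n x > 0"
proof (cases "x = 0")
  case False
  define y where "y = \<bar>x\<bar>"
  have y: "0 < y" "real n * y < pi" using False assms by (auto simp: y_def)
  have "y \<le> real n * y" using assms(1) y by simp
  then have "y < pi" using y(2) by (rule order.strict_trans1)
  then have "sin y > 0" by (rule sin_gt_zero[OF y(1)])
  moreover have "sin (real n * y) > 0"
    using y assms by (intro sin_gt_zero) auto
  ultimately have "sin_quot n y > 0"
    using sin_mult_sin_quot[of y n] by (metis zero_less_mult_pos)
  then show ?thesis by (cases "x \<ge> 0") (simp_all add: y_def)
qed (use assms in simp)

lemma sin_mult_sin_quot': "cos x * sin_quot n x + sin x * sin_quot' n x = real n * cos (real n * x)"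
proof -
  have "((\<lambda>x. sin x * sin_quot n x) has_real_derivative cos x * sin_quot n x + sin x * sin_quot' n x) (at x)"
    by (auto intro!: derivative_eq_intros sin_quot_deriv)
  moreover have "((\<lambda>x. sin (real n * x)) has_real_derivative real n * cos (real n * x)) (at x)"
    by (auto intro!: derivative_eq_intros)
  ultimately show ?thesis
    unfolding sin_mult_sin_quot by (rule DERIV_unique)
qed

locale coprime_pair =
  fixes a b :: nat
  assumes pos: "a > 0" "b > 0" and coprime: "coprime a b"
begin

text \<open>The angle between the critical point on the positive real axis and each of the two nearest roots of
\<open>t\<^sup>a\<^sup>+\<^sup>b = -1\<close>.\<close>

definition half_width :: real where
  "half_width = pi / real (a + b)"

text \<open>The positive solution of \<open>r\<^sup>a\<^sup>+\<^sup>b = sin (a x) / sin (b x)\<close>, which makes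
\<open>t\<^sup>b + t\<^sup>-\<^sup>a\<close> real for \<open>t = r e\<^sup>i\<^sup>x\<close>.\<close>

definition radius :: "real \<Rightarrow> real" where
  "radius x = exp ((ln (sin_quot a x) - ln (sin_quot b x)) / real (a + b))"

definition log_slope :: "real \<Rightarrow> real" where
  "log_slope x = (sin_quot' a x / sin_quot a x - sin_quot' b x / sin_quot b x) / real (a + b)"

definition arm :: "real \<Rightarrow> complex" where
  "arm x = of_real (radius x) * cis x"

text \<open>The real part of \<open>t\<^sup>b + t\<^sup>-\<^sup>a\<close> along the arm; for \<open>\<bar>x\<bar>
\<le> half_width\<close> it is the value of \<open>W\<close>.\<close>

definition height :: "real \<Rightarrow> real" where
  "height x = radius x ^ b * cos (real b * x) + cos (real a * x) / radius x ^ a"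

lemma half_width_mult: "real (a + b) * half_width = pi" "real a * half_width + real b * half_width = pi"
proof -
  show *: "real (a + b) * half_width = pi" using pos by (simp add: half_width_def)
  then show "real a * half_width + real b * half_width = pi" by (simp add: distrib_right)
qed

lemma half_width_pos: "0 < half_width" "half_width < pi" "real a * half_width < pi" "real b * half_width < pi"
proof -
  show w: "0 < half_width" using pos by (simp add: half_width_def)
  have ab: "real a * half_width > 0" "real b * half_width > 0" using w pos by simp_all
  then show "real a * half_width < pi" "real b * half_width < pi" using half_width_mult(2) by linarith+
  have "1 * half_width \<le> real a * half_width" using w pos by (intro mult_right_mono) auto
  then show "half_width < pi" using half_width_mult(2) ab by linarith
qed

lemma sin_quot_pos':
  assumes "\<bar>x\<bar> \<le> half_width"
  shows "sin_quot a x > 0" "sin_quot b x > 0"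
proof -
  have "real a * \<bar>x\<bar> \<le> real a * half_width" "real b * \<bar>x\<bar> \<le> real b * half_width"
    using assms by (auto intro!: mult_left_mono)
  then show "sin_quot a x > 0" "sin_quot b x > 0"
    using half_width_pos pos by (intro sin_quot_pos; linarith)+
qed

lemma radius_pos: "radius x > 0"
  by (simp add: radius_def)

lemma radius_power: 
  assumes "\<bar>x\<bar> \<le> half_width"
  shows "radius x ^ (a + b) = sin_quot a x / sin_quot b x"
proof -
  have "radius x ^ (a + b) = exp (real (a + b) * ((ln (sin_quot a x) - ln (sin_quot b x)) / real (a + b)))"
    unfolding radius_def by (rule exp_of_nat_mult[symmetric])
  also have "real (a + b) * ((ln (sin_quot a x) - ln (sin_quot b x)) / real (a + b)) =
      ln (sin_quot a x) - ln (sin_quot b x)"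
    using pos by simp
  also have "exp \<dots> = sin_quot a x / sin_quot b x"
    using sin_quot_pos'[OF assms] by (simp add: exp_diff)
  finally show ?thesis .
qed

lemma radius_minus [simp]: "radius (- x) = radius x"
  by (simp add: radius_def)

lemma log_slope_minus [simp]: "log_slope (- x) = - log_slope x"
  by (simp add: log_slope_def diff_divide_distrib)

lemma height_minus [simp]: "height (- x) = height x"
  by (simp add: height_def)

lemma arm_minus: "arm (- x) = cnj (arm x)"
  by (simp add: arm_def cis_cnj)

lemma arm_nonzero [simp]: "arm x \<noteq> 0"
  using radius_pos[of x] by (simp add: arm_def)

lemma radius_deriv:
  assumes "\<bar>x\<bar> \<le> half_width"
  shows "(radius has_real_derivative radius x * log_slope x) (at x within A)"
proof -
  have ln: "((\<lambda>x. ln (sin_quot n x)) has_real_derivative sin_quot' n x / sin_quot n x) (at x within A)"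
    if "sin_quot n x > 0" for n
    using that by (auto intro!: derivative_eq_intros sin_quot_deriv)
  show ?thesis
    unfolding radius_def[abs_def] log_slope_def
    by (intro DERIV_chain2[OF DERIV_exp] DERIV_cdivide DERIV_diff ln sin_quot_pos'[OF assms])
qed

lemma cis_deriv: "(cis has_vector_derivative \<i> * cis x) (at x within A)"
proof -
  have "((\<lambda>z. exp (\<i> * z)) has_field_derivative \<i> * exp (\<i> * complex_of_real x)) (at (of_real x))"
    by (auto intro!: derivative_eq_intros)
  then show ?thesis
    unfolding cis_conv_exp[abs_def] by (rule has_vector_derivative_real_field)
qed

lemma arm_deriv:
  assumes "\<bar>x\<bar> \<le> half_width"
  shows "(arm has_vector_derivative arm x * Complex (log_slope x) 1) (at x within A)"
proof -
  have "((\<lambda>x. of_real (radius x) * cis x) has_vector_derivative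
      of_real (radius x) * (\<i> * cis x) + of_real (radius x * log_slope x) * cis x) (at x within A)"
    by (intro has_vector_derivative_mult has_vector_derivative_of_real cis_deriv
        radius_deriv[OF assms])
  then show ?thesis
    unfolding arm_def[abs_def] by (simp add: algebra_simps Complex_eq)
qed

lemma continuous_on_log_slope: "A \<subseteq> {-half_width..half_width} \<Longrightarrow> continuous_on A log_slope"
proof -
  assume A: "A \<subseteq> {-half_width..half_width}"
  have nz: "sin_quot a x \<noteq> 0 \<and> sin_quot b x \<noteq> 0" if "x \<in> A" for x
  proof -
    have "\<bar>x\<bar> \<le> half_width" using A that by (auto simp: abs_le_iff)
    then show ?thesis using sin_quot_pos'[of x] by simp
  qed
  show ?thesis
    unfolding log_slope_def[abs_def] using nz pos by (intro continuous_intros) auto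
qed

lemma continuous_on_arm: "A \<subseteq> {-half_width..half_width} \<Longrightarrow> continuous_on A arm"
  by (rule continuous_on_vector_derivative[of _ _ "\<lambda>x. arm x * Complex (log_slope x) 1"])
     (auto intro!: arm_deriv simp: abs_le_iff)

text \<open>At the end of the arm \<open>a x\<close> and \<open>b x\<close> are supplementary angles, so \<open>a cot
(a x) - b cot (b x)\<close> collapses to \<open>(a + b) cot (a x)\<close>.\<close>

lemma log_slope_half_width: "log_slope half_width = cot (real a * half_width)"
proof -
  define s c where "s = sin (real a * half_width)" and "c = cos (real a * half_width)"
  have bw: "real b * half_width = pi - real a * half_width" using half_width_mult(2) by linarith
  have s: "s > 0" unfolding s_def using pos half_width_pos by (intro sin_gt_zero) auto
  have sw: "sin half_width > 0" using half_width_pos by (intro sin_gt_zero)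
  have qa: "sin_quot a half_width = s / sin half_width" "sin_quot b half_width = s / sin half_width"
    using sin_mult_sin_quot[of half_width a] sin_mult_sin_quot[of half_width b] sw by (auto simp: s_def bw field_simps)
  have da: "sin_quot' a half_width = (real a * c - cos half_width * sin_quot a half_width) / sin half_width"
    and db: "sin_quot' b half_width = (- real b * c - cos half_width * sin_quot b half_width) / sin half_width"
    using sin_mult_sin_quot'[of half_width a] sin_mult_sin_quot'[of half_width b] sw by (auto simp: c_def bw field_simps)
  have "log_slope half_width = (real (a + b) * c / s) / real (a + b)"
  proof -
    have "sin_quot' a half_width / sin_quot a half_width - sin_quot' b half_width / sin_quot b half_width = real (a + b) * c / s"
    proof -
      have eq: "(x * c - cos half_width * (s / sin half_width)) / sin half_width / (s / sin half_width) = x * (c / s) - cos half_width / sin half_width" for x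
        using s sw by (simp add: field_simps)
      show ?thesis
        unfolding da db qa eq by (simp add: distrib_right add_divide_distrib)
    qed
    then show ?thesis by (simp add: log_slope_def)
  qed
  then show ?thesis using pos by (simp add: cot_def s_def c_def)
qed

lemma arm_power_sum:
  assumes "\<bar>x\<bar> \<le> half_width"
  shows "arm x ^ b + inverse (arm x) ^ a = of_real (height x)"
proof -
  have q: "sin_quot a x > 0" "sin_quot b x > 0" by (rule sin_quot_pos'[OF assms])+
  have "radius x ^ (a + b) * sin (real b * x) = sin (real a * x)"
    using q unfolding radius_power[OF assms] sin_mult_sin_quot[symmetric] by simp
  then have im: "radius x ^ b * sin (real b * x) = sin (real a * x) / radius x ^ a"
    using radius_pos[of x] by (simp add: power_add field_simps)
  have b: "arm x ^ b = Complex (radius x ^ b * cos (real b * x)) (radius x ^ b * sin (real b * x))"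
    unfolding arm_def power_mult_distrib Complex.DeMoivre unfolding cis.code
    by (simp add: complex_eq_iff flip: of_real_power)
  have "inverse (arm x) = of_real (1 / radius x) * cis (- x)"
    unfolding arm_def inverse_mult_distrib cis_inverse by (simp add: inverse_eq_divide)
  then have a: "inverse (arm x) ^ a = of_real ((1 / radius x) ^ a) * cis (- (real a * x))"
    by (simp only: power_mult_distrib Complex.DeMoivre of_real_power mult_minus_right)
  have a: "inverse (arm x) ^ a = Complex (cos (real a * x) / radius x ^ a) (- (sin (real a * x) / radius x ^ a))"
    unfolding a unfolding cis.code by (simp add: complex_eq_iff power_divide flip: of_real_power)
  show ?thesis
    unfolding a b using im by (simp add: complex_eq_iff height_def)
qed

text \<open>A critical point satisfies \<open>t\<^sup>a\<^sup>+\<^sup>b = a / b > 0\<close>, but \<open>(a + b)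
x\<close> stays in \<open>[-\<pi>, \<pi>]\<close> along the arm, so its argument vanishes only at \<open>x =
0\<close>.\<close>

lemma arm_critical:
  assumes "\<bar>x\<bar> \<le> half_width" "arm x ^ (a + b) = of_nat a / of_nat b"
  shows "x = 0"
proof (rule ccontr)
  assume x: "x \<noteq> 0"
  have l: "real (a + b) * half_width = pi" using pos by (simp add: half_width_def)
  have lx: "real (a + b) * \<bar>x\<bar> \<le> pi"
    using mult_left_mono[OF assms(1), of "real (a + b)"] l by simp
  define R N where "R = radius x ^ (a + b)" and "N = real (a + b) * x"
  have R: "R > 0" using radius_pos[of x] by (simp add: R_def)
  have "of_real R * cis N = arm x ^ (a + b)"
    unfolding R_def N_def arm_def power_mult_distrib Complex.DeMoivre of_real_power by (rule refl)
  also have "\<dots> = of_real (real a / real b)" using assms(2) by (simp only: of_real_divide of_real_of_nat_eq)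
  finally have "R * cos N = real a / real b" "R * sin N = 0"
    by (auto dest: arg_cong[where f = Re] arg_cong[where f = Im])
  moreover have "real a / real b > 0" using pos by simp
  ultimately have c: "cos N > 0" and s: "sin N = 0"
    using R by (metis zero_less_mult_pos, metis mult_eq_0_iff less_irrefl)
  define K where "K = real (a + b) * \<bar>x\<bar>"
  have "K = N \<or> K = - N"
    unfolding K_def N_def by (metis abs_if mult_minus_right)
  then have "cos K > 0" "sin K = 0" using c s by auto
  moreover have "0 < K" unfolding K_def using x pos by (intro mult_pos_pos) auto
  moreover have "K \<le> pi" using lx by (simp only: K_def)
  ultimately have "K = pi"
    using sin_gt_zero[of K] by (metis less_irrefl order_le_less)
  then show False using \<open>cos K > 0\<close> by simp
qed

end

section \<open>Monotonicity of \<open>W\<close> along half of the thimble\<close>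

context coprime_pair
begin

lemma half_width_supplement: "real b * half_width = pi - real a * half_width"
  using half_width_mult(2) by linarith

lemma radius_half_width: "radius half_width = 1"
proof -
  have half_width_le: "\<bar>half_width\<bar> \<le> half_width" using half_width_pos(1) by simp
  have "sin half_width * sin_quot a half_width = sin half_width * sin_quot b half_width"
    unfolding sin_mult_sin_quot half_width_supplement sin_pi_minus by (rule refl)
  then have "sin_quot a half_width = sin_quot b half_width"
    using sin_gt_zero[OF half_width_pos(1,2)] by simp
  then have "radius half_width ^ (a + b) = 1 ^ (a + b)"
    using radius_power[OF half_width_le] sin_quot_pos'(2)[OF half_width_le] by (simp only: power_one divide_self less_irrefl simp_thms)
  then show ?thesis
    by (rule power_eq_imp_eq_base) (use radius_pos[of half_width] pos in linarith)+
qed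

lemma arm_half_width: "arm half_width = cis half_width"
  by (simp add: arm_def radius_half_width)

lemma height_half_width: "height half_width = 0"
  unfolding height_def radius_half_width half_width_supplement cos_pi_minus by simp

lemma radius_0_power: "radius 0 ^ (a + b) = real a / real b"
  using radius_power[of 0] half_width_pos(1) by simp

lemma height_0: "height 0 * radius 0 ^ a = real (a + b) / real b" "height 0 > 0"
proof -
  have "radius 0 ^ (a + b) = real a / real b" by (rule radius_0_power)
  then show "height 0 * radius 0 ^ a = real (a + b) / real b"
  proof -
    have "height 0 * radius 0 ^ a = radius 0 ^ (a + b) + 1"
      using radius_pos[of 0] by (simp add: height_def distrib_right power_add mult.commute[of "radius 0 ^ a"])
    also have "\<dots> = real (a + b) / real b"
      unfolding \<open>radius 0 ^ (a + b) = real a / real b\<close> using pos by (simp add: add_divide_distrib)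
    finally show ?thesis .
  qed
  show "height 0 > 0"
    using radius_pos[of 0] by (simp add: height_def add_pos_pos)
qed

text \<open>This identifies the modulus in \<open>crit_value\<close> with the value of \<open>W\<close> at the
critical point \<open>x = 0\<close> of the arm.\<close>

lemma critical_radius: "root (a + b) (real ((a + b) ^ (a + b)) / real (a ^ a * b ^ b)) = height 0"
proof (rule real_root_pos_unique)
  have r: "radius 0 ^ (a + b) = real a / real b" by (rule radius_0_power)
  have "height 0 ^ (a + b) * (radius 0 ^ (a + b)) ^ a = (height 0 * radius 0 ^ a) ^ (a + b)"
    by (simp only: power_mult_distrib power_mult[symmetric] mult.commute[of a])
  then have "height 0 ^ (a + b) * (real a / real b) ^ a = (real (a + b) / real b) ^ (a + b)"
    unfolding r height_0(1) .
  then have "height 0 ^ (a + b) = (real (a + b) / real b) ^ (a + b) / (real a / real b) ^ a"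
    using pos by (simp add: eq_divide_eq)
  also have "\<dots> = real (a + b) ^ (a + b) / (real a ^ a * real b ^ b)"
  proof -
    have "(L / B) ^ (a + b) / (A / B) ^ a = L ^ (a + b) / (A ^ a * B ^ b)" if "B > 0" for A B L :: real
      using that by (simp add: power_divide power_add)
    then show ?thesis using pos by simp
  qed
  finally show "height 0 ^ (a + b) = real ((a + b) ^ (a + b)) / real (a ^ a * b ^ b)"
    by (simp only: of_nat_power of_nat_mult)
qed (use pos height_0 in auto)

lemma crit_value_eq: "crit_value a b j = of_real (height 0) * cis (- (2 * pi * real j / real (a + b)))"
proof -
  have "exp (- (2 * pi * \<i> * of_nat j / of_nat (a + b))) = cis (- (2 * pi * real j / real (a + b)))"
    unfolding cis_conv_exp by (rule arg_cong[where f = exp]) simp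
  then show ?thesis unfolding crit_value_def critical_radius by simp
qed

lemma seg_eq: "seg a b j s = of_real s * crit_value a b j"
  by (simp add: seg_def linepath_def scaleR_conv_of_real)

text \<open>The derivative of \<open>W\<close> along the arm is real, since \<open>W\<close> is real there, and by the
chain rule it vanishes only at a critical point of \<open>W\<close>.\<close>

lemma height_deriv:
  assumes x: "0 < x" "x < half_width"
  shows "\<exists>d. d \<noteq> 0 \<and> (height has_real_derivative d) (at x)"
proof -
  let ?G = "\<lambda>x. arm x ^ b + inverse (arm x) ^ a"
  define z where "z = arm x"
  define D where "D = Complex (log_slope x) 1 * (of_nat b * z ^ b - of_nat a * inverse z ^ a)"
  have z: "z \<noteq> 0" by (simp add: z_def)
  have ax: "\<bar>x\<bar> \<le> half_width" using x by simp
  let ?d = "of_nat b * z ^ (b - 1) - of_nat a * inverse z ^ (a - 1) * inverse z ^ 2"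
  have "((\<lambda>z. z ^ b + inverse z ^ a) has_field_derivative ?d) (at z)"
    using z by (auto intro!: derivative_eq_intros simp: power2_eq_square)
  from field_vector_diff_chain_at[OF arm_deriv[OF ax, of UNIV] this[unfolded z_def]]
  have "(?G has_vector_derivative arm x * Complex (log_slope x) 1 * ?d) (at x)"
    by (simp only: o_def z_def)
  also have "arm x * Complex (log_slope x) 1 * ?d = D"
  proof -
    have "z ^ b = z ^ (b - 1) * z" using pos by (cases b) auto
    moreover have "z * (inverse z ^ (a - 1) * inverse z ^ 2) = inverse z ^ a"
      using pos z by (cases a) (auto simp: power2_eq_square)
    ultimately show ?thesis unfolding D_def z_def[symmetric] by (simp add: right_diff_distrib mult_ac)
  qed
  finally have G: "(?G has_vector_derivative D) (at x)" .
  have h: "((\<lambda>x. complex_of_real (height x)) has_vector_derivative D) (at x)"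
  proof (rule has_vector_derivative_transform_within_open[OF G])
    show "open {0<..<half_width}" "x \<in> {0<..<half_width}" using x by auto
    show "?G y = complex_of_real (height y)" if "y \<in> {0<..<half_width}" for y
      using that by (intro arm_power_sum) auto
  qed
  have re: "(height has_real_derivative Re D) (at x)"
    using bounded_linear.has_vector_derivative[OF bounded_linear_Re h]
    by (simp add: has_real_derivative_iff_has_vector_derivative)
  have "((\<lambda>x. 0) has_vector_derivative Im D) (at x)"
    using bounded_linear.has_vector_derivative[OF bounded_linear_Im h] by simp
  \<comment> \<open>The height is real, so its complex derivative has no imaginary part.\<close>
  then have im: "Im D = 0"
    using vector_derivative_unique_at[OF _ has_vector_derivative_const] by blast
  have "D \<noteq> 0"
  proof
    assume "D = 0"
    then have "of_nat b * z ^ b - of_nat a * inverse z ^ a = 0"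
      unfolding D_def mult_eq_0_iff by (auto simp: complex_eq_iff)
    then have eq: "of_nat b * z ^ b = of_nat a * inverse z ^ a" by simp
    have "of_nat b * z ^ (a + b) = z ^ a * (of_nat b * z ^ b)" by (simp add: power_add)
    also have "\<dots> = of_nat a" unfolding eq using z by (simp add: power_inverse)
    finally have "arm x ^ (a + b) = of_nat a / of_nat b" using pos by (simp add: z_def eq_divide_eq mult.commute)
    from arm_critical[OF ax this] x show False by simp
  qed
  then have "Re D \<noteq> 0" using im by (auto simp: complex_eq_iff)
  with re show ?thesis by blast
qed

lemma continuous_on_height: "A \<subseteq> {-half_width..half_width} \<Longrightarrow> continuous_on A height"
proof -
  assume A: "A \<subseteq> {-half_width..half_width}"
  have "continuous_on A radius"
    by (rule DERIV_continuous_on[OF radius_deriv]) (use A in \<open>auto simp: abs_le_iff\<close>)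
  moreover have "radius x \<noteq> 0" for x using radius_pos[of x] by simp
  ultimately show ?thesis
    unfolding height_def[abs_def] by (intro continuous_intros) simp_all
qed

lemma height_inj: "inj_on height {0..half_width}"
proof -
  have "height x \<noteq> height y" if xy: "0 \<le> x" "x < y" "y \<le> half_width" for x y
  proof
    assume "height x = height y"
    moreover have "continuous_on {x..y} height"
      using xy half_width_pos by (intro continuous_on_height) auto
    moreover have "height differentiable (at t)" if "x < t" "t < y" for t
      using height_deriv[of t] that xy unfolding real_differentiable_def by auto
    ultimately obtain z where z: "x < z" "z < y" "(height has_real_derivative 0) (at z)"
      using Rolle[of x y height] xy(2) by blast
    obtain d where "d \<noteq> 0" "(height has_real_derivative d) (at z)"
      using height_deriv[of z] z xy by auto
    then show False using DERIV_unique[OF z(3)] by blast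
  qed
  then show ?thesis
    by (intro linorder_inj_onI) auto
qed

lemma height_image: "height ` {0..half_width} = {0..height 0}"
proof (intro equalityI subsetI)
  have cont: "continuous_on {0..half_width} height"
    using half_width_pos(1) by (intro continuous_on_height) auto
  fix y
  assume "y \<in> height ` {0..half_width}"
  then obtain x where x: "0 \<le> x" "x \<le> half_width" "y = height x" by auto
  have "height x \<in> {0..height 0}"
  proof (cases "x = 0 \<or> x = half_width")
    case True
    then show ?thesis using height_0 height_half_width by auto
  next
    case False
    then have "0 < x" "x < half_width" using x by auto
    from continuous_inj_imp_mono[OF this cont height_inj] show ?thesis
      using height_0(2) height_half_width by auto
  qed
  then show "y \<in> {0..height 0}" using x by simp
next
  have cont: "continuous_on {0..half_width} height"
    using half_width_pos(1) by (intro continuous_on_height) auto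
  fix y
  assume "y \<in> {0..height 0}"
  then obtain x where "0 \<le> x" "x \<le> half_width" "height x = y"
    using IVT2'[of height half_width y 0, OF _ _ _ cont] height_half_width half_width_pos(1) by auto
  then show "y \<in> height ` {0..half_width}" by auto
qed

text \<open>The angle at which the upper arm lies over the point of parameter \<open>s\<close> of the segment.\<close>

definition angle_at :: "real \<Rightarrow> real" where
  "angle_at s = inv_into {0..half_width} height (s * height 0)"

lemma angle_at: 
  assumes "s \<in> {0..1}"
  shows "angle_at s \<in> {0..half_width}" "height (angle_at s) = s * height 0" "\<bar>angle_at s\<bar> \<le> half_width"
proof -
  have "s * height 0 \<in> height ` {0..half_width}"
    unfolding height_image using assms height_0 by (auto simp: mult_le_cancel_right1)
  then show "angle_at s \<in> {0..half_width}" "height (angle_at s) = s * height 0"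
    unfolding angle_at_def by (rule inv_into_into f_inv_into_f; assumption)+
  then show "\<bar>angle_at s\<bar> \<le> half_width" by simp
qed

lemma angle_at_ends: "angle_at 0 = half_width" "angle_at 1 = 0"
proof -
  have e: "0 \<in> {0..1::real}" "1 \<in> {0..1::real}" and w: "0 \<in> {0..half_width}" "half_width \<in> {0..half_width}"
    using half_width_pos(1) by simp_all
  show "angle_at 0 = half_width" using angle_at(2)[OF e(1)] height_half_width by (intro inj_onD[OF height_inj _ angle_at(1)[OF e(1)] w(2)]) simp
  show "angle_at 1 = 0" using angle_at(2)[OF e(2)] by (intro inj_onD[OF height_inj _ angle_at(1)[OF e(2)] w(1)]) simp
qed

lemma angle_at_pos:
  assumes "s \<in> {0..<1}"
  shows "0 < angle_at s"
proof -
  have s: "s \<in> {0..1}" using assms by simp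
  have "angle_at s \<noteq> 0"
    using angle_at(2)[OF s] height_0(2) assms by (metis atLeastLessThan_iff less_irrefl mult_cancel_right1)
  then show ?thesis using angle_at(1)[OF s] by simp
qed

lemma angle_at_image: "angle_at ` {0..1} = {0..half_width}"
proof (intro equalityI subsetI)
  fix x assume "x \<in> {0..half_width}"
  then have "height x \<in> {0..height 0}" using height_image by blast
  then have s: "height x / height 0 \<in> {0..1}" using height_0 by auto
  then have "height (angle_at (height x / height 0)) = height x" using angle_at(2)[OF s] height_0 by simp
  then have "angle_at (height x / height 0) = x"
    using inj_onD[OF height_inj _ angle_at(1)[OF s] \<open>x \<in> {0..half_width}\<close>] by blast
  then show "x \<in> angle_at ` {0..1}" using imageI[OF s, of angle_at] by simp
qed (use angle_at in blast)

lemma continuous_on_angle_at: "continuous_on {0..1} angle_at"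
proof -
  have "continuous_on (height ` {0..half_width}) (inv_into {0..half_width} height)"
    by (rule continuous_on_inv) (auto simp: continuous_on_height height_inj inv_into_f_f)
  then have "continuous_on ((\<lambda>s. s * height 0) ` {0..1}) (inv_into {0..half_width} height)"
    by (rule continuous_on_subset)
       (use height_0 in \<open>auto simp: height_image mult_le_cancel_right1\<close>)
  then show ?thesis
    unfolding angle_at_def[abs_def]
    by (rule continuous_on_compose2[where g = "inv_into {0..half_width} height"]) (auto intro!: continuous_intros)
qed

end

section \<open>Lifts of the segments\<close>

context coprime_pair
begin

definition bez_a :: int where "bez_a = fst (bezout_coefficients (int a) (int b))"
definition bez_b :: int where "bez_b = snd (bezout_coefficients (int a) (int b))"

lemma bezout: "bez_a * int a + bez_b * int b = 1"
proof -
  have "gcd (int a) (int b) = 1" using coprime by simp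
  then show ?thesis
    unfolding bez_a_def bez_b_def by (metis bezout_coefficients_fst_snd)
qed

definition par :: "complex \<Rightarrow> point" where
  "par t = (t ^ b, inverse t ^ a)"

text \<open>By coprimality \<open>t = t\<^sup>p\<^sup>a\<^sup>+\<^sup>q\<^sup>b\<close> for integers \<open>p\<close>
and \<open>q\<close>, so \<open>t\<close> is a monomial in \<open>t\<^sup>b\<close> and
\<open>t\<^sup>-\<^sup>a\<close>.\<close>

definition coord :: "point \<Rightarrow> complex" where
  "coord p = fst p powi bez_b * snd p powi (- bez_a)"

lemma coord_par:
  assumes "t \<noteq> 0"
  shows "coord (par t) = t"
proof -
  have "par t = (t powi int b, t powi (- int a))"
    by (simp add: par_def power_int_minus power_inverse)
  then have "coord (par t) = t powi (int b * bez_b) * t powi (- int a * - bez_a)"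
    by (simp only: coord_def fst_conv snd_conv power_int_mult)
  also have "\<dots> = t powi (bez_a * int a + bez_b * int b)"
    using assms by (simp add: power_int_add mult.commute)
  finally show ?thesis unfolding bezout by simp
qed

lemma par_coord:
  assumes "p \<in> LG_X a b"
  shows "par (coord p) = p" "coord p \<noteq> 0"
proof -
  obtain x y where p: "p = (x, y)" by (cases p)
  have nz: "x \<noteq> 0" "y \<noteq> 0" and xy: "x ^ a * y ^ b = 1"
    using assms p by (auto simp: LG_X_def)
  show "coord p \<noteq> 0" using nz p by (simp add: coord_def)
  have y: "y powi (int b) = x powi (- int a)"
    using xy nz by (simp add: power_int_minus field_simps)
  have x: "x powi (int a) = y powi (- int b)"
    using xy nz by (simp add: power_int_minus field_simps)
  have "coord p ^ b = x powi (bez_b * int b) * (y powi (int b)) powi (- bez_a)"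
    unfolding p coord_def fst_conv snd_conv power_mult_distrib
    by (simp add: power_int_mult[symmetric] mult.commute flip: power_int_of_nat)
  also have "\<dots> = x powi (bez_b * int b) * x powi (bez_a * int a)"
    unfolding y by (simp add: power_int_mult[symmetric] mult.commute)
  also have "\<dots> = x powi (bez_a * int a + bez_b * int b)"
    using nz by (simp add: power_int_add mult.commute)
  finally have 1: "coord p ^ b = x" unfolding bezout by simp
  have "inverse (coord p) ^ a = (x powi (int a)) powi (- bez_b) * y powi (bez_a * int a)"
    unfolding p coord_def fst_conv snd_conv inverse_mult_distrib power_mult_distrib
    by (simp add: power_int_mult[symmetric] power_int_minus[symmetric] mult.commute flip: power_int_of_nat)
  also have "\<dots> = y powi (bez_b * int b) * y powi (bez_a * int a)"
    unfolding x by (simp add: power_int_mult[symmetric] mult.commute)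
  also have "\<dots> = y powi (bez_a * int a + bez_b * int b)"
    using nz by (simp add: power_int_add mult.commute)
  finally have 2: "inverse (coord p) ^ a = y" unfolding bezout by simp
  show "par (coord p) = p" using 1 2 p by (simp add: par_def)
qed

lemma par_in_LG_X: "t \<noteq> 0 \<Longrightarrow> par t \<in> LG_X a b"
  by (simp add: par_def LG_X_def power_inverse power_mult[symmetric] mult.commute)

lemma continuous_on_coord: "continuous_on (LG_X a b) coord"
  unfolding coord_def by (intro continuous_intros) (auto simp: LG_X_def)

lemma continuous_on_par: "continuous_on A f \<Longrightarrow> (\<And>s. s \<in> A \<Longrightarrow> f s \<noteq> 0) \<Longrightarrow> continuous_on A (\<lambda>s. par (f s))"
  for f :: "real \<Rightarrow> complex"
  unfolding par_def by (intro continuous_intros) auto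

lemma LG_W_par_iff: "t \<noteq> 0 \<Longrightarrow> LG_W (par t) = c \<longleftrightarrow> trinomial_root (a + b) a c t"
proof -
  assume t: "t \<noteq> 0"
  have "LG_W (par t) * t ^ a = t ^ (a + b) + 1"
    using t by (simp add: LG_W_def par_def power_add power_inverse distrib_right)
  moreover have "t ^ a \<noteq> 0" using t by simp
  ultimately show ?thesis
    unfolding trinomial_root_def by (metis mult_cancel_right)
qed

lemma trinomial_root_nonzero: "trinomial_root (a + b) a c t \<Longrightarrow> t \<noteq> 0"
  using pos by (cases "t = 0") (auto simp: trinomial_root_def power_0_left)

lemma lift_coord:
  assumes "is_lift a b (seg a b j) c"
  shows "continuous_on {0..1} (\<lambda>s. coord (c s))"
    and "s \<in> {0..1} \<Longrightarrow> trinomial_root (a + b) a (seg a b j s) (coord (c s))"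
    and "s \<in> {0..1} \<Longrightarrow> c s = par (coord (c s))"
proof -
  have c: "continuous_on {0..1} c" "c ` {0..1} \<subseteq> LG_X a b" "\<And>s. s \<in> {0..1} \<Longrightarrow> LG_W (c s) = seg a b j s"
    using assms by (auto simp: is_lift_def path_def path_image_def)
  show "continuous_on {0..1} (\<lambda>s. coord (c s))"
    by (rule continuous_on_compose2[OF continuous_on_coord c(1,2)])
  assume s: "s \<in> {0..1}"
  have X: "c s \<in> LG_X a b" using c(2) s by blast
  show "c s = par (coord (c s))" by (rule par_coord(1)[OF X, symmetric])
  have "LG_W (par (coord (c s))) = seg a b j s"
    using c(3)[OF s] by (simp only: par_coord(1)[OF X])
  then show "trinomial_root (a + b) a (seg a b j s) (coord (c s))"
    by (simp only: LG_W_par_iff[OF par_coord(2)[OF X]])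
qed

lemma lift_par:
  assumes "continuous_on {0..1} x" "\<And>s. s \<in> {0..1} \<Longrightarrow> trinomial_root (a + b) a (seg a b j s) (x s)"
  shows "is_lift a b (seg a b j) (\<lambda>s. par (x s))"
proof -
  have nz: "x s \<noteq> 0" if "s \<in> {0..1}" for s
    using assms(2)[OF that] by (rule trinomial_root_nonzero)
  show ?thesis
    unfolding is_lift_def path_def path_image_def
    using continuous_on_par[OF assms(1) nz] nz par_in_LG_X LG_W_par_iff assms(2) by blast
qed

text \<open>The second hypothesis says that \<open>t\<close> is a multiple root. Eliminating \<open>c
t\<^sup>a\<close> between the two equations determines \<open>t\<^sup>a\<^sup>+\<^sup>b\<close>.\<close>

lemma critical_root:
  assumes "trinomial_root (a + b) a c t" "of_nat (a + b) * t ^ (a + b) = c * of_nat a * t ^ a"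
  shows "t ^ (a + b) = of_nat a / of_nat b" "c * t ^ a = of_nat (a + b) / of_nat b"
proof -
  have "of_nat (a + b) * t ^ (a + b) = of_nat a * (c * t ^ a)" using assms(2) by (simp only: mult_ac)
  also have "\<dots> = of_nat a * (t ^ (a + b) + 1)" using assms(1) by (simp only: trinomial_root_def)
  finally have "of_nat b * t ^ (a + b) = of_nat a"
    by (simp only: of_nat_add distrib_right distrib_left mult_1_right) (simp only: add_left_cancel)
  then show 1: "t ^ (a + b) = of_nat a / of_nat b"
    using pos by (simp only: eq_divide_eq mult.commute) simp
  have "c * t ^ a = of_nat a / of_nat b + 1"
    using assms(1) unfolding trinomial_root_def 1 by simp
  also have "\<dots> = of_nat (a + b) / of_nat b" using pos by (simp add: add_divide_distrib)
  finally show "c * t ^ a = of_nat (a + b) / of_nat b" .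
qed

lemma norm_crit_value: "norm (crit_value a b j) = height 0"
  using height_0(2) by (simp add: crit_value_eq norm_mult)

text \<open>A multiple root forces \<open>\<bar>c\<bar>\<close> to be the modulus of the critical values, which the
segment reaches only at its end.\<close>

lemma seg_simple_root:
  assumes s: "s \<in> {0..<1}" and t: "trinomial_root (a + b) a (seg a b j s) t"
  shows "of_nat (a + b) * t ^ (a + b) \<noteq> seg a b j s * of_nat a * t ^ a"
proof
  assume "of_nat (a + b) * t ^ (a + b) = seg a b j s * of_nat a * t ^ a"
  note c = critical_root[OF t this]
  have "norm t ^ (a + b) = norm (of_nat a / of_nat b :: complex)"
    unfolding c(1)[symmetric] by (rule norm_power[symmetric])
  then have "norm t ^ (a + b) = radius 0 ^ (a + b)"
    unfolding radius_0_power by (simp add: norm_divide)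
  then have "norm t = radius 0"
    by (rule power_eq_imp_eq_base) (use radius_pos[of 0] pos in \<open>simp_all add: less_imp_le\<close>)
  have "norm (seg a b j s) * norm t ^ a = norm (of_nat (a + b) / of_nat b :: complex)"
    unfolding c(2)[symmetric] by (simp add: norm_mult norm_power)
  then have "(s * height 0) * radius 0 ^ a = real (a + b) / real b"
    using s by (simp add: seg_eq norm_mult norm_crit_value \<open>norm t = radius 0\<close> norm_divide del: of_nat_add)
  then have "s * (real (a + b) / real b) = real (a + b) / real b"
    unfolding height_0(1)[symmetric] by (simp only: mult.assoc)
  moreover have "real (a + b) / real b \<noteq> 0" using pos by simp
  ultimately have "s = 1" by (metis mult_cancel_right1 mult.commute)
  with s show False by simp
qed

text \<open>Each critical value has a single critical point: \<open>t\<^sup>a\<^sup>+\<^sup>b\<close> and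
\<open>t\<^sup>a\<close> are determined by the value, and together they determine \<open>t\<close> as \<open>a\<close>
and \<open>b\<close> are coprime.\<close>

lemma critical_root_unique:
  assumes "trinomial_root (a + b) a c t" "of_nat (a + b) * t ^ (a + b) = c * of_nat a * t ^ a"
    and "trinomial_root (a + b) a c u" "of_nat (a + b) * u ^ (a + b) = c * of_nat a * u ^ a"
  shows "t = u"
proof -
  note t = critical_root[OF assms(1,2)] and u = critical_root[OF assms(3,4)]
  have nz: "t \<noteq> 0" "u \<noteq> 0" using assms(1,3) trinomial_root_nonzero by auto
  have "c \<noteq> 0" using t(2) pos by (auto simp del: of_nat_add)
  moreover have "c * t ^ a = c * u ^ a" using t(2) u(2) by simp
  ultimately have a: "t ^ a = u ^ a" by simp
  have "t ^ a * t ^ b = u ^ a * u ^ b" using t(1) u(1) by (simp only: power_add[symmetric])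
  then have "t ^ b = u ^ b" using a nz by simp
  with a have "par t = par u" by (simp add: par_def power_inverse)
  then show ?thesis using coord_par nz by metis
qed

text \<open>As \<open>b\<close> is congruent to \<open>-a\<close> modulo \<open>a + b\<close>, the difference of the
Bezout coefficients is an inverse of \<open>a\<close> modulo \<open>a + b\<close>. Multiplying \<open>t\<close> by the
resulting root of unity multiplies \<open>W\<close> by \<open>exp (- 2 \<pi> i j / (a + b))\<close>, which carries the
segment of index 0 to the segment of index \<open>j\<close>.\<close>

definition rot :: "nat \<Rightarrow> complex" where
  "rot j = cis (2 * pi * real j * of_int (bez_a - bez_b) / real (a + b))"

lemma rot_powers:
  "rot j ^ a = cis (2 * pi * real j / real (a + b))" 
  "rot j ^ b = cis (- (2 * pi * real j / real (a + b)))"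
proof -
  have per: "cis (x + 2 * pi * real_of_int k) = cis x" for x k
    by (simp add: cis_mult[symmetric] cis_multiple_2pi)
  have l: "real (a + b) \<noteq> 0" using pos by simp
  have d1: "p * (1 - u * L) / L = p / L - p * u"
    and d2: "p * (- 1 + u * L) / L = - (p / L) + p * u" if "L \<noteq> 0" for p u L :: real
    using that by (simp_all add: right_diff_distrib distrib_left diff_divide_distrib add_divide_distrib)
  have 1: "real_of_int bez_a * real a + real_of_int bez_b * real b = 1"
    using arg_cong[OF bezout, of real_of_int] by simp
  have "real a * (2 * pi * real j * of_int (bez_a - bez_b) / real (a + b)) =
      2 * pi * real j / real (a + b) + 2 * pi * real_of_int (- (int j * bez_b))"
  proof -
    have "real a * of_int (bez_a - bez_b) = 1 - of_int bez_b * real (a + b)"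
      using 1 by (simp add: algebra_simps)
    then have "real a * (2 * pi * real j * of_int (bez_a - bez_b) / real (a + b)) =
      2 * pi * real j * (1 - of_int bez_b * real (a + b)) / real (a + b)"
      by (metis (no_types) mult.left_commute times_divide_eq_right)
    also have "\<dots> = 2 * pi * real j / real (a + b) - 2 * pi * real j * of_int bez_b"
      by (rule d1[OF l])
    finally show ?thesis by simp
  qed
  then show "rot j ^ a = cis (2 * pi * real j / real (a + b))"
    unfolding rot_def Complex.DeMoivre by (simp only: per)
  have "real b * (2 * pi * real j * of_int (bez_a - bez_b) / real (a + b)) =
      - (2 * pi * real j / real (a + b)) + 2 * pi * real_of_int (int j * bez_a)"
  proof -
    have "real b * of_int (bez_a - bez_b) = - 1 + of_int bez_a * real (a + b)"
      using 1 by (simp add: algebra_simps)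
    then have "real b * (2 * pi * real j * of_int (bez_a - bez_b) / real (a + b)) =
      2 * pi * real j * (- 1 + of_int bez_a * real (a + b)) / real (a + b)"
      by (metis (no_types) mult.left_commute times_divide_eq_right)
    also have "\<dots> = - (2 * pi * real j / real (a + b)) + 2 * pi * real j * of_int bez_a"
      by (rule d2[OF l])
    finally show ?thesis by simp
  qed
  then show "rot j ^ b = cis (- (2 * pi * real j / real (a + b)))"
    unfolding rot_def Complex.DeMoivre by (simp only: per)
qed

lemma rot_nonzero [simp]: "rot j \<noteq> 0"
  by (simp add: rot_def)

lemma arm_root:
  assumes "\<bar>x\<bar> \<le> half_width"
  shows "trinomial_root (a + b) a (of_real (height x) * cis (- (2 * pi * real j / real (a + b)))) (rot j * arm x)"
proof (subst LG_W_par_iff[symmetric])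
  let ?e = "cis (- (2 * pi * real j / real (a + b)))"
  have "inverse (rot j) ^ a = ?e" 
    unfolding power_inverse rot_powers by simp
  then have "LG_W (par (rot j * arm x)) = ?e * (arm x ^ b + inverse (arm x) ^ a)"
    by (simp add: LG_W_def par_def power_mult_distrib rot_powers distrib_left)
  then show "LG_W (par (rot j * arm x)) = of_real (height x) * ?e"
    unfolding arm_power_sum[OF assms] by simp
qed simp

text \<open>The lift of the segment of index \<open>j\<close> along the upper (\<open>\<sigma> = 1\<close>) or lower
(\<open>\<sigma> = -1\<close>) arm.\<close>

definition branch :: "nat \<Rightarrow> real \<Rightarrow> real \<Rightarrow> complex" where
  "branch j \<sigma> s = rot j * arm (\<sigma> * angle_at s)"

lemma branch:
  assumes \<sigma>: "\<sigma> \<in> {1, - 1}"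
  shows "continuous_on {0..1} (branch j \<sigma>)"
    and "s \<in> {0..1} \<Longrightarrow> trinomial_root (a + b) a (seg a b j s) (branch j \<sigma> s)"
proof -
  have sub: "(\<lambda>s. \<sigma> * angle_at s) ` {0..1} \<subseteq> {-half_width..half_width}"
  proof
    fix x assume "x \<in> (\<lambda>s. \<sigma> * angle_at s) ` {0..1}"
    then obtain s where s: "s \<in> {0..1}" "x = \<sigma> * angle_at s" by blast
    then have "0 \<le> angle_at s \<and> angle_at s \<le> half_width" using angle_at(1) by fastforce
    then show "x \<in> {-half_width..half_width}" using \<sigma> s by auto
  qed
  show "continuous_on {0..1} (branch j \<sigma>)"
    unfolding branch_def[abs_def]
    by (intro continuous_intros continuous_on_compose2[OF continuous_on_arm[OF order_refl] _ sub] continuous_on_angle_at)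
  assume s: "s \<in> {0..1}"
  have "\<bar>\<sigma> * angle_at s\<bar> \<le> half_width" "height (\<sigma> * angle_at s) = s * height 0"
    using angle_at[OF s] \<sigma> by auto
  with arm_root[of "\<sigma> * angle_at s" j]
  show "trinomial_root (a + b) a (seg a b j s) (branch j \<sigma> s)"
    by (simp add: branch_def seg_eq crit_value_eq mult.assoc)
qed

lemma branch_ends: "branch j \<sigma> 0 = rot j * arm (\<sigma> * half_width)" "branch j \<sigma> 1 = rot j * arm 0"
  by (simp_all add: branch_def angle_at_ends)

lemma branch_distinct:
  assumes "s \<in> {0..<1}"
  shows "branch j 1 s \<noteq> branch j (- 1) s"
proof
  assume "branch j 1 s = branch j (- 1) s"
  then have "arm (angle_at s) = cnj (arm (angle_at s))" by (simp add: branch_def arm_minus)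
  then have "Im (arm (angle_at s)) = 0" by (simp add: complex_eq_iff)
  then have "sin (angle_at s) = 0" using radius_pos[of "angle_at s"] by (simp add: arm_def)
  moreover have "0 < angle_at s" "angle_at s < pi"
    using angle_at_pos[OF assms] angle_at(1)[of s] assms half_width_pos(2) by auto
  ultimately show False using sin_gt_zero by fastforce
qed

lemma continuous_on_seg: "continuous_on A (seg a b j)"
  unfolding seg_eq[abs_def] by (intro continuous_intros)

lemma branch_unique:
  assumes x: "continuous_on {0..1} x" "\<And>s. s \<in> {0..1} \<Longrightarrow> trinomial_root (a + b) a (seg a b j s) (x s)"
    and y: "continuous_on {0..1} y" "\<And>s. s \<in> {0..1} \<Longrightarrow> trinomial_root (a + b) a (seg a b j s) (y s)"
    and eq: "s0 \<in> {0..<1}" "x s0 = y s0" and s: "s \<in> {0..1}"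
  shows "x s = y s"
proof (rule trinomial_lifts_agree[OF x(1) y(1) continuous_on_seg _ _ eq s])
  show "trinomial_root (a + b) a (seg a b j s) (x s) \<and> trinomial_root (a + b) a (seg a b j s) (y s)"
    if "s \<in> {0..1}" for s
    using x(2)[OF that] y(2)[OF that] by blast
  show "of_nat (a + b) * x s ^ (a + b) \<noteq> seg a b j s * of_nat a * x s ^ a" if "s \<in> {0..<1}" for s
    using that by (intro seg_simple_root x(2)) auto
qed

text \<open>The lift \<open>x\<close> ends at a multiple root because it merges with \<open>y\<close>, hence at the
same point as the two arms. If it were neither of them, three distinct roots would converge to this point, and the
first two derivatives of the trinomial would both vanish there. That is impossible: it would imply \<open>a + b - 1 =
a - 1\<close>.\<close>

lemma merging_branches:
  assumes x: "continuous_on {0..1} x" "\<And>s. s \<in> {0..1} \<Longrightarrow> trinomial_root (a + b) a (seg a b j s) (x s)"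
    and y: "continuous_on {0..1} y" "\<And>s. s \<in> {0..1} \<Longrightarrow> trinomial_root (a + b) a (seg a b j s) (y s)"
    and start: "x 0 \<noteq> y 0" and finish: "x 1 = y 1"
  shows "x 0 = branch j 1 0 \<or> x 0 = branch j (- 1) 0"
proof (rule ccontr)
  assume "\<not> (x 0 = branch j 1 0 \<or> x 0 = branch j (- 1) 0)"
  then have xp: "x 0 \<noteq> branch j 1 0" and xm: "x 0 \<noteq> branch j (- 1) 0" by auto
  let ?F = "at (1::real) within {0..<1}" and ?R = "\<lambda>s t. trinomial_root (a + b) a (seg a b j s) t"
  have F: "?F \<noteq> bot" by (simp add: at_within_eq_bot_iff)
  have lim: "(f \<longlongrightarrow> f 1) ?F" if "continuous_on {0..1} f" for f :: "real \<Rightarrow> complex"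
  proof -
    have "(f \<longlongrightarrow> f 1) (at 1 within {0..1})" using that by (simp add: continuous_on_def)
    then show ?thesis by (rule tendsto_within_subset) auto
  qed
  have ev: "\<forall>\<^sub>F s in ?F. P s" if "\<And>s. s \<in> {0..<1} \<Longrightarrow> P s" for P
    unfolding eventually_at_filter by (rule always_eventually) (use that in blast)
  have b1: "continuous_on {0..1} (branch j 1)" "\<And>s. s \<in> {0..1} \<Longrightarrow> ?R s (branch j 1 s)"
    and b2: "continuous_on {0..1} (branch j (- 1))" "\<And>s. s \<in> {0..1} \<Longrightarrow> ?R s (branch j (- 1) s)"
    using branch by simp_all
  have apart: "f s \<noteq> g s"
    if "continuous_on {0..1} f" "\<And>s. s \<in> {0..1} \<Longrightarrow> ?R s (f s)"
      "continuous_on {0..1} g" "\<And>s. s \<in> {0..1} \<Longrightarrow> ?R s (g s)" "f 0 \<noteq> g 0" "s \<in> {0..<1}" for f g s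
    using branch_unique[OF that(1-4) that(6), of 0] that(5) by auto
  have crit: "of_nat (a + b) * f 1 ^ (a + b) = seg a b j 1 * of_nat a * f 1 ^ a"
    if f: "continuous_on {0..1} f" "\<And>s. s \<in> {0..1} \<Longrightarrow> ?R s (f s)"
      and g: "continuous_on {0..1} g" "\<And>s. s \<in> {0..1} \<Longrightarrow> ?R s (g s)" and "f 0 \<noteq> g 0" "f 1 = g 1" for f g
  proof (rule ccontr)
    assume "\<not> ?thesis"
    then have "\<forall>\<^sub>F s in ?F. f s = g s"
      by (intro trinomial_simple_root[of _ "f 1" _ _ "seg a b j" "seg a b j 1" "a + b" a] lim f(1) continuous_on_seg)
         (use lim[OF g(1)] that(6) f(2) g(2) in \<open>auto intro!: ev\<close>)
    moreover have "\<forall>\<^sub>F s in ?F. f s \<noteq> g s"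
      by (rule ev) (rule apart[OF f g that(5)])
    ultimately have "\<forall>\<^sub>F s in ?F. False" by eventually_elim simp
    then show False using F by simp
  qed
  have x1: "x 1 = branch j 1 1"
  proof (rule critical_root_unique)
    show "?R 1 (x 1)" "?R 1 (branch j 1 1)" using x(2) b1(2) by auto
    show "of_nat (a + b) * x 1 ^ (a + b) = seg a b j 1 * of_nat a * x 1 ^ a"
      by (rule crit[OF x y start finish])
    show "of_nat (a + b) * branch j 1 1 ^ (a + b) = seg a b j 1 * of_nat a * branch j 1 1 ^ a"
      by (rule crit[OF b1 b2]) (use branch_distinct[of 0 j] branch_ends in auto)
  qed
  have "of_nat (a + b) * (of_nat (a + b) - 1) * x 1 ^ (a + b) =
      seg a b j 1 * (of_nat a * (of_nat a - 1)) * x 1 ^ a"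
  proof (rule trinomial_double_root[OF lim[OF x(1)] _ _ lim[OF continuous_on_seg] F])
    show "(branch j 1 \<longlongrightarrow> x 1) ?F" "(branch j (- 1) \<longlongrightarrow> x 1) ?F"
      using lim[OF b1(1)] lim[OF b2(1)] x1 by (simp_all add: branch_ends)
    show "\<forall>\<^sub>F s in ?F. ?R s (x s) \<and> ?R s (branch j 1 s) \<and> ?R s (branch j (- 1) s) \<and>
        x s \<noteq> branch j 1 s \<and> x s \<noteq> branch j (- 1) s \<and> branch j 1 s \<noteq> branch j (- 1) s"
    proof (rule ev)
      fix s :: real assume s: "s \<in> {0..<1}"
      then have s': "s \<in> {0..1}" by simp
      show "?R s (x s) \<and> ?R s (branch j 1 s) \<and> ?R s (branch j (- 1) s) \<and>
        x s \<noteq> branch j 1 s \<and> x s \<noteq> branch j (- 1) s \<and> branch j 1 s \<noteq> branch j (- 1) s"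
        using x(2)[OF s'] b1(2)[OF s'] b2(2)[OF s'] apart[OF x b1 xp s] apart[OF x b2 xm s]
          branch_distinct[OF s] by blast
    qed
  qed
  moreover have "of_nat (a + b) * x 1 ^ (a + b) = seg a b j 1 * of_nat a * x 1 ^ a"
    by (rule crit[OF x y start finish])
  moreover have "(L - 1) * (L * p) = (A - 1) * (L * p)"
    if "L * (L - 1) * p = c * (A * (A - 1)) * q" "L * p = c * A * q" for L A p q c :: complex
  proof -
    have "(L - 1) * (L * p) = L * (L - 1) * p" by (simp only: mult_ac)
    also have "\<dots> = (A - 1) * (c * A * q)" unfolding that(1) by (simp only: mult_ac)
    finally show ?thesis unfolding that(2) .
  qed
  ultimately have "(of_nat (a + b) - 1) * (of_nat (a + b) * x 1 ^ (a + b)) =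
      (of_nat a - 1) * (of_nat (a + b) * x 1 ^ (a + b))"
    by blast
  moreover have "of_nat (a + b) * x 1 ^ (a + b) \<noteq> (0 :: complex)"
    using trinomial_root_nonzero[OF x(2)[of 1]] pos by (simp del: of_nat_add)
  ultimately have "(of_nat (a + b) - 1 :: complex) = of_nat a - 1" by (simp only: mult_cancel_right simp_thms)
  then show False using pos by simp
qed

end

section \<open>Vanishing cycles and thimbles\<close>

text \<open>The factor \<open>R\<close> may be negative, because arguments are only compared modulo
\<open>\<pi>\<close>.\<close>

lemma lifts_argI:
  assumes "z = of_real R * cis r" "R \<noteq> 0"
  shows "lifts_arg r z"
proof -
  have z: "z \<noteq> 0" using assms by simp
  have "of_real (norm z) * cis (Arg z) = of_real R * cis r"
    using assms(1) cis_Arg[OF z] z by (simp add: sgn_eq)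
  then have "of_real (norm z) * cis (Arg z) * cis (- r) = of_real R * (cis r * cis (- r))"
    by (simp only: mult.assoc)
  then have "of_real (norm z) * cis (Arg z - r) = complex_of_real R"
    by (simp add: cis_mult mult.assoc)
  then have "norm z * sin (Arg z - r) = 0"
    by (auto dest: arg_cong[where f = Im])
  then have "sin (r - Arg z) = 0" using z sin_minus[of "Arg z - r"] by simp
  then obtain k :: int where "r - Arg z = of_int k * pi"
    unfolding sin_zero_iff_int2 by blast
  then show ?thesis unfolding lifts_arg_def by (intro exI[of _ k]) simp
qed

lemma Arg_of_real_cis: "0 < r \<Longrightarrow> - pi < x \<Longrightarrow> x \<le> pi \<Longrightarrow> Arg (of_real r * cis x) = x"
  by (rule Arg_unique) (simp_all add: cis_conv_exp)

lemma Arg_cot: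
  assumes "0 < x" "x < pi"
  shows "Arg (Complex (cot x) 1) = x"
proof -
  have s: "sin x > 0" using assms by (rule sin_gt_zero)
  then have eq: "Complex (cot x) 1 = of_real (1 / sin x) * cis x"
    by (simp add: complex_eq_iff cot_def)
  show ?thesis
    unfolding eq by (rule Arg_of_real_cis) (use s assms in simp_all)
qed

context coprime_pair
begin

text \<open>The image of the vector \<open>t z\<close> under the differential of \<open>par\<close>, so that
\<open>z\<close> is the value of \<open>dt / t\<close>.\<close>

definition tangent :: "complex \<Rightarrow> complex \<Rightarrow> point" where
  "tangent t z = (of_nat b * t ^ b * z, - (of_nat a * inverse t ^ a * z))"

text \<open>In the coordinate \<open>t\<close>, \<open>\<Omega>\<close> is the logarithmic form \<open>dt /
t\<close>.\<close>

lemma Omega_tangent: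
  assumes "t \<noteq> 0"
  shows "Omega a b (par t) (tangent t z) = z"
  unfolding Omega_def
proof (rule the_equality)
  let ?x = "t ^ b" and ?y = "inverse t ^ a"
  have nz: "?x \<noteq> 0" "?y \<noteq> 0" using assms by simp_all
  have gen: "(B * x * z * w2 - - (A * y * z) * w1) / (x * y) = z * (A / x * w1 + B / y * w2)"
    if "x \<noteq> 0" "y \<noteq> 0" for x y A B w1 w2 :: complex
    using that by (simp add: field_simps)
  show eq: "\<forall>w. z * eta a b (par t) w =
      (fst (tangent t z) * snd w - snd (tangent t z) * fst w) / (fst (par t) * snd (par t))"
    unfolding eta_def par_def tangent_def fst_conv snd_conv by (simp only: gen[OF nz] simp_thms)
  fix z' assume z': "\<forall>w. z' * eta a b (par t) w =
      (fst (tangent t z) * snd w - snd (tangent t z) * fst w) / (fst (par t) * snd (par t))"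
  have "z' * eta a b (par t) (1, 0) = z * eta a b (par t) (1, 0)"
    using z' eq by simp
  moreover have "eta a b (par t) (1, 0) \<noteq> 0"
    using nz pos by (simp add: eta_def par_def)
  ultimately show "z' = z" by simp
qed

lemma tangent_X_eq:
  assumes "t \<noteq> 0"
  shows "tangent_X a b (par t) = range (tangent t)"
proof (intro equalityI subsetI)
  fix v assume v: "v \<in> tangent_X a b (par t)"
  let ?x = "t ^ b" and ?y = "inverse t ^ a"
  have nz: "?x \<noteq> 0" "?y \<noteq> 0" using assms by simp_all
  have "of_nat a / ?x * fst v + of_nat b / ?y * snd v = 0"
    using v by (simp only: tangent_X_def mem_Collect_eq eta_def par_def fst_conv snd_conv)
  then have e: "of_nat b * snd v / ?y = - (of_nat a * fst v / ?x)"
    by (simp add: add_eq_0_iff)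
  have gen: "v2 = - (A * y * (v1 / (B * x)))"
    if "B * v2 / y = - (A * v1 / x)" "x \<noteq> 0" "y \<noteq> 0" "B \<noteq> 0" for x y A B v1 v2 :: complex
  proof -
    have "v2 = (B * v2 / y) * y / B" using that(2-4) by simp
    also have "\<dots> = - (A * y * (v1 / (B * x)))" unfolding that(1) using that(2-4) by (simp add: field_simps)
    finally show ?thesis .
  qed
  have "v = tangent t (fst v / (of_nat b * ?x))"
    using nz pos gen[OF e nz] by (simp add: tangent_def prod_eq_iff)
  then show "v \<in> range (tangent t)" by blast
next
  fix v assume "v \<in> range (tangent t)"
  then obtain z where v: "v = tangent t z" by blast
  have nz: "t ^ b \<noteq> 0" "inverse t ^ a \<noteq> 0" using assms by simp_all
  have gen: "A / x * (B * x * z) + B / y * - (A * y * z) = 0" if "x \<noteq> 0" "y \<noteq> 0" for x y A B :: complex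
    using that by simp
  show "v \<in> tangent_X a b (par t)"
    unfolding v tangent_X_def mem_Collect_eq eta_def par_def tangent_def fst_conv snd_conv
    by (rule gen[OF nz])
qed

text \<open>On the reference fiber \<open>t\<^sup>-\<^sup>a = -t\<^sup>b\<close>, so \<open>dW = (b t\<^sup>b - a
t\<^sup>-\<^sup>a) dt / t\<close> reduces to \<open>(a + b) t\<^sup>b dt / t\<close>.\<close>

lemma Theta_fiber:
  assumes t: "t \<noteq> 0" and W: "LG_W (par t) = 0"
  shows "Theta a b (par t) = 1 / (of_nat (a + b) * t ^ b)"
proof -
  have y: "inverse t ^ a = - (t ^ b)"
    using W by (simp add: LG_W_def par_def add_eq_0_iff)
  have LW: "LG_W (tangent t z) = of_nat (a + b) * t ^ b * z" for z
    unfolding LG_W_def tangent_def fst_conv snd_conv y by (simp add: algebra_simps)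
  have nz: "of_nat (a + b) * t ^ b \<noteq> 0" using t pos by (simp del: of_nat_add)
  show ?thesis
    unfolding Theta_def tangent_X_eq[OF t]
  proof (rule the_equality)
    show "\<forall>v\<in>range (tangent t). Omega a b (par t) v = 1 / (of_nat (a + b) * t ^ b) * LG_W v"
      using nz by (auto simp: Omega_tangent[OF t] LW simp del: of_nat_add)
    fix z assume "\<forall>v\<in>range (tangent t). Omega a b (par t) v = z * LG_W v"
    then have "Omega a b (par t) (tangent t 1) = z * LG_W (tangent t 1)" by blast
    then show "z = 1 / (of_nat (a + b) * t ^ b)"
      using nz by (simp add: Omega_tangent[OF t] LW eq_divide_eq del: of_nat_add)
  qed
qed

text \<open>With \<open>n\<close> ranging over the integers of the parity of \<open>b\<close>, these are the points of
the reference fiber; \<open>n\<close> matters only modulo \<open>2 (a + b)\<close>.\<close>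

definition node :: "int \<Rightarrow> point" where
  "node n = (cis (real_of_int n * half_width), - cis (real_of_int n * half_width))"

lemma node_eq_iff: "node m = node n \<longleftrightarrow> 2 * int (a + b) dvd m - n"
proof -
  have l: "pi = real (a + b) * half_width" by (rule half_width_mult(1)[symmetric])
  have "node m = node n \<longleftrightarrow> cis (real_of_int m * half_width) = cis (real_of_int n * half_width)"
    by (simp add: node_def)
  also have "\<dots> \<longleftrightarrow> (\<exists>k::int. real_of_int m * half_width = real_of_int n * half_width + 2 * pi * of_int k)"
    using sin_cos_eq_iff[of "real_of_int m * half_width" "real_of_int n * half_width"]
    by (auto simp: complex_eq_iff)
  also have "\<dots> \<longleftrightarrow> (\<exists>k::int. m = n + 2 * int (a + b) * k)"
  proof (rule arg_cong[where f = Ex], rule ext)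
    fix k :: int
    have "real_of_int m * half_width = real_of_int n * half_width + 2 * pi * of_int k \<longleftrightarrow>
        real_of_int m * half_width = real_of_int (n + 2 * int (a + b) * k) * half_width"
      unfolding l by (simp add: algebra_simps)
    also have "\<dots> \<longleftrightarrow> m = n + 2 * int (a + b) * k"
      using half_width_pos(1) by (simp only: mult_cancel_right of_int_eq_iff) simp
    finally show "(real_of_int m * half_width = real_of_int n * half_width + 2 * pi * of_int k) = (m = n + 2 * int (a + b) * k)" .
  qed
  also have "\<dots> \<longleftrightarrow> 2 * int (a + b) dvd m - n"
    unfolding dvd_def by (auto simp: algebra_simps intro: exI)
  finally show ?thesis .
qed

lemma tip:
  assumes "\<sigma> \<in> {1, -1::int}"
  shows "(rot j * arm (of_int \<sigma> * half_width)) ^ b = cis (real_of_int (\<sigma> * int b - 2 * int j) * half_width)"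
    and "LG_W (par (rot j * arm (of_int \<sigma> * half_width))) = 0"
    and "par (rot j * arm (of_int \<sigma> * half_width)) = node (\<sigma> * int b - 2 * int j)"
proof -
  have arm: "arm (of_int \<sigma> * half_width) = cis (of_int \<sigma> * half_width)"
    using assms arm_half_width arm_minus[of half_width] by (auto simp: cis_cnj)
  have "2 * pi * real j / real (a + b) = 2 * real j * half_width" by (simp add: half_width_def)
  then show 1: "(rot j * arm (of_int \<sigma> * half_width)) ^ b = cis (real_of_int (\<sigma> * int b - 2 * int j) * half_width)"
    unfolding power_mult_distrib rot_powers arm Complex.DeMoivre cis_mult
    by (simp add: algebra_simps)
  show 2: "LG_W (par (rot j * arm (of_int \<sigma> * half_width))) = 0"
    using LG_W_par_iff[of "rot j * arm (of_int \<sigma> * half_width)" 0] arm_root[of "of_int \<sigma> * half_width" j] assms half_width_pos(1) height_half_width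
    by auto
  show "par (rot j * arm (of_int \<sigma> * half_width)) = node (\<sigma> * int b - 2 * int j)"
    using 2 unfolding node_def 1[symmetric] par_def LG_W_def by (simp add: add_eq_0_iff)
qed

lemma branch_lift:
  assumes "\<sigma> \<in> {1, - 1}"
  shows "is_lift a b (seg a b j) (\<lambda>s. par (branch j \<sigma> s))"
  by (rule lift_par) (use branch[OF assms] in auto)

text \<open>Both arms are lifts that merge at the critical point, and by \<open>merging_branches\<close> every lift
that takes part in a merger is one of them.\<close>

lemma vanishing_cycle_eq:
  "vanishing_cycle a b (seg a b j) = {node (int b - 2 * int j), node (- int b - 2 * int j)}"
proof -
  have start: "par (branch j 1 0) = node (int b - 2 * int j)" "par (branch j (- 1) 0) = node (- int b - 2 * int j)"
    using tip(3)[of 1 j] tip(3)[of "-1" j] by (simp_all add: branch_ends)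
  have fib: "par (branch j \<sigma> 0) \<in> fiber0 a b" if "\<sigma> \<in> {1, - 1}" for \<sigma>
    using tip(2)[of 1 j] tip(2)[of "-1" j] that par_in_LG_X
    by (auto simp: fiber0_def branch_ends)
  have ne: "par (branch j 1 0) \<noteq> par (branch j (- 1) 0)"
    using branch_distinct[of 0 j] coord_par[of "branch j 1 0"] coord_par[of "branch j (- 1) 0"]
    by (auto simp: branch_def)
  have fin: "par (branch j 1 1) = par (branch j (- 1) 1)" by (simp add: branch_ends)
  show ?thesis
  proof (intro equalityI subsetI)
    fix p assume "p \<in> vanishing_cycle a b (seg a b j)"
    then obtain q c d where cd: "q \<noteq> p" "is_lift a b (seg a b j) c" "is_lift a b (seg a b j) d"
      "c 0 = p" "d 0 = q" "c 1 = d 1"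
      unfolding vanishing_cycle_def pathstart_def pathfinish_def by blast
    have "coord (c 0) = branch j 1 0 \<or> coord (c 0) = branch j (- 1) 0"
    proof (rule merging_branches[OF lift_coord(1,2)[OF cd(2)] lift_coord(1,2)[OF cd(3)]])
      show "coord (c 0) \<noteq> coord (d 0)"
        using cd(1,4,5) lift_coord(3)[OF cd(2), of 0] lift_coord(3)[OF cd(3), of 0] by auto
      show "coord (c 1) = coord (d 1)" using cd(6) by simp
    qed
    moreover have "p = par (coord (c 0))" using cd(4) lift_coord(3)[OF cd(2), of 0] by simp
    ultimately show "p \<in> {node (int b - 2 * int j), node (- int b - 2 * int j)}"
      using start by auto
  next
    have "par (branch j \<sigma> 0) \<in> vanishing_cycle a b (seg a b j)" if s: "\<sigma> \<in> {1, - 1}" for \<sigma>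
    proof -
      have s': "- \<sigma> \<in> {1, - 1}" using s by auto
      have "par (branch j (- \<sigma>) 0) \<noteq> par (branch j \<sigma> 0)" "par (branch j \<sigma> 1) = par (branch j (- \<sigma>) 1)"
        using s ne fin by auto
      then show ?thesis
        unfolding vanishing_cycle_def pathstart_def pathfinish_def
        using fib[OF s] fib[OF s'] branch_lift[OF s, of j] branch_lift[OF s', of j] by blast
    qed
    from this[of 1] this[of "- 1"]
    show "p \<in> {node (int b - 2 * int j), node (- int b - 2 * int j)} \<Longrightarrow> p \<in> vanishing_cycle a b (seg a b j)" for p
      using start by auto
  qed
qed

text \<open>A lift is determined by its starting point, so only the two arms contribute.\<close>

lemma thimble_eq: "thimble a b (seg a b j) = (\<lambda>x. par (rot j * arm x)) ` {-half_width..half_width}"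
proof (intro equalityI subsetI)
  fix p assume "p \<in> thimble a b (seg a b j)"
  then obtain c s where c: "is_lift a b (seg a b j) c" "c 0 \<in> vanishing_cycle a b (seg a b j)"
    and s: "s \<in> {0..1}" "p = c s"
    unfolding thimble_def path_image_def pathstart_def by blast
  have "\<exists>\<sigma>\<in>{1, - 1}. c 0 = par (branch j \<sigma> 0)"
    using c(2) tip(3)[of 1 j] tip(3)[of "-1" j] unfolding vanishing_cycle_eq by (auto simp: branch_ends)
  then obtain \<sigma> where \<sigma>: "\<sigma> \<in> {1, - 1}" "c 0 = par (branch j \<sigma> 0)" by blast
  have "coord (c s) = branch j \<sigma> s"
  proof (rule branch_unique[OF lift_coord(1,2)[OF c(1)] branch[OF \<sigma>(1)]])
    show "coord (c 0) = branch j \<sigma> 0" unfolding \<sigma>(2) by (rule coord_par) (simp add: branch_def)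
  qed (use s in auto)
  then have "p = par (rot j * arm (\<sigma> * angle_at s))"
    using lift_coord(3)[OF c(1) s(1)] s(2) by (simp add: branch_def)
  moreover have "\<sigma> * angle_at s \<in> {-half_width..half_width}" using angle_at(1)[OF s(1)] \<sigma>(1) half_width_pos(1) by auto
  ultimately show "p \<in> (\<lambda>x. par (rot j * arm x)) ` {-half_width..half_width}" by blast
next
  fix p assume "p \<in> (\<lambda>x. par (rot j * arm x)) ` {-half_width..half_width}"
  then obtain x where x: "x \<in> {-half_width..half_width}" "p = par (rot j * arm x)" by blast
  have "\<exists>\<sigma>\<in>{1, - 1}. x = \<sigma> * \<bar>x\<bar>" by (cases "x \<ge> 0") auto
  then obtain \<sigma> where \<sigma>: "\<sigma> \<in> {1, - 1}" "x = \<sigma> * \<bar>x\<bar>" by blast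
  have "\<bar>x\<bar> \<in> angle_at ` {0..1}" unfolding angle_at_image using x by (auto simp: abs_le_iff)
  then obtain s where s: "s \<in> {0..1}" "\<bar>x\<bar> = angle_at s" by blast
  then have p: "p = par (branch j \<sigma> s)" using x \<sigma>(2) by (simp add: branch_def)
  have "par (branch j \<sigma> 0) \<in> vanishing_cycle a b (seg a b j)"
    using \<sigma>(1) tip(3)[of 1 j] tip(3)[of "-1" j] unfolding vanishing_cycle_eq by (auto simp: branch_ends)
  with branch_lift[OF \<sigma>(1), of j] s(1) p show "p \<in> thimble a b (seg a b j)"
    unfolding thimble_def path_image_def pathstart_def by blast
qed

end

section \<open>Gradings\<close>

context coprime_pair
begin

text \<open>The inverse of \<open>x \<mapsto> par (rot j * arm x)\<close> on the thimble.\<close>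

definition angle :: "nat \<Rightarrow> point \<Rightarrow> real" where
  "angle j p = Arg (coord p / rot j)"

text \<open>The argument of \<open>\<Omega>\<close> on the tangent vector of the arm. It is taken of a number with
imaginary part 1, hence continuous.\<close>

definition phase :: "nat \<Rightarrow> point \<Rightarrow> real" where
  "phase j p = Arg (Complex (log_slope (angle j p)) 1)"

text \<open>The shift is the argument of \<open>dW\<close> along the segment, up to sign; it turns the phase of the
thimble into an argument of \<open>\<Theta>\<close>.\<close>

definition grade :: "nat \<Rightarrow> point \<Rightarrow> real" where
  "grade j p = phase j p + 2 * real j * half_width"

lemma arm_not_nonpos:
  assumes "\<bar>x\<bar> \<le> half_width"
  shows "arm x \<notin> \<real>\<^sub>\<le>\<^sub>0"
proof
  assume n: "arm x \<in> \<real>\<^sub>\<le>\<^sub>0"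
  then have "radius x * cos x \<le> 0" "radius x * sin x = 0"
    by (auto simp: complex_nonpos_Reals_iff arm_def)
  then have c: "cos x \<le> 0" and s: "sin x = 0"
    using radius_pos[of x] by (auto simp: mult_le_0_iff)
  have "x = 0"
  proof (rule ccontr)
    assume "x \<noteq> 0"
    then have "sin \<bar>x\<bar> > 0" using assms half_width_pos(2) by (intro sin_gt_zero) auto
    then show False using s by (cases "x \<ge> 0") auto
  qed
  with c show False by simp
qed

lemma angle_par: "\<bar>x\<bar> \<le> half_width \<Longrightarrow> angle j (par (rot j * arm x)) = x"
proof -
  assume x: "\<bar>x\<bar> \<le> half_width"
  have "Arg (arm x) = x"
    unfolding arm_def by (rule Arg_of_real_cis) (use x half_width_pos(2) radius_pos[of x] in auto)
  then show ?thesis by (simp add: angle_def coord_par)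
qed

lemma phase_tips:
  "phase j (node (int b - 2 * int j)) = real a * half_width" 
  "phase j (node (- int b - 2 * int j)) = real b * half_width"
proof -
  have A: "0 < real a * half_width" "real a * half_width < pi" and B: "0 < real b * half_width" "real b * half_width < pi"
    using half_width_pos pos by auto
  have "angle j (node (int b - 2 * int j)) = half_width"
    using angle_par[of half_width j] tip(3)[of 1 j] half_width_pos(1) by simp
  then show "phase j (node (int b - 2 * int j)) = real a * half_width"
    by (simp add: phase_def log_slope_half_width Arg_cot[OF A])
  have "angle j (node (- int b - 2 * int j)) = - half_width"
    using angle_par[of "- half_width" j] tip(3)[of "-1" j] half_width_pos(1) by simp
  then have "phase j (node (- int b - 2 * int j)) = Arg (Complex (- cot (real a * half_width)) 1)"
    by (simp add: phase_def log_slope_half_width)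
  also have "- cot (real a * half_width) = cot (real b * half_width)"
    unfolding half_width_supplement by (simp add: cot_def)
  finally show "phase j (node (- int b - 2 * int j)) = real b * half_width"
    by (simp add: Arg_cot[OF B])
qed

lemma grade_tips:
  "grade j (node (int b - 2 * int j)) = (real a + 2 * real j) * half_width" 
  "grade j (node (- int b - 2 * int j)) = (real b + 2 * real j) * half_width"
  by (simp_all add: grade_def phase_tips distrib_right)

text \<open>At the two tips \<open>\<Theta>\<close> is a positive multiple of \<open>1 / t\<^sup>b\<close>. At one tip
its argument is the grading itself, at the other one the two differ by \<open>\<pi>\<close>, because \<open>a\<close>
and \<open>b\<close> times the half width add up to \<open>\<pi>\<close>.\<close>

lemma grade_lifts_Theta:
  assumes "p \<in> vanishing_cycle a b (seg a b j)"
  shows "lifts_arg (grade j p) (Theta a b p)"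
proof -
  have Th: "Theta a b (node (\<sigma> * int b - 2 * int j)) =
      of_real (1 / real (a + b)) * cis (real_of_int (2 * int j - \<sigma> * int b) * half_width)" if s: "\<sigma> \<in> {1, -1}" for \<sigma> :: int
  proof -
    have "Theta a b (node (\<sigma> * int b - 2 * int j)) = 1 / (of_nat (a + b) * cis (real_of_int (\<sigma> * int b - 2 * int j) * half_width))"
      using Theta_fiber[OF _ tip(2)[OF s, of j]] unfolding tip(1)[OF s, of j] tip(3)[OF s, of j] by simp
    also have "\<dots> = of_real (1 / real (a + b)) * inverse (cis (real_of_int (\<sigma> * int b - 2 * int j) * half_width))"
      by (simp add: divide_inverse del: cis_inverse of_nat_add)
    also have "inverse (cis (real_of_int (\<sigma> * int b - 2 * int j) * half_width)) = cis (real_of_int (2 * int j - \<sigma> * int b) * half_width)"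
      unfolding cis_inverse by (simp add: algebra_simps)
    finally show ?thesis .
  qed
  have l: "1 / real (a + b) \<noteq> 0" "- (1 / real (a + b)) \<noteq> 0" using pos by simp_all
  from assms consider "p = node (1 * int b - 2 * int j)" | "p = node (- 1 * int b - 2 * int j)"
    unfolding vanishing_cycle_eq by auto
  then show ?thesis
  proof cases
    case 1
    have "real_of_int (2 * int j - 1 * int b) * half_width + pi = grade j p"
      unfolding 1 using grade_tips(1)[of j] half_width_mult(2) by (simp add: algebra_simps)
    then have "cis (real_of_int (2 * int j - 1 * int b) * half_width) = - cis (grade j p)"
      by (metis minus_cis minus_minus)
    then have "Theta a b p = of_real (- (1 / real (a + b))) * cis (grade j p)"
      unfolding 1 using Th[of 1] by simp
    then show ?thesis using l(2) by (rule lifts_argI)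
  next
    case 2
    have "real_of_int (2 * int j - - 1 * int b) * half_width = grade j p"
      unfolding 2 using grade_tips(2)[of j] by (simp add: algebra_simps)
    then have "Theta a b p = of_real (1 / real (a + b)) * cis (grade j p)"
      unfolding 2 using Th[of "-1"] by simp
    then show ?thesis using l(1) by (rule lifts_argI)
  qed
qed

lemma arm_inj:
  assumes "\<bar>x\<bar> \<le> half_width" "\<bar>y\<bar> \<le> half_width" "par (rot j * arm x) = par (rot j * arm y)"
  shows "x = y"
  using assms angle_par by metis

definition sweep :: "real \<Rightarrow> real" where
  "sweep s = (2 * s - 1) * half_width"

text \<open>The logarithmic derivative of \<open>rot j * arm (sweep s)\<close> with respect to
\<open>s\<close>.\<close>

definition velocity :: "real \<Rightarrow> complex" where
  "velocity s = of_real (2 * half_width) * Complex (log_slope (sweep s)) 1"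

lemma sweep: "s \<in> {0..1} \<Longrightarrow> \<bar>sweep s\<bar> \<le> half_width" "sweep ` {0..1} = {-half_width..half_width}" "inj sweep"
proof -
  show le: "\<bar>sweep s\<bar> \<le> half_width" if "s \<in> {0..1}" for s
  proof -
    have "\<bar>2 * s - 1\<bar> * half_width \<le> 1 * half_width" using that half_width_pos(1) by (intro mult_right_mono) auto
    then show ?thesis using half_width_pos(1) by (simp add: sweep_def abs_mult)
  qed
  have "sweep s \<in> {-half_width..half_width}" if "s \<in> {0..1}" for s
    using le[OF that] by (auto simp: abs_le_iff)
  moreover have "x \<in> sweep ` {0..1}" if "x \<in> {-half_width..half_width}" for x
    using that half_width_pos(1) by (intro image_eqI[of _ _ "(x / half_width + 1) / 2"]) (auto simp: sweep_def field_simps)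
  ultimately show "sweep ` {0..1} = {-half_width..half_width}" by blast
  show "inj sweep" using half_width_pos(1) by (auto intro!: injI simp: sweep_def)
qed

lemma regular_param_thimble:
  "regular_param (\<lambda>s. par (rot j * arm (sweep s)))
     (\<lambda>s. tangent (rot j * arm (sweep s)) (velocity s)) (thimble a b (seg a b j))"
  unfolding regular_param_def
proof (intro conjI ballI)
  let ?t = "\<lambda>s. rot j * arm (sweep s)"
  show "inj_on (\<lambda>s. par (?t s)) {0..1}"
    using arm_inj sweep(1) sweep(3) by (intro inj_onI) (metis injD)
  show "(\<lambda>s. par (?t s)) ` {0..1} = thimble a b (seg a b j)"
    unfolding thimble_eq sweep(2)[symmetric] by (simp only: image_image)
  have cs: "continuous_on {0..1} sweep" unfolding sweep_def[abs_def] by (intro continuous_intros)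
  have ct: "continuous_on {0..1} ?t"
    by (intro continuous_intros continuous_on_compose2[OF continuous_on_arm[OF order_refl] cs])
       (simp add: sweep(2))
  have "continuous_on {0..1} (\<lambda>s. log_slope (sweep s))"
    by (rule continuous_on_compose2[OF continuous_on_log_slope[OF order_refl] cs]) (simp add: sweep(2))
  then have "continuous_on {0..1} velocity"
    unfolding velocity_def[abs_def] Complex_eq by (intro continuous_intros)
  moreover have "continuous_on {0..1} (\<lambda>s. tangent (f s) (v s))"
    if "continuous_on {0..1} f" "continuous_on {0..1} v" "\<And>s. f s \<noteq> 0" for f v :: "real \<Rightarrow> complex"
    unfolding tangent_def using that by (intro continuous_intros) auto
  ultimately show "continuous_on {0..1} (\<lambda>s. tangent (?t s) (velocity s))"
    using ct by simp
  fix s :: real assume s: "s \<in> {0..1}"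
  have v: "velocity s \<noteq> 0" using half_width_pos(1) by (simp add: velocity_def complex_eq_iff)
  have "(sweep has_vector_derivative 2 * half_width) (at s)"
    unfolding sweep_def[abs_def] has_real_derivative_iff_has_vector_derivative[symmetric]
    by (auto intro!: derivative_eq_intros)
  from vector_diff_chain_at[OF this arm_deriv[OF sweep(1)[OF s]]]
  have "((\<lambda>s. arm (sweep s)) has_vector_derivative (2 * half_width) *\<^sub>R (arm (sweep s) * Complex (log_slope (sweep s)) 1)) (at s)"
    by (simp only: o_def)
  then have "(?t has_vector_derivative rot j * ((2 * half_width) *\<^sub>R (arm (sweep s) * Complex (log_slope (sweep s)) 1))) (at s)"
    by (rule has_vector_derivative_mult_right)
  also have "rot j * ((2 * half_width) *\<^sub>R (arm (sweep s) * Complex (log_slope (sweep s)) 1)) = velocity s * ?t s"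
    by (simp add: velocity_def scaleR_conv_of_real mult_ac)
  finally have t': "(?t has_vector_derivative velocity s * ?t s) (at s)" .
  have nz: "?t s \<noteq> 0" by simp
  have "((\<lambda>z. z ^ b) has_field_derivative of_nat b * ?t s ^ (b - 1)) (at (?t s))"
    by (auto intro!: derivative_eq_intros)
  from field_vector_diff_chain_at[OF t' this]
  have "((\<lambda>s. ?t s ^ b) has_vector_derivative velocity s * ?t s * (of_nat b * ?t s ^ (b - 1))) (at s)"
    by (simp only: o_def)
  also have "velocity s * ?t s * (of_nat b * ?t s ^ (b - 1)) = of_nat b * (?t s) ^ b * velocity s"
  proof -
    have "u * z * (c * z ^ (b - 1)) = c * z ^ b * u" for u z c :: complex
      using pos by (cases b) auto
    then show ?thesis .
  qed
  finally have d1: "((\<lambda>s. ?t s ^ b) has_vector_derivative of_nat b * (?t s) ^ b * velocity s) (at s)" .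
  have "((\<lambda>z. inverse z ^ a) has_field_derivative - (of_nat a * inverse (?t s) ^ (a - 1) * inverse (?t s) ^ 2)) (at (?t s))"
    using nz by (auto intro!: derivative_eq_intros simp: power2_eq_square)
  from field_vector_diff_chain_at[OF t' this]
  have "((\<lambda>s. inverse (?t s) ^ a) has_vector_derivative
      velocity s * ?t s * - (of_nat a * inverse (?t s) ^ (a - 1) * inverse (?t s) ^ 2)) (at s)"
    by (simp only: o_def)
  also have "velocity s * ?t s * - (of_nat a * inverse (?t s) ^ (a - 1) * inverse (?t s) ^ 2) =
      - (of_nat a * inverse (?t s) ^ a * velocity s)"
  proof -
    have "u * z * - (c * inverse z ^ (a - 1) * inverse z ^ 2) = - (c * inverse z ^ a * u)"
      if "z \<noteq> 0" for u z c :: complex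
      using pos that by (cases a) (auto simp: power2_eq_square)
    then show ?thesis using nz .
  qed
  finally have d2: "((\<lambda>s. inverse (?t s) ^ a) has_vector_derivative - (of_nat a * inverse (?t s) ^ a * velocity s)) (at s)" .
  have "((\<lambda>s. par (?t s)) has_vector_derivative tangent (?t s) (velocity s)) (at s)"
    unfolding par_def tangent_def by (rule has_vector_derivative_Pair[OF d1 d2])
  then show "((\<lambda>s. par (?t s)) has_vector_derivative tangent (?t s) (velocity s)) (at s within {0..1})"
    by (rule has_vector_derivative_at_within)
  show "tangent (?t s) (velocity s) \<noteq> 0"
    using v nz pos by (simp add: tangent_def prod_eq_iff)
qed

lemma continuous_on_phase: "continuous_on (thimble a b (seg a b j)) (phase j)"
proof -
  let ?D = "thimble a b (seg a b j)"
  have sub: "?D \<subseteq> LG_X a b" unfolding thimble_eq using par_in_LG_X by auto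
  have D: "\<exists>x. \<bar>x\<bar> \<le> half_width \<and> coord p / rot j = arm x \<and> angle j p = x" if p: "p \<in> ?D" for p
  proof -
    obtain x where "x \<in> {-half_width..half_width}" "p = par (rot j * arm x)" using p unfolding thimble_eq by blast
    then show ?thesis
      by (intro exI[of _ x]) (simp add: angle_par coord_par abs_le_iff)
  qed
  have "continuous_on ?D (\<lambda>p. coord p / rot j)"
    by (intro continuous_intros continuous_on_subset[OF continuous_on_coord sub]) simp
  then have angle_at: "continuous_on ?D (angle j)"
    unfolding angle_def[abs_def]
    by (rule continuous_on_Arg') (use D arm_not_nonpos in metis)
  have "continuous_on ?D (\<lambda>p. log_slope (angle j p))"
  proof (rule continuous_on_compose2[OF continuous_on_log_slope[OF order_refl] angle_at])
    show "angle j ` ?D \<subseteq> {-half_width..half_width}"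
    proof
      fix x assume "x \<in> angle j ` ?D"
      then obtain p where "p \<in> ?D" "x = angle j p" by blast
      with D[of p] show "x \<in> {-half_width..half_width}" by (auto simp: abs_le_iff)
    qed
  qed
  then have "continuous_on ?D (\<lambda>p. Complex (log_slope (angle j p)) 1)"
    unfolding Complex_eq by (intro continuous_intros)
  then show ?thesis
    unfolding phase_def[abs_def] by (rule continuous_on_Arg') (simp add: complex_nonpos_Reals_iff)
qed

lemma is_grading_grade: "is_grading a b (seg a b j) (grade j)"
  unfolding is_grading_def
proof (intro conjI ballI exI)
  show "lifts_arg (grade j p) (Theta a b p)" if "p \<in> vanishing_cycle a b (seg a b j)" for p
    by (rule grade_lifts_Theta[OF that])
  show "regular_param (\<lambda>s. par (rot j * arm (sweep s)))
     (\<lambda>s. tangent (rot j * arm (sweep s)) (velocity s)) (thimble a b (seg a b j))"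
    by (rule regular_param_thimble)
  show "continuous_on (thimble a b (seg a b j)) (phase j)"
    by (rule continuous_on_phase)
  show "grade j p = phase j p - (- 2 * real j * half_width)" for p
    by (simp add: grade_def)
  fix s :: real assume s: "s \<in> {0..1}"
  have "Omega a b (par (rot j * arm (sweep s))) (tangent (rot j * arm (sweep s)) (velocity s)) = velocity s"
    by (rule Omega_tangent) simp
  moreover have "phase j (par (rot j * arm (sweep s))) = Arg (velocity s)"
    using half_width_pos(1) by (simp add: phase_def angle_par[OF sweep(1)[OF s]] velocity_def del: of_real_mult)
  ultimately show "lifts_arg (phase j (par (rot j * arm (sweep s))))
      (Omega a b (par (rot j * arm (sweep s))) (tangent (rot j * arm (sweep s)) (velocity s)))"
    unfolding lifts_arg_def by (intro exI[of _ 0]) simp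
qed

text \<open>Two indices that occur here agree modulo \<open>2 (a + b)\<close> only if half their difference is
divisible by \<open>a + b\<close>, and half differences of tips of distinct cycles are small.\<close>

lemma node_eq_iff_small:
  assumes "i < j" "j < a + b"
  shows "node (int b - 2 * int i) = node (- int b - 2 * int j) \<longleftrightarrow> j = i + a"
    and "node (- int b - 2 * int i) = node (int b - 2 * int j) \<longleftrightarrow> j = i + b"
    and "node (int b - 2 * int i) \<noteq> node (int b - 2 * int j)"
    and "node (- int b - 2 * int i) \<noteq> node (- int b - 2 * int j)"
proof -
  have half: "node m = node n \<longleftrightarrow> int (a + b) dvd k" if "m - n = 2 * k" for m n k
    unfolding node_eq_iff that by (rule dvd_times_left_cancel_iff) simp
  have small: "int (a + b) dvd k \<longleftrightarrow> k = 0" if "\<bar>k\<bar> < int (a + b)" for k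
    using that zdvd_imp_le[of "int (a + b)" "\<bar>k\<bar>"] by (cases "k = 0") auto
  \<comment> \<open>\<open>b + j - i\<close> lies strictly between 0 and \<open>2 (a + b)\<close>; subtracting \<open>a + b\<close> makes it small.\<close>
  have shift: "l dvd m \<longleftrightarrow> l dvd m - l" for l m :: int
    by (metis diff_add_cancel dvd_add_triv_right_iff)
  have "int (a + b) dvd int b + (int j - int i) \<longleftrightarrow> int (a + b) dvd (int b + (int j - int i)) - int (a + b)"
    by (rule shift)
  also have "\<dots> \<longleftrightarrow> j = i + a"
    using assms pos by (subst small) auto
  finally show "node (int b - 2 * int i) = node (- int b - 2 * int j) \<longleftrightarrow> j = i + a"
    by (subst half[of _ _ "int b + (int j - int i)"]) auto
  show "node (- int b - 2 * int i) = node (int b - 2 * int j) \<longleftrightarrow> j = i + b"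
    using assms pos by (subst half[of _ _ "int j - int i - int b"], simp, subst small) auto
  show "node (int b - 2 * int i) \<noteq> node (int b - 2 * int j)"
    "node (- int b - 2 * int i) \<noteq> node (- int b - 2 * int j)"
    using assms by (subst half[of _ _ "int j - int i"], simp, subst small; auto)+
qed

text \<open>The point shared for \<open>j = i + a\<close> is the upper tip over \<open>i\<close> and the lower tip
over \<open>j\<close>; for \<open>j = i + b\<close> the roles are exchanged. In both cases the gradings differ by
\<open>a + b\<close> half widths, that is by \<open>\<pi>\<close>.\<close>

lemma vanishing_cycles_degree_one:
  "degree_one_cycles a b (seg a b) grade (\<lambda>j. node (int b - 2 * int j)) (\<lambda>j. node (- int b - 2 * int j))"
proof
  show "a > 0" "b > 0" by (rule pos)+
  have inter: "vanishing_cycle a b (seg a b i) \<inter> vanishing_cycle a b (seg a b j) =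
      {p. j = i + a \<and> p = node (int b - 2 * int i) \<or> j = i + b \<and> p = node (- int b - 2 * int i)}"
    if "i < j" "j < a + b" for i j
  proof -
    have "{A, B} \<inter> {C, D} = {p. A = D \<and> p = A \<or> B = C \<and> p = B}" if "A \<noteq> C" "B \<noteq> D" for A B C D :: point
      using that by blast
    from this[OF node_eq_iff_small(3,4)[OF that]] show ?thesis
      unfolding vanishing_cycle_eq node_eq_iff_small(1,2)[OF that] .
  qed
  show "vanishing_cycle a b (seg a b i) \<inter> vanishing_cycle a b (seg a b j) =
      {p. j = i + a \<and> p = node (int b - 2 * int i) \<or> j = i + b \<and> p = node (- int b - 2 * int i)}"
    if "i < j" "j < a + b" for i j
    by (rule inter[OF that])
  show "node (int b - 2 * int i) \<noteq> node (- int b - 2 * int i)" for i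
  proof
    assume "node (int b - 2 * int i) = node (- int b - 2 * int i)"
    then have "2 * int (a + b) dvd 2 * int b"
      unfolding node_eq_iff by (simp only: diff_diff_eq2) simp
    then show False using pos zdvd_imp_le[of "2 * int (a + b)" "2 * int b"] by simp
  qed
  show "point_degree grade i j p = 1"
    if ij: "i < j" "j < a + b" and p: "p \<in> vanishing_cycle a b (seg a b i) \<inter> vanishing_cycle a b (seg a b j)" for i j p
  proof -
    have pw: "pi = (real a + real b) * half_width" using half_width_mult(2) by (simp add: distrib_right)
    from p consider "j = i + a" "p = node (int b - 2 * int i)" | "j = i + b" "p = node (- int b - 2 * int i)"
      unfolding inter[OF ij] by blast
    then have "grade j p - grade i p = pi"
    proof cases
      case 1
      have "p = node (- int b - 2 * int j)"
        unfolding 1(2) node_eq_iff_small(1)[OF ij] by (rule 1(1))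
      then have "grade j p = (real b + 2 * real j) * half_width" by (simp only: grade_tips(2))
      moreover have "grade i p = (real a + 2 * real i) * half_width" unfolding 1(2) by (rule grade_tips(1))
      moreover have "real j = real i + real a" using 1(1) by simp
      ultimately show ?thesis unfolding pw by (simp add: algebra_simps)
    next
      case 2
      have "p = node (int b - 2 * int j)"
        unfolding 2(2) node_eq_iff_small(2)[OF ij] by (rule 2(1))
      then have "grade j p = (real a + 2 * real j) * half_width" by (simp only: grade_tips(1))
      moreover have "grade i p = (real b + 2 * real i) * half_width" unfolding 2(2) by (rule grade_tips(2))
      moreover have "real j = real i + real b" using 2(1) by simp
      ultimately show ?thesis unfolding pw by (simp add: algebra_simps)
    qed
    then show ?thesis by (simp add: point_degree_def)
  qed
qed

end

theorem theorem3p4: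
  fixes a b :: nat
  assumes "a > 0" and "b > 0" and "coprime a b"
  shows "\<exists>\<phi>. (\<forall>j<a + b. is_grading a b (seg a b j) (\<phi> j)) \<and>
           ainf_is_dg (Lag_vc a b (seg a b) \<phi>) \<and>
           (\<forall>\<theta> :: complex^2^2. (\<forall>i j. \<theta> $ i $ j \<noteq> 0) \<longrightarrow>
              dg_equivalent (dg_of_ainf (Lag_vc a b (seg a b) \<phi>)) (C_theta a b \<theta>))"
proof -
  interpret coprime_pair a b by (rule coprime_pair.intro) (use assms in auto)
  interpret degree_one_cycles a b "seg a b" grade "\<lambda>j. node (int b - 2 * int j)" "\<lambda>j. node (- int b - 2 * int j)"
    by (rule vanishing_cycles_degree_one)
  show ?thesis
    using is_grading_grade ainf_is_dg_Lag dg_equivalent_C_theta by blast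
qed

end
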